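(* Let $(\sigma,\tau)$ be uniformly distributed on $S_n\times S_n$ and let $S(\sigma,\tau)$ be the associated square-tiled surface with $n$ squares. Then, as $n\to\infty$, $$\Pr[S(\sigma,\tau)\text{ is a holonomy torus}]=\frac1e+O(n^{-1}),\qquad \Pr[S(\sigma,\tau)\text{ is a visibility torus}]=1-O\left(\frac{n}{2^{n/2}}\right).$$
   Context: $S_n$ is the symmetric group on $\{1,\dots,n\}$. For $(\sigma,\tau)\in S_n\times S_n$, $S(\sigma,\tau)$ is the (possibly disconnected) closed translation surface obtained from $n$ unit squares labelled $1,\dots,n$ by gluing sides by translations: the right side of square $i$ is glued to the left side of square $\sigma(i)$, and the top side of square $i$ is glued to the bottom side of square $\tau(i)$. Cone points are points with total angle $>2\pi$. A saddle connection is a straight-line local geodesic segment whose endpoints are cone points and with no cone points in its interior; on a connected component without cone points, one point is marked and saddle connections are segments from the marked point to itself with no marked point in the interior. The holonomy vector of a saddle connection (with either orientation) is its Euclidean displacement vector. $\mathrm{Hol}(S)\subset\mathbb{Z}^2$ is the set of holonomy vectors of all saddle connections of $S$ (for disconnected $S$, the union over the connected components). Let $\mathrm{RP}=\mathrm{SL}_2(\mathbb{Z})\cdot(1,0)$, the set of vectors of $\mathbb{Z}^2$ with relatively prime components. $S$ is a holonomy torus if $\mathrm{Hol}(S)=\mathrm{RP}$, and a visibility torus if $\mathrm{Hol}(S)\supset\mathrm{RP}$. *)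

theory Defs
  imports "HOL-Probability.Probability" "HOL-Library.Landau_Symbols" "HOL-Combinatorics.Permutations"
begin

section \<open>Square-tiled surfaces\<close>

text \<open>
  The point \<open>(i, (x, y))\<close> is the point with coordinates \<open>(x, y)\<close> in the unit square
  labelled \<open>i\<close>.
\<close>

definition squares :: "nat \<Rightarrow> (nat \<times> real \<times> real) set" where
  "squares n = {1..n} \<times> {0..1} \<times> {0..1}"

definition side_gluing ::
  "nat \<Rightarrow> (nat \<Rightarrow> nat) \<Rightarrow> (nat \<Rightarrow> nat) \<Rightarrow> (nat \<times> real \<times> real) rel" where
  "side_gluing n \<sigma> \<tau> =
     {((i, 1, y), (\<sigma> i, 0, y)) | i y. i \<in> {1..n} \<and> y \<in> {0..1}} \<union>
     {((i, x, 1), (\<tau> i, x, 0)) | i x. i \<in> {1..n} \<and> x \<in> {0..1}}"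

definition gluing_equiv ::
  "nat \<Rightarrow> (nat \<Rightarrow> nat) \<Rightarrow> (nat \<Rightarrow> nat) \<Rightarrow> (nat \<times> real \<times> real) rel" where
  "gluing_equiv n \<sigma> \<tau> =
     (side_gluing n \<sigma> \<tau> \<union> (side_gluing n \<sigma> \<tau>)\<inverse>)\<^sup>* \<inter> (squares n \<times> squares n)"

text \<open>Points of the surface are the equivalence classes of points of the squares.\<close>

definition surface ::
  "nat \<Rightarrow> (nat \<Rightarrow> nat) \<Rightarrow> (nat \<Rightarrow> nat) \<Rightarrow> (nat \<times> real \<times> real) set set" where
  "surface n \<sigma> \<tau> = squares n // gluing_equiv n \<sigma> \<tau>"

definition surface_pt ::
  "nat \<Rightarrow> (nat \<Rightarrow> nat) \<Rightarrow> (nat \<Rightarrow> nat) \<Rightarrow> nat \<times> real \<times> real \<Rightarrow> (nat \<times> real \<times> real) set" where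
  "surface_pt n \<sigma> \<tau> p = gluing_equiv n \<sigma> \<tau> `` {p}"

text \<open>The quotient topology; the factor \<open>nat\<close> carries the discrete topology.\<close>

definition surface_topology ::
  "nat \<Rightarrow> (nat \<Rightarrow> nat) \<Rightarrow> (nat \<Rightarrow> nat) \<Rightarrow> (nat \<times> real \<times> real) set topology" where
  "surface_topology n \<sigma> \<tau> =
     topology (\<lambda>U. U \<subseteq> surface n \<sigma> \<tau> \<and>
       openin (top_of_set (squares n)) {p \<in> squares n. surface_pt n \<sigma> \<tau> p \<in> U})"

lemma openin_surface_topology:
  "openin (surface_topology n \<sigma> \<tau>) U \<longleftrightarrow> U \<subseteq> surface n \<sigma> \<tau> \<and>
     openin (top_of_set (squares n)) {p \<in> squares n. surface_pt n \<sigma> \<tau> p \<in> U}"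
proof -
  have "istopology (\<lambda>U. U \<subseteq> surface n \<sigma> \<tau> \<and>
          openin (top_of_set (squares n)) {p \<in> squares n. surface_pt n \<sigma> \<tau> p \<in> U})"
    unfolding istopology_def
  proof (intro conjI allI impI)
    fix S T
    assume "S \<subseteq> surface n \<sigma> \<tau> \<and>
              openin (top_of_set (squares n)) {p \<in> squares n. surface_pt n \<sigma> \<tau> p \<in> S}"
       and "T \<subseteq> surface n \<sigma> \<tau> \<and>
              openin (top_of_set (squares n)) {p \<in> squares n. surface_pt n \<sigma> \<tau> p \<in> T}"
    moreover have "{p \<in> squares n. surface_pt n \<sigma> \<tau> p \<in> S \<inter> T} =
        {p \<in> squares n. surface_pt n \<sigma> \<tau> p \<in> S} \<inter> {p \<in> squares n. surface_pt n \<sigma> \<tau> p \<in> T}"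
      by blast
    ultimately show "S \<inter> T \<subseteq> surface n \<sigma> \<tau>"
      and "openin (top_of_set (squares n)) {p \<in> squares n. surface_pt n \<sigma> \<tau> p \<in> S \<inter> T}"
      by (auto simp only: intro!: openin_Int)
  next
    fix K
    assume *: "\<forall>U\<in>K. U \<subseteq> surface n \<sigma> \<tau> \<and>
              openin (top_of_set (squares n)) {p \<in> squares n. surface_pt n \<sigma> \<tau> p \<in> U}"
    show "\<Union>K \<subseteq> surface n \<sigma> \<tau>" using * by blast
    have "{p \<in> squares n. surface_pt n \<sigma> \<tau> p \<in> \<Union>K} =
        (\<Union>U\<in>K. {p \<in> squares n. surface_pt n \<sigma> \<tau> p \<in> U})"
      by blast
    then show "openin (top_of_set (squares n)) {p \<in> squares n. surface_pt n \<sigma> \<tau> p \<in> \<Union>K}"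
      using * by (simp only:) (intro openin_Union, blast)
  qed
  then show ?thesis
    by (simp add: surface_topology_def topology_inverse')
qed

section \<open>Cone points\<close>

definition square_angle :: "nat \<times> real \<times> real \<Rightarrow> real" where
  "square_angle = (\<lambda>(i, x, y).
     if x \<in> {0, 1} \<and> y \<in> {0, 1} then pi / 2
     else if x \<in> {0, 1} \<or> y \<in> {0, 1} then pi
     else 2 * pi)"

definition total_angle :: "(nat \<times> real \<times> real) set \<Rightarrow> real" where
  "total_angle P = (\<Sum>p\<in>P. square_angle p)"

definition cone_points ::
  "nat \<Rightarrow> (nat \<Rightarrow> nat) \<Rightarrow> (nat \<Rightarrow> nat) \<Rightarrow> (nat \<times> real \<times> real) set set" where
  "cone_points n \<sigma> \<tau> = {P \<in> surface n \<sigma> \<tau>. total_angle P > 2 * pi}"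

text \<open>
  Which point is marked on a component without cone points is an arbitrary choice. It does not
  affect the holonomy vectors, since such a component is a flat torus and hence homogeneous.
\<close>

definition marked_points ::
  "nat \<Rightarrow> (nat \<Rightarrow> nat) \<Rightarrow> (nat \<Rightarrow> nat) \<Rightarrow> (nat \<times> real \<times> real) set set" where
  "marked_points n \<sigma> \<tau> =
     {(SOME P. P \<in> C) | C.
        C \<in> connected_components_of (surface_topology n \<sigma> \<tau>) \<and> C \<inter> cone_points n \<sigma> \<tau> = {}}"

section \<open>Saddle connections and holonomy\<close>

text \<open>
  A path \<open>\<gamma>\<close> on \<open>[0, 1]\<close> that can be cut into finitely many pieces, each lying in
  one square and having constant velocity \<open>v\<close> in the coordinates of that square. As all gluings
  are translations, these are, as long as no cone point is met in the interior, exactly the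
  straight-line local geodesics with displacement \<open>v\<close>, parametrised proportionally to length:
  around a point of total angle \<open>2 * pi\<close> there is only one germ of a segment leaving in
  direction \<open>v\<close>.
\<close>

definition straight_segment ::
  "nat \<Rightarrow> (nat \<Rightarrow> nat) \<Rightarrow> (nat \<Rightarrow> nat) \<Rightarrow> real \<times> real \<Rightarrow>
     (real \<Rightarrow> (nat \<times> real \<times> real) set) \<Rightarrow> bool" where
  "straight_segment n \<sigma> \<tau> v \<gamma> \<longleftrightarrow> v \<noteq> 0 \<and>
     (\<exists>(m::nat) (t :: nat \<Rightarrow> real) (i :: nat \<Rightarrow> nat) (a :: nat \<Rightarrow> real \<times> real).
        t 0 = 0 \<and> t m = 1 \<and>
        (\<forall>k<m. t k < t (Suc k) \<and>
           (\<forall>s\<in>{t k..t (Suc k)}.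
              (i k, a k + s *\<^sub>R v) \<in> squares n \<and>
              \<gamma> s = surface_pt n \<sigma> \<tau> (i k, a k + s *\<^sub>R v))))"

definition saddle_connection ::
  "nat \<Rightarrow> (nat \<Rightarrow> nat) \<Rightarrow> (nat \<Rightarrow> nat) \<Rightarrow> real \<times> real \<Rightarrow>
     (real \<Rightarrow> (nat \<times> real \<times> real) set) \<Rightarrow> bool" where
  "saddle_connection n \<sigma> \<tau> v \<gamma> \<longleftrightarrow>
     straight_segment n \<sigma> \<tau> v \<gamma> \<and>
     \<gamma> 0 \<in> cone_points n \<sigma> \<tau> \<union> marked_points n \<sigma> \<tau> \<and>
     \<gamma> 1 \<in> cone_points n \<sigma> \<tau> \<union> marked_points n \<sigma> \<tau> \<and>
     (\<forall>s\<in>{0<..<1}. \<gamma> s \<notin> cone_points n \<sigma> \<tau> \<union> marked_points n \<sigma> \<tau>)"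

text \<open>
  Both orientations are accounted for: \<open>\<lambda>s. \<gamma> (1 - s)\<close> is a saddle connection with
  displacement \<open>- v\<close> whenever \<open>\<gamma>\<close> is one with displacement \<open>v\<close>.
\<close>

definition Hol :: "nat \<Rightarrow> (nat \<Rightarrow> nat) \<Rightarrow> (nat \<Rightarrow> nat) \<Rightarrow> (real \<times> real) set" where
  "Hol n \<sigma> \<tau> = {v. \<exists>\<gamma>. saddle_connection n \<sigma> \<tau> v \<gamma>}"

definition RP :: "(real \<times> real) set" where
  "RP = {(real_of_int a, real_of_int b) | a b. coprime a b}"

definition holonomy_torus :: "nat \<Rightarrow> (nat \<Rightarrow> nat) \<Rightarrow> (nat \<Rightarrow> nat) \<Rightarrow> bool" where
  "holonomy_torus n \<sigma> \<tau> \<longleftrightarrow> Hol n \<sigma> \<tau> = RP"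

definition visibility_torus :: "nat \<Rightarrow> (nat \<Rightarrow> nat) \<Rightarrow> (nat \<Rightarrow> nat) \<Rightarrow> bool" where
  "visibility_torus n \<sigma> \<tau> \<longleftrightarrow> RP \<subseteq> Hol n \<sigma> \<tau>"

section \<open>Random square-tiled surfaces\<close>

definition sym_group :: "nat \<Rightarrow> (nat \<Rightarrow> nat) set" where
  "sym_group n = {\<sigma>. \<sigma> permutes {1..n}}"

definition random_pair :: "nat \<Rightarrow> ((nat \<Rightarrow> nat) \<times> (nat \<Rightarrow> nat)) pmf" where
  "random_pair n = pmf_of_set (sym_group n \<times> sym_group n)"

end

theory Submission
  imports Defs
begin

text \<open>
  Call a square \<open>j\<close> regular if \<open>\<sigma> (\<tau> j) = \<tau> (\<sigma> j)\<close>, and let \<open>X\<close> be the number of regular squares. Every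
  vertex of the surface is the top right corner of some square, and it is a cone point unless that square
  is regular.

  Geometry. For a primitive direction \<open>v\<close>, translation by \<open>v\<close> permutes the \<open>n\<close> rays in direction \<open>v\<close> that start
  at vertices. If \<open>2 * X < n\<close>, one of these rays therefore starts at a cone point and has a cone point as
  the first vertex it meets, and the surface is a visibility torus. If \<open>X = 0\<close>, then every vertex is a cone point
  and nothing but primitive vectors occurs. If \<open>X > 0\<close> and the surface is a holonomy torus, then the set of regular
  squares is invariant under \<open>\<sigma>\<close> and \<open>\<tau>\<close>, for otherwise an edge joins a cone point to a regular
  vertex and its prolongation is a saddle connection of length at least 2.

  Probability. Given \<open>\<sigma>\<close>, composing \<open>\<tau>\<close> with the transposition of \<open>\<tau> (\<sigma> j)\<close> and \<open>\<sigma> (\<tau> j)\<close> makes \<open>j\<close>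
  regular, typically raises \<open>X\<close> by 1, and is \<open>(n - 1)\<close>-to-1. Stein's method turns this into
  \<open>P (X = 0) = 1 / e + O (1 / n)\<close>. A union bound over sets of regular squares on which \<open>\<tau>\<close> is determined by its other
  values shows that \<open>P (2 * X \<ge> n) = O (2 powr (- n / 2))\<close>, and a proper invariant set exists with
  probability \<open>O (1 / n)\<close>.
\<close>

section \<open>Many regular squares\<close>

text \<open>Fixed points of \<sigma> are the obstacle in the counting. Such a \<open>j\<close> is
  regular exactly if \<open>\<tau> j\<close> is fixed as well, so its regularity does not tie one
  value of \<tau> to another: it can neither be switched on nor enter the union bound. Both
  arguments therefore work with \<sigma> given, treat its fixed points apart, and afterwards use
  that a random \<sigma> has few of them: a quarter of all points only with exponentially small
  probability, and a bounded number in the second moment. The union bound has up to 2^n terms, but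
  each is at most 1/b! with b at least n/12, which beats every exponential; hence the generous
  constants. In the geometry, the obstacle is the marked points, whose position is arbitrary. They
  lie on components without cone points, and a line starting at a cone point never enters such a
  component, so it is enough to keep track of which squares belong to one.\<close>

lemma card_permutes_prescribed:
  assumes "finite A" and "B \<subseteq> A"
  shows "card {p. p permutes A \<and> (\<forall>x\<in>B. p x = h x)} \<le> fact (card A - card B)"
proof (cases "{p. p permutes A \<and> (\<forall>x\<in>B. p x = h x)} = {}")
  case True
  then show ?thesis by (metis card.empty le0)
next
  case False
  then obtain p0 where p0: "p0 permutes A" "\<forall>x\<in>B. p0 x = h x" by blast
  \<comment> \<open>Two such permutations differ by one that fixes \<open>B\<close> pointwise, so
    composing with the inverse of one solution \<open>p0\<close> lands in the permutations of
    \<open>A - B\<close>.\<close>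
  have "card {p. p permutes A \<and> (\<forall>x\<in>B. p x = h x)} \<le> card {q. q permutes (A - B)}"
  proof (rule card_inj_on_le)
    show "inj_on (\<lambda>p. inv p0 \<circ> p) {p. p permutes A \<and> (\<forall>x\<in>B. p x = h x)}"
    proof (rule inj_onI)
      fix p q assume "inv p0 \<circ> p = inv p0 \<circ> q"
      then have "p0 \<circ> (inv p0 \<circ> p) = p0 \<circ> (inv p0 \<circ> q)" by simp
      then show "p = q"
        by (simp add: o_assoc permutes_inv_o(1)[OF p0(1)])
    qed
    show "(\<lambda>p. inv p0 \<circ> p) ` {p. p permutes A \<and> (\<forall>x\<in>B. p x = h x)} \<subseteq> {q. q permutes (A - B)}"
    proof clarify
      fix p assume p: "p permutes A" "\<forall>x\<in>B. p x = h x"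
      have 1: "(inv p0 \<circ> p) permutes A"
        using p0(1) p(1) by (intro permutes_compose permutes_inv)
      show "(inv p0 \<circ> p) permutes (A - B)"
      proof (rule permutes_superset[OF 1])
        fix x assume "x \<in> A - (A - B)"
        then have "p x = p0 x" using p0 p by auto
        then show "(inv p0 \<circ> p) x = x"
          by (simp add: permutes_inverses(2)[OF p0(1)])
      qed
    qed
    show "finite {q. q permutes (A - B)}" using assms by (simp add: finite_permutations)
  qed
  also have "\<dots> = fact (card (A - B))"
    using assms by (simp add: card_permutations)
  also have "card (A - B) = card A - card B"
    using assms by (meson card_Diff_subset finite_subset)
  finally show ?thesis .
qed

text \<open>Composing a member of \<open>T\<close> with a permutation of \<open>B\<close> changes
  its values on \<open>B\<close> only, and the values outside recover it. So the
  \<open>fact (card B)\<close> rearrangements of all members are distinct.\<close>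

lemma card_permutes_determined:
  assumes "finite A" and "B \<subseteq> A" and "T \<subseteq> {p. p permutes A}"
    and det: "\<And>p q. p \<in> T \<Longrightarrow> q \<in> T \<Longrightarrow> (\<And>x. x \<in> A - B \<Longrightarrow> p x = q x) \<Longrightarrow> p = q"
  shows "card T * fact (card B) \<le> fact (card A)"
proof -
  have fB: "finite B" using assms finite_subset by blast
  have "card (T \<times> {r. r permutes B}) \<le> card {p. p permutes A}"
  proof (rule card_inj_on_le)
    show "inj_on (\<lambda>(p, r). p \<circ> r) (T \<times> {r. r permutes B})"
    proof (rule inj_onI, clarify)
      fix p r q s
      assume T: "p \<in> T" "q \<in> T" and r: "r permutes B" "s permutes B" and e: "p \<circ> r = q \<circ> s"
      have pq: "p = q"
      proof (rule det[OF T])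
        fix x assume "x \<in> A - B"
        then have "r x = x" "s x = x" using r by (auto simp: permutes_def)
        then show "p x = q x" using e by (metis comp_apply)
      qed
      have "p permutes A" using T assms by blast
      then have "inj p" by (rule permutes_inj)
      then have "r = s" using e pq by (auto simp: fun_eq_iff inj_eq)
      with pq show "p = q \<and> r = s" by blast
    qed
    show "(\<lambda>(p, r). p \<circ> r) ` (T \<times> {r. r permutes B}) \<subseteq> {p. p permutes A}"
      using assms by (auto intro!: permutes_compose intro: permutes_subset)
    show "finite {p. p permutes A}" using assms by (simp add: finite_permutations)
  qed
  then show ?thesis
    using assms fB by (simp add: card_cartesian_product card_permutations)
qed

text \<open>
  The top right corner of square \<open>j\<close> has total angle \<open>2 * pi\<close> exactly if the two ways of passing to the
  square diagonally across it agree, so these are the squares whose top right corner is not a cone point.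
\<close>

definition commuting :: "'a set \<Rightarrow> ('a \<Rightarrow> 'a) \<Rightarrow> ('a \<Rightarrow> 'a) \<Rightarrow> 'a set" where
  "commuting A \<sigma> \<tau> = {j \<in> A. \<sigma> (\<tau> j) = \<tau> (\<sigma> j)}"

lemma commuting_subset: "commuting A \<sigma> \<tau> \<subseteq> A"
  by (auto simp: commuting_def)

text \<open>A largest admissible \<open>B\<close> is taken: a point of \<open>C\<close> that cannot
  be added lies in \<open>B\<close>, in its image or in its preimage under \<sigma>. The factor 3 is
  attained when \<open>C\<close> is a 3-cycle.\<close>

lemma independent_subset:
  assumes "finite C" and "inj \<sigma>" and "\<And>x. x \<in> C \<Longrightarrow> \<sigma> x \<noteq> x"
  obtains B where "B \<subseteq> C" "B \<inter> \<sigma> ` B = {}" "card C \<le> 3 * card B"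
proof -
  let ?P = "\<lambda>B. B \<subseteq> C \<and> B \<inter> \<sigma> ` B = {}"
  have "\<exists>B. ?P B \<and> (\<forall>B'. ?P B' \<longrightarrow> card B' \<le> card B)"
    by (rule ex_has_greatest_nat[where b = "Suc (card C)" and k = "{}"])
      (auto simp: assms less_Suc_eq_le card_mono)
  then obtain B where B: "?P B" and max: "\<And>B'. ?P B' \<Longrightarrow> card B' \<le> card B" by blast
  have fB: "finite B" using B assms finite_subset by blast
  have "C \<subseteq> B \<union> \<sigma> ` B \<union> {x \<in> C. \<sigma> x \<in> B}"
  proof
    fix x assume x: "x \<in> C"
    show "x \<in> B \<union> \<sigma> ` B \<union> {x \<in> C. \<sigma> x \<in> B}"
    proof (rule ccontr)
      assume n: "x \<notin> B \<union> \<sigma> ` B \<union> {x \<in> C. \<sigma> x \<in> B}"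
      have "?P (insert x B)" using n x B assms(3)[OF x] by auto
      then have "card (insert x B) \<le> card B" by (rule max)
      then show False using n fB by auto
    qed
  qed
  then have "card C \<le> card (B \<union> \<sigma> ` B \<union> {x \<in> C. \<sigma> x \<in> B})"
    using assms fB by (intro card_mono) auto
  also have "\<dots> \<le> card B + card (\<sigma> ` B) + card {x \<in> C. \<sigma> x \<in> B}"
    by (meson card_Un_le le_trans add_mono order_refl)
  also have "card (\<sigma> ` B) = card B"
    using assms(2) by (meson card_image inj_on_subset subset_UNIV)
  also have "card {x \<in> C. \<sigma> x \<in> B} \<le> card B"
    using fB assms(2) by (intro card_inj_on_le[of \<sigma>]) (auto intro: inj_on_subset)
  finally have "card C \<le> 3 * card B" by simp
  with B that show ?thesis by blast
qed

text \<open>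
  The factor \<open>2 ^ n\<close> pays for a union bound over the subsets of an \<open>n\<close>-element set.
\<close>

lemma exp_growth_le_fact:
  assumes "n \<le> 12 * b"
  shows "2 ^ n * 2 powr (real n / 2) \<le> exp (2 ^ 18) * fact b"
proof -
  have "2 ^ n * 2 powr (real n / 2) = 2 powr (3 * real n / 2)"
    by (simp add: powr_realpow[symmetric] powr_add[symmetric])
  \<comment> \<open>By \<open>n \<le> 12 * b\<close> the exponent \<open>3 * n / 2\<close> is at
    most \<open>18 * b\<close>; the power is then compared with a single term of the exponential
    series at \<open>2 ^ 18\<close>.\<close>
  also have "\<dots> \<le> 2 powr (real (18 * b))"
    using assms by (intro powr_mono) auto
  also have "\<dots> = (2 ^ 18) ^ b"
    by (subst powr_realpow) (simp_all add: power_mult)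
  also have "\<dots> \<le> exp (2 ^ 18) * fact b"
  proof -
    have "((2::real) ^ 18) ^ b /\<^sub>R fact b \<le> (\<Sum>k. (2 ^ 18) ^ k /\<^sub>R fact k)"
      using sum_le_suminf[OF summable_exp_generic[of "(2::real) ^ 18"], of "{b}"] by simp
    also have "\<dots> = exp (2 ^ 18)" by (simp add: exp_def)
    finally show ?thesis by (simp add: divide_simps)
  qed
  finally show ?thesis .
qed

text \<open>The union bound for both kinds of exceptional permutations. Each \<open>B\<close> has at
  least a twelfth of the points and forces as many values, those on \<open>f B\<close>, so
  \<open>T B\<close> is a fraction of at most \<open>1 / fact (card B)\<close> of all permutations.
  This outweighs the at most \<open>2 ^ card A\<close> choices of \<open>B\<close>.\<close>

lemma card_union_determined_le:
  assumes A: "finite A" and T: "\<And>B. B \<in> \<B> \<Longrightarrow> T B \<subseteq> {p. p permutes A}"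
    and \<B>: "\<And>B. B \<in> \<B> \<Longrightarrow> B \<subseteq> A \<and> card A \<le> 12 * card B"
    and det: "\<And>B p q. B \<in> \<B> \<Longrightarrow> p \<in> T B \<Longrightarrow> q \<in> T B \<Longrightarrow> (\<And>x. x \<in> A - f B \<Longrightarrow> p x = q x) \<Longrightarrow> p = q"
    and f: "\<And>B. B \<in> \<B> \<Longrightarrow> f B \<subseteq> A \<and> card (f B) = card B"
  shows "card (\<Union>B\<in>\<B>. T B) * 2 powr (real (card A) / 2) \<le> exp (2 ^ 18) * fact (card A)"
proof -
  let ?n = "card A"
  have sub: "\<B> \<subseteq> Pow A" using \<B> by blast
  have fin: "finite \<B>" using A sub by (meson finite_Pow_iff finite_subset)
  have c: "card \<B> \<le> 2 ^ ?n"
    using card_mono[OF _ sub] A by (simp add: card_Pow)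
  have one: "real (card (T B)) * (2 ^ ?n * 2 powr (real ?n / 2)) \<le> exp (2 ^ 18) * fact ?n"
    if B: "B \<in> \<B>" for B
  proof -
    have "card (T B) * fact (card (f B)) \<le> fact ?n"
      using card_permutes_determined[OF A _ T[OF B] det[OF B]] f[OF B] by blast
    then have 1: "real (card (T B)) * fact (card B) \<le> fact ?n"
      using f[OF B] by (metis of_nat_fact of_nat_le_iff of_nat_mult)
    have "real (card (T B)) * (2 ^ ?n * 2 powr (real ?n / 2)) \<le> real (card (T B)) * (exp (2 ^ 18) * fact (card B))"
      using \<B>[OF B] by (intro mult_left_mono exp_growth_le_fact) auto
    also have "\<dots> = exp (2 ^ 18) * (real (card (T B)) * fact (card B))" by simp
    also have "\<dots> \<le> exp (2 ^ 18) * fact ?n" using 1 by (intro mult_left_mono) auto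
    finally show ?thesis .
  qed
  have "real (card (\<Union>B\<in>\<B>. T B)) * (2 ^ ?n * 2 powr (real ?n / 2))
      \<le> (\<Sum>B\<in>\<B>. real (card (T B))) * (2 ^ ?n * 2 powr (real ?n / 2))"
    using card_UN_le[OF fin, of T] by (intro mult_right_mono) (auto simp flip: of_nat_sum)
  also have "\<dots> \<le> (\<Sum>B\<in>\<B>. exp (2 ^ 18) * fact ?n)"
    unfolding sum_distrib_right by (intro sum_mono one)
  also have "\<dots> \<le> 2 ^ ?n * (exp (2 ^ 18) * fact ?n)"
  proof -
    have "real (card \<B>) \<le> real (2 ^ ?n)" using c by (simp only: of_nat_le_iff)
    then have "real (card \<B>) * (exp (2 ^ 18) * fact ?n) \<le> real (2 ^ ?n) * (exp (2 ^ 18) * fact ?n)"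
      by (rule mult_right_mono) simp
    then show ?thesis by simp
  qed
  finally show ?thesis by simp
qed

lemma card_many_fixed_points_le:
  assumes A: "finite A"
  shows "card {\<sigma>. \<sigma> permutes A \<and> card A \<le> 4 * card {j\<in>A. \<sigma> j = j}} * 2 powr (real (card A) / 2)
    \<le> exp (2 ^ 18) * fact (card A)"
proof -
  \<comment> \<open>A set of fixed points forces its own values. It has a quarter of the points,
    more than the twelfth that the union bound asks for.\<close>
  let ?\<B> = "{B. B \<subseteq> A \<and> card A \<le> 12 * card B}"
  let ?T = "\<lambda>B. {\<sigma>. \<sigma> permutes A \<and> (\<forall>j\<in>B. \<sigma> j = j)}"
  have 1: "real (card (\<Union>B\<in>?\<B>. ?T B)) * 2 powr (real (card A) / 2) \<le> exp (2 ^ 18) * fact (card A)"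
  proof (rule card_union_determined_le[OF A, where f = id])
    fix B p q
    assume B: "B \<in> ?\<B>" and p: "p \<in> ?T B" and q: "q \<in> ?T B"
      and e: "\<And>x. x \<in> A - id B \<Longrightarrow> p x = q x"
    show "p = q"
    proof
      fix x show "p x = q x"
        using e[of x] p q by (cases "x \<in> A"; cases "x \<in> B") (auto simp: permutes_def)
    qed
  qed auto
  have "{\<sigma>. \<sigma> permutes A \<and> card A \<le> 4 * card {j\<in>A. \<sigma> j = j}} \<subseteq> (\<Union>B\<in>?\<B>. ?T B)"
  proof clarify
    fix \<sigma> assume "\<sigma> permutes A" "card A \<le> 4 * card {j\<in>A. \<sigma> j = j}"
    then show "\<sigma> \<in> (\<Union>B\<in>?\<B>. ?T B)"
      by (intro UN_I[of "{j\<in>A. \<sigma> j = j}"]) auto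
  qed
  then have "card {\<sigma>. \<sigma> permutes A \<and> card A \<le> 4 * card {j\<in>A. \<sigma> j = j}} \<le> card (\<Union>B\<in>?\<B>. ?T B)"
    using A by (intro card_mono finite_subset[OF _ finite_permutations[OF A]]) auto
  then have "real (card {\<sigma>. \<sigma> permutes A \<and> card A \<le> 4 * card {j\<in>A. \<sigma> j = j}}) * 2 powr (real (card A) / 2)
     \<le> real (card (\<Union>B\<in>?\<B>. ?T B)) * 2 powr (real (card A) / 2)"
    by (intro mult_right_mono) auto
  with 1 show ?thesis by linarith
qed

text \<open>A commuting \<open>j\<close> makes \<open>\<tau> (\<sigma> j)\<close> equal to
  \<open>\<sigma> (\<tau> j)\<close>, so if \<open>B\<close> consists of commuting points and is
  disjoint from its image, the values of \<tau> elsewhere force those on the image. Fixed points of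
  \<sigma> give no such relation and are discarded: \<open>1/2 - 1/4\<close> of all points remain,
  and a third of these, the twelfth of the union bound, can be chosen disjoint from its
  image.\<close>

lemma card_many_commuting_le:
  assumes A: "finite A" and \<sigma>: "\<sigma> permutes A" and few: "4 * card {j\<in>A. \<sigma> j = j} < card A"
  shows "card {\<tau>. \<tau> permutes A \<and> card A \<le> 2 * card (commuting A \<sigma> \<tau>)} * 2 powr (real (card A) / 2)
    \<le> exp (2 ^ 18) * fact (card A)"
proof -
  let ?\<B> = "{B. B \<subseteq> A \<and> card A \<le> 12 * card B \<and> B \<inter> \<sigma> ` B = {}}"
  let ?T = "\<lambda>B. {\<tau>. \<tau> permutes A \<and> B \<subseteq> commuting A \<sigma> \<tau>}"
  have inj: "inj \<sigma>" using \<sigma> by (rule permutes_inj)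
  have 1: "real (card (\<Union>B\<in>?\<B>. ?T B)) * 2 powr (real (card A) / 2) \<le> exp (2 ^ 18) * fact (card A)"
  proof (rule card_union_determined_le[OF A, where f = "\<lambda>B. \<sigma> ` B"])
    fix B p q
    assume B: "B \<in> ?\<B>" and p: "p \<in> ?T B" and q: "q \<in> ?T B"
      and e: "\<And>x. x \<in> A - \<sigma> ` B \<Longrightarrow> p x = q x"
    show "p = q"
    proof
      fix x
      consider "x \<in> A - \<sigma> ` B" | "x \<notin> A" | j where "j \<in> B" "x = \<sigma> j" by blast
      then show "p x = q x"
      proof cases
        case 3
        then have "p j = q j" using B by (intro e) blast
        moreover have "p (\<sigma> j) = \<sigma> (p j)" "q (\<sigma> j) = \<sigma> (q j)"
          using 3 p q by (auto simp: commuting_def)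
        ultimately show ?thesis using 3 by simp
      qed (use e p q in \<open>auto simp: permutes_def\<close>)
    qed
  next
    fix B assume B: "B \<in> ?\<B>"
    have "card (\<sigma> ` B) = card B" by (meson card_image inj_on_subset subset_UNIV inj)
    then show "\<sigma> ` B \<subseteq> A \<and> card (\<sigma> ` B) = card B"
      using B permutes_image[OF \<sigma>] by blast
  qed auto
  have "{\<tau>. \<tau> permutes A \<and> card A \<le> 2 * card (commuting A \<sigma> \<tau>)} \<subseteq> (\<Union>B\<in>?\<B>. ?T B)"
  proof clarify
    fix \<tau> assume \<tau>: "\<tau> permutes A" "card A \<le> 2 * card (commuting A \<sigma> \<tau>)"
    let ?F = "{j\<in>A. \<sigma> j = j}"
    let ?C = "commuting A \<sigma> \<tau> - ?F"
    have "finite ?C" using A commuting_subset by (metis finite_Diff finite_subset)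
    then obtain B where B: "B \<subseteq> ?C" "B \<inter> \<sigma> ` B = {}" "card ?C \<le> 3 * card B"
      by (rule independent_subset[OF _ inj]) (auto simp: commuting_def)
    have "card (commuting A \<sigma> \<tau>) \<le> card ?C + card ?F"
    proof -
      have "card (commuting A \<sigma> \<tau>) \<le> card (?C \<union> ?F)"
        using A by (intro card_mono) (auto simp: commuting_def)
      then show ?thesis by (meson card_Un_le le_trans)
    qed
    then have "card A \<le> 12 * card B" using few \<tau>(2) B(3) by linarith
    then show "\<tau> \<in> (\<Union>B\<in>?\<B>. ?T B)"
      using B \<tau>(1) by (intro UN_I[of B]) (auto simp: commuting_def)
  qed
  then have "card {\<tau>. \<tau> permutes A \<and> card A \<le> 2 * card (commuting A \<sigma> \<tau>)} \<le> card (\<Union>B\<in>?\<B>. ?T B)"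
    using A by (intro card_mono finite_subset[OF _ finite_permutations[OF A]]) auto
  then have "real (card {\<tau>. \<tau> permutes A \<and> card A \<le> 2 * card (commuting A \<sigma> \<tau>)}) * 2 powr (real (card A) / 2)
     \<le> real (card (\<Union>B\<in>?\<B>. ?T B)) * 2 powr (real (card A) / 2)"
    by (intro mult_right_mono) auto
  with 1 show ?thesis by linarith
qed

text \<open>The \<sigma> with many fixed points are counted with all \<tau>, since for them
  commuting may carry no information: for the identity every point commutes. The two kinds of
  \<sigma> contribute equally to the factor 2.\<close>

lemma card_pairs_many_commuting_le:
  assumes A: "finite A"
  shows "card {(\<sigma>, \<tau>). \<sigma> permutes A \<and> \<tau> permutes A \<and> card A \<le> 2 * card (commuting A \<sigma> \<tau>)}
           * 2 powr (real (card A) / 2)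
    \<le> 2 * exp (2 ^ 18) * (fact (card A))\<^sup>2"
proof -
  let ?S = "{\<sigma>. \<sigma> permutes A}"
  let ?E = "{\<sigma>. \<sigma> permutes A \<and> card A \<le> 4 * card {j\<in>A. \<sigma> j = j}}"
  let ?G = "\<lambda>\<sigma>. {\<tau>. \<tau> permutes A \<and> card A \<le> 2 * card (commuting A \<sigma> \<tau>)}"
  let ?p = "2 powr (real (card A) / 2)"
  let ?K = "exp (2 ^ 18) * fact (card A) :: real"
  have fS: "finite ?S" using A by (rule finite_permutations)
  have cS: "card ?S = fact (card A)" using A by (simp add: card_permutations)
  have fE: "finite ?E" and fG: "finite (?G \<sigma>)" for \<sigma>
    by (rule finite_subset[OF _ fS], blast)+
  have "{(\<sigma>, \<tau>). \<sigma> permutes A \<and> \<tau> permutes A \<and> card A \<le> 2 * card (commuting A \<sigma> \<tau>)}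
     \<subseteq> ?E \<times> ?S \<union> Sigma (?S - ?E) ?G"
    by blast
  then have "card {(\<sigma>, \<tau>). \<sigma> permutes A \<and> \<tau> permutes A \<and> card A \<le> 2 * card (commuting A \<sigma> \<tau>)}
     \<le> card (?E \<times> ?S \<union> Sigma (?S - ?E) ?G)"
    using fS fE fG by (intro card_mono) auto
  also have "\<dots> \<le> card (?E \<times> ?S) + card (Sigma (?S - ?E) ?G)" by (rule card_Un_le)
  also have "\<dots> = card ?E * fact (card A) + (\<Sum>\<sigma>\<in>?S - ?E. card (?G \<sigma>))"
    using fS fG cS by (simp add: card_cartesian_product)
  finally have "real (card {(\<sigma>, \<tau>). \<sigma> permutes A \<and> \<tau> permutes A \<and> card A \<le> 2 * card (commuting A \<sigma> \<tau>)})
      \<le> real (card ?E * fact (card A) + (\<Sum>\<sigma>\<in>?S - ?E. card (?G \<sigma>)))"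
    by (simp only: of_nat_le_iff)
  then have "real (card {(\<sigma>, \<tau>). \<sigma> permutes A \<and> \<tau> permutes A \<and> card A \<le> 2 * card (commuting A \<sigma> \<tau>)}) * ?p
      \<le> real (card ?E * fact (card A) + (\<Sum>\<sigma>\<in>?S - ?E. card (?G \<sigma>))) * ?p"
    by (rule mult_right_mono) simp
  also have "\<dots> = fact (card A) * (card ?E * ?p) + (\<Sum>\<sigma>\<in>?S - ?E. card (?G \<sigma>) * ?p)"
    by (simp add: algebra_simps sum_distrib_left)
  also have "\<dots> \<le> fact (card A) * ?K + (\<Sum>\<sigma>\<in>?S - ?E. ?K)"
    by (intro add_mono mult_left_mono sum_mono card_many_fixed_points_le[OF A] card_many_commuting_le[OF A]) auto
  also have "\<dots> \<le> fact (card A) * ?K + fact (card A) * ?K"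
  proof -
    have "card (?S - ?E) \<le> fact (card A)" using fS cS card_mono[of ?S "?S - ?E"] by auto
    then have "real (card (?S - ?E)) \<le> fact (card A)" 
      by (subst of_nat_fact[symmetric]) (simp only: of_nat_le_iff)
    then have "real (card (?S - ?E)) * ?K \<le> fact (card A) * ?K" by (intro mult_right_mono) auto
    then show ?thesis by simp
  qed
  finally show ?thesis by (simp add: power2_eq_square mult_ac)
qed

section \<open>Invariant sets\<close>

text \<open>By finiteness such a \<sigma> maps \<open>B\<close> onto itself, hence also its
  complement, and splits into a permutation of \<open>B\<close> and one of
  \<open>A - B\<close>.\<close>

lemma card_permutes_invariant:
  assumes A: "finite A" and B: "B \<subseteq> A"
  shows "card {\<sigma>. \<sigma> permutes A \<and> \<sigma> ` B \<subseteq> B} \<le> fact (card B) * fact (card A - card B)"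
proof -
  have fB: "finite B" using A B finite_subset by blast
  have fin: "finite ({p. p permutes B} \<times> {q. q permutes (A - B)})"
    using A fB by (simp add: finite_permutations)
  have "{\<sigma>. \<sigma> permutes A \<and> \<sigma> ` B \<subseteq> B}
      \<subseteq> (\<lambda>(p, q). p \<circ> q) ` ({p. p permutes B} \<times> {q. q permutes (A - B)})"
  proof clarify
    fix \<sigma> assume \<sigma>: "\<sigma> permutes A" "\<sigma> ` B \<subseteq> B"
    have inj: "inj \<sigma>" using \<sigma>(1) by (rule permutes_inj)
    have eq: "\<sigma> ` B = B"
      using \<sigma>(2) fB inj by (meson card_subset_eq card_image inj_on_subset subset_UNIV)
    define p where "p = (\<lambda>x. if x \<in> B then \<sigma> x else x)"
    define q where "q = (\<lambda>x. if x \<in> B then x else \<sigma> x)"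
    have out: "\<sigma> x \<notin> B" if "x \<notin> B" for x
      using that eq inj by (metis image_iff injD)
    have p: "p permutes B"
    proof (rule bij_imp_permutes)
      have "bij_betw \<sigma> B B" using eq inj by (simp add: bij_betw_def inj_on_subset[OF inj])
      then show "bij_betw p B B" by (simp add: p_def cong: bij_betw_cong)
    qed (simp add: p_def)
    have q: "q permutes (A - B)"
    proof (rule bij_imp_permutes)
      have "\<sigma> ` (A - B) = A - B"
        using permutes_image[OF \<sigma>(1)] eq inj by (simp add: image_set_diff)
      then have "bij_betw \<sigma> (A - B) (A - B)" by (simp add: bij_betw_def inj_on_subset[OF inj])
      then show "bij_betw q (A - B) (A - B)"
        by (rule bij_betw_cong[THEN iffD1, rotated]) (auto simp: q_def)
      show "q x = x" if "x \<notin> A - B" for x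
        using that \<sigma>(1) by (auto simp: q_def permutes_def)
    qed
    have "\<sigma> = p \<circ> q" using out by (auto simp: p_def q_def)
    with p q show "\<sigma> \<in> (\<lambda>(p, q). p \<circ> q) ` ({p. p permutes B} \<times> {q. q permutes (A - B)})"
      by (intro image_eqI[of _ _ "(p, q)"]) auto
  qed
  then have "card {\<sigma>. \<sigma> permutes A \<and> \<sigma> ` B \<subseteq> B} \<le> card ({p. p permutes B} \<times> {q. q permutes (A - B)})"
    using fin surj_card_le by blast
  also have "\<dots> = fact (card B) * fact (card A - card B)"
    using A B fB by (simp add: card_cartesian_product card_permutations card_Diff_subset)
  finally show ?thesis .
qed

text \<open>Log-convexity of the factorial: for a given sum \<open>k + m\<close> the product grows
  towards the ends of the range, and the right side is its value at \<open>2\<close> and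
  \<open>k + m - 2\<close>.\<close>

lemma fact_mult_fact_le:
  assumes "2 \<le> k" and "2 \<le> m"
  shows "fact k * fact m \<le> (2 * fact (k + m - 2) :: nat)"
  using assms(1)
proof (induction k rule: dec_induct)
  case base
  then show ?case by (simp add: fact_2)
next
  case (step k)
  have "fact (Suc k) * fact m = Suc k * (fact k * fact m :: nat)" by (simp only: fact_Suc mult.assoc of_nat_id)
  also have "\<dots> \<le> Suc k * (2 * fact (k + m - 2))" using step by (intro mult_left_mono) auto
  also have "\<dots> \<le> (k + m - 1) * (2 * fact (k + m - 2))"
    using assms(2) by (intro mult_right_mono) auto
  also have "\<dots> = 2 * fact (Suc k + m - 2)"
  proof -
    have "Suc k + m - 2 = Suc (k + m - 2)" using step by simp
    moreover have "k + m - 1 = Suc (k + m - 2)" using step by simp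
    ultimately show ?thesis by (simp only: fact_Suc of_nat_id mult.left_commute)
  qed
  finally show ?case .
qed

text \<open>The end terms \<open>k = 1\<close> and \<open>k = n - 1\<close> are
  \<open>fact (n - 1)\<close> each; the others are at most \<open>2 * fact (n - 2)\<close>, and at
  most \<open>n - 1\<close> of them add up to \<open>2 * fact (n - 1)\<close> or less.\<close>

lemma sum_fact_mult_fact_le:
  assumes "2 \<le> n"
  shows "(\<Sum>k=1..<n. fact k * fact (n - k)) * real n \<le> 4 * fact n"
proof -
  have le: "fact k * fact (n - k) \<le> (2 * fact (n - 2) + (if k = 1 \<or> k = n - 1 then fact (n - 1) else 0) :: nat)"
    if k: "k \<in> {1..<n}" for k
  proof -
    consider "k = 1" | "k = n - 1" | "2 \<le> k" "2 \<le> n - k" using k by force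
    then show ?thesis
    proof cases
      case 3
      then have "fact k * fact (n - k) \<le> (2 * fact (k + (n - k) - 2) :: nat)" by (rule fact_mult_fact_le)
      also have "k + (n - k) - 2 = n - 2" using k by auto
      finally show ?thesis by simp
    qed (use assms in auto)
  qed
  have "(\<Sum>k=1..<n. fact k * fact (n - k) :: nat)
      \<le> (\<Sum>k=1..<n. 2 * fact (n - 2) + (if k = 1 \<or> k = n - 1 then fact (n - 1) else 0))"
    by (intro sum_mono le)
  also have "\<dots> = (n - 1) * (2 * fact (n - 2)) + (\<Sum>k=1..<n. if k = 1 \<or> k = n - 1 then fact (n - 1) else 0)"
    by (simp add: sum.distrib)
  also have "(\<Sum>k=1..<n. if k = 1 \<or> k = n - 1 then fact (n - 1) else 0 :: nat)
     = card ({1..<n} \<inter> {k. k = 1 \<or> k = n - 1}) * fact (n - 1)"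
    by (simp add: sum.If_cases)
  also have "\<dots> \<le> 2 * fact (n - 1)"
  proof -
    have "card ({1..<n} \<inter> {k. k = 1 \<or> k = n - 1}) \<le> card {1, n - 1}" by (intro card_mono) auto
    also have "\<dots> \<le> 2" by (simp add: card_insert_if)
    finally show ?thesis by simp
  qed
  also have "(n - 1) * (2 * fact (n - 2)) = (2 * fact (n - 1) :: nat)"
  proof -
    have "n - 1 = Suc (n - 2)" using assms by simp
    then show ?thesis by (simp only: fact_Suc of_nat_id mult.left_commute)
  qed
  finally have "(\<Sum>k=1..<n. fact k * fact (n - k) :: nat) * n \<le> (2 * fact (n - 1) + 2 * fact (n - 1)) * n"
    by (intro mult_right_mono) auto
  also have "\<dots> = 4 * fact n" 
  proof -
    have "n = Suc (n - 1)" using assms by simp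
    then have "(fact n :: nat) = n * fact (n - 1)" by (metis fact_Suc of_nat_id)
    then show ?thesis by simp
  qed
  finally have "real ((\<Sum>k=1..<n. fact k * fact (n - k) :: nat) * n) \<le> real (4 * fact n)"
    by (simp only: of_nat_le_iff)
  then show ?thesis by simp
qed

text \<open>Union bound over \<open>B\<close>, grouped by size \<open>k\<close>: the binomial
  coefficient cancels one of the two factors \<open>fact k * fact (card A - k)\<close> and leaves
  \<open>fact (card A)\<close> times a sum dominated by its ends, that is, by singletons and their
  complements.\<close>

lemma card_pairs_invariant_le:
  assumes A: "finite A" and n: "2 \<le> card A"
  shows "card {(\<sigma>, \<tau>). \<sigma> permutes A \<and> \<tau> permutes A \<and> (\<exists>B. B \<noteq> {} \<and> B \<subset> A \<and> \<sigma> ` B \<subseteq> B \<and> \<tau> ` B \<subseteq> B)}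
     * real (card A) \<le> 4 * (fact (card A))\<^sup>2"
proof -
  let ?n = "card A"
  let ?\<B> = "{B. B \<noteq> {} \<and> B \<subset> A}"
  let ?T = "\<lambda>B. {\<sigma>. \<sigma> permutes A \<and> \<sigma> ` B \<subseteq> B}"
  have fin: "finite ?\<B>" by (rule finite_subset[of _ "Pow A"]) (use A in auto)
  have fT: "finite (?T B)" for B
    by (rule finite_subset[OF _ finite_permutations[OF A]]) auto
  have cB: "card B \<in> {1..<?n}" if "B \<in> ?\<B>" for B
    using that A psubset_card_mono[of A B] finite_subset[of B A] by (auto simp: Suc_le_eq card_gt_0_iff)
  have "{(\<sigma>, \<tau>). \<sigma> permutes A \<and> \<tau> permutes A \<and> (\<exists>B. B \<noteq> {} \<and> B \<subset> A \<and> \<sigma> ` B \<subseteq> B \<and> \<tau> ` B \<subseteq> B)}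
     = (\<Union>B\<in>?\<B>. ?T B \<times> ?T B)"
    by blast
  then have "card {(\<sigma>, \<tau>). \<sigma> permutes A \<and> \<tau> permutes A \<and> (\<exists>B. B \<noteq> {} \<and> B \<subset> A \<and> \<sigma> ` B \<subseteq> B \<and> \<tau> ` B \<subseteq> B)}
     \<le> (\<Sum>B\<in>?\<B>. card (?T B \<times> ?T B))"
    using card_UN_le[OF fin, of "\<lambda>B. ?T B \<times> ?T B"] by presburger
  also have "\<dots> \<le> (\<Sum>B\<in>?\<B>. (fact (card B) * fact (?n - card B))\<^sup>2)"
    unfolding card_cartesian_product power2_eq_square
    using card_permutes_invariant[OF A] by (intro sum_mono mult_mono) auto
  also have "\<dots> = (\<Sum>k=1..<?n. \<Sum>B | B \<in> ?\<B> \<and> card B = k. (fact (card B) * fact (?n - card B))\<^sup>2)"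
    by (rule sum.group[symmetric, OF fin finite_atLeastLessThan]) (use cB in blast)
  also have "\<dots> = (\<Sum>k=1..<?n. (?n choose k) * (fact k * fact (?n - k))\<^sup>2)"
  proof (rule sum.cong[OF refl])
    fix k assume k: "k \<in> {1..<?n}"
    have "{B. B \<in> ?\<B> \<and> card B = k} = {B. B \<subseteq> A \<and> card B = k}"
      using k by auto
    then show "(\<Sum>B | B \<in> ?\<B> \<and> card B = k. (fact (card B) * fact (?n - card B))\<^sup>2)
       = (?n choose k) * (fact k * fact (?n - k))\<^sup>2"
      using n_subsets[OF A, of k] by (simp add: sum.cong)
  qed
  also have "\<dots> = (\<Sum>k=1..<?n. fact ?n * (fact k * fact (?n - k)))"
  proof (rule sum.cong[OF refl])
    fix k assume k: "k \<in> {1..<?n}"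
    have "fact k * fact (?n - k) * (?n choose k) = fact ?n" using k by (intro binomial_fact_lemma) auto
    then show "(?n choose k) * (fact k * fact (?n - k))\<^sup>2 = fact ?n * (fact k * fact (?n - k))"
      by (simp add: power2_eq_square algebra_simps)
  qed
  also have "\<dots> = fact ?n * (\<Sum>k=1..<?n. fact k * fact (?n - k))" by (simp add: sum_distrib_left)
  finally have "card {(\<sigma>, \<tau>). \<sigma> permutes A \<and> \<tau> permutes A \<and> (\<exists>B. B \<noteq> {} \<and> B \<subset> A \<and> \<sigma> ` B \<subseteq> B \<and> \<tau> ` B \<subseteq> B)}
    \<le> fact ?n * (\<Sum>k=1..<?n. fact k * fact (?n - k))" .
  then have "real (card {(\<sigma>, \<tau>). \<sigma> permutes A \<and> \<tau> permutes A \<and> (\<exists>B. B \<noteq> {} \<and> B \<subset> A \<and> \<sigma> ` B \<subseteq> B \<and> \<tau> ` B \<subseteq> B)})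
    \<le> real (fact ?n * (\<Sum>k=1..<?n. fact k * fact (?n - k)))"
    by (simp only: of_nat_le_iff)
  then have "real (card {(\<sigma>, \<tau>). \<sigma> permutes A \<and> \<tau> permutes A \<and> (\<exists>B. B \<noteq> {} \<and> B \<subset> A \<and> \<sigma> ` B \<subseteq> B \<and> \<tau> ` B \<subseteq> B)}) * real ?n
    \<le> real (fact ?n * (\<Sum>k=1..<?n. fact k * fact (?n - k))) * real ?n"
    by (rule mult_right_mono) simp
  also have "\<dots> = fact ?n * ((\<Sum>k=1..<?n. fact k * fact (?n - k)) * real ?n)" by simp
  also have "\<dots> \<le> fact ?n * (4 * fact ?n)"
    by (intro mult_left_mono sum_fact_mult_fact_le n) simp
  finally show ?thesis by (simp add: power2_eq_square mult_ac)
qed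

section \<open>Stein's method\<close>

text \<open>
  The solution of Stein's equation for the Poisson distribution of mean 1 and the set \<open>{0}\<close>, see
  \<open>stein_eq\<close> below. The value at 0 is arbitrary.
\<close>

definition stein :: "nat \<Rightarrow> real" where
  "stein k = (if k = 0 then 0 else fact (k - 1) * (\<Sum>i. 1 / fact (i + k)) / exp 1)"

lemma sums_inverse_fact: "(\<lambda>i. 1 / fact i :: real) sums exp 1"
  using exp_converges[of "1::real"] by (simp add: divide_inverse scaleR_conv_of_real)

lemma summable_inverse_fact_shift: "summable (\<lambda>i. 1 / fact (i + k) :: real)"
  using sums_inverse_fact sums_summable summable_ignore_initial_segment by blast

text \<open>On average over a random \<open>k\<close>, the right side is the probability of
  \<open>k = 0\<close> minus 1/e, so it suffices to estimate the left side. The recursion holds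
  because the tails of the series of e from \<open>k\<close> and from \<open>k + 1\<close> differ in
  the single term 1/k!.\<close>

lemma stein_eq: "stein (k + 1) - real k * stein k = (if k = 0 then 1 else 0) - 1 / exp 1"
proof (cases "k = 0")
  case True
  have "(\<Sum>i. 1 / fact (i + 1) :: real) = (\<Sum>i. 1 / fact i) - (\<Sum>i<1. 1 / fact i)"
    by (rule suminf_minus_initial_segment) (rule sums_summable[OF sums_inverse_fact])
  then have "(\<Sum>i. 1 / fact (i + 1) :: real) = exp 1 - 1"
    by (simp add: sums_unique[OF sums_inverse_fact, symmetric] del: fact_Suc)
  then show ?thesis using True by (simp add: stein_def diff_divide_distrib del: fact_Suc)
next
  case False
  let ?S = "\<Sum>i. 1 / fact (i + k) :: real"
  have "(\<Sum>i. 1 / fact (i + (k + 1)) :: real) = ?S - 1 / fact k"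
    using suminf_minus_initial_segment[OF summable_inverse_fact_shift[of k], of 1]
    by (simp del: fact_Suc)
  then have "stein (k + 1) = fact k * (?S - 1 / fact k) / exp 1" by (simp only: stein_def) simp
  also have "\<dots> = fact k * ?S / exp 1 - 1 / exp 1" by (simp add: right_diff_distrib diff_divide_distrib)
  finally have "stein (k + 1) = fact k * ?S / exp 1 - 1 / exp 1" .
  moreover have "real k * stein k = real k * fact (k - 1) * ?S / exp 1"
    using False by (simp add: stein_def)
  moreover have "real k * fact (k - 1) = fact k" using False by (simp add: fact_reduce)
  ultimately show ?thesis using False by simp
qed

text \<open>Multiplied by \<open>fact (k - 1)\<close>, the tail is compared term by term with the
  whole series of e; the division by \<open>exp 1\<close> then leaves at most 1.\<close>

lemma stein_bounds: "0 \<le> stein k \<and> stein k \<le> 1"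
proof (cases "k = 0")
  case False
  have "fact (k - 1) * (\<Sum>i. 1 / fact (i + k) :: real) = (\<Sum>i. fact (k - 1) * (1 / fact (i + k)))"
    by (rule suminf_mult[symmetric, OF summable_inverse_fact_shift])
  also have "\<dots> \<le> (\<Sum>i. 1 / fact i)"
  proof (rule suminf_le)
    fix i
    have "fact (k - 1) * fact i dvd (fact (k - 1 + i) :: nat)" by (rule fact_fact_dvd_fact)
    then have "fact (k - 1) * fact i \<le> (fact (k - 1 + i) :: nat)" by (rule dvd_imp_le) simp
    also have "\<dots> \<le> fact (i + k)" by (rule fact_mono) simp
    finally have "real (fact (k - 1) * fact i) \<le> real (fact (i + k))" by (simp only: of_nat_le_iff)
    then show "fact (k - 1) * (1 / fact (i + k)) \<le> (1 / fact i :: real)" by (simp add: field_simps)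
  qed (rule summable_mult summable_inverse_fact_shift sums_summable[OF sums_inverse_fact])+
  also have "\<dots> = exp 1" using sums_inverse_fact sums_unique by metis
  finally have "fact (k - 1) * (\<Sum>i. 1 / fact (i + k) :: real) \<le> exp 1" .
  moreover have "0 \<le> (\<Sum>i. 1 / fact (i + k) :: real)"
    by (intro suminf_nonneg summable_inverse_fact_shift) simp
  ultimately show ?thesis using False by (simp add: stein_def)
qed (simp add: stein_def)

text \<open>Distinct natural numbers are at least 1 apart, and the values lie in the unit
  interval.\<close>

lemma stein_lipschitz: "\<bar>stein x - stein y\<bar> \<le> \<bar>real x - real y\<bar>"
proof (cases "x = y")
  case False
  then have "1 \<le> \<bar>real x - real y\<bar>" by linarith
  moreover have "\<bar>stein x - stein y\<bar> \<le> 1" using stein_bounds[of x] stein_bounds[of y] by linarith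
  ultimately show ?thesis by linarith
qed simp

text \<open>Here \<sigma> is fixed and only \<tau> is random. The final estimate depends on \<sigma>
  through the numbers of points fixed by it and by its square, over which an average is taken
  afterwards.\<close>

locale switching =
  fixes A :: "'a set" and \<sigma> :: "'a \<Rightarrow> 'a"
  assumes finA: "finite A" and perm: "\<sigma> permutes A" and nge2: "2 \<le> card A"
begin

abbreviation "Sy \<equiv> {\<tau>. \<tau> permutes A}"
abbreviation "C \<equiv> commuting A \<sigma>"
abbreviation "X \<tau> \<equiv> card (C \<tau>)"
abbreviation "Fix \<equiv> {j\<in>A. \<sigma> j = j}"
abbreviation "sw j \<tau> \<equiv> Transposition.transpose (\<tau> (\<sigma> j)) (\<sigma> (\<tau> j)) \<circ> \<tau>"
text \<open>The domain of the switch at a non-fixed \<open>j\<close>: the switch preserves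
  \<open>\<tau> j\<close>, and hence makes \<open>j\<close> commute, because \<open>\<tau> j\<close>
  is neither of the two exchanged values.\<close>

abbreviation "N j \<equiv> {\<tau>\<in>Sy. \<sigma> (\<tau> j) \<noteq> \<tau> j}"
abbreviation "I j \<equiv> {\<tau>\<in>Sy. j \<in> C \<tau>}"

lemma finSy: "finite Sy" using finA by (rule finite_permutations)

lemma cardSy: "card Sy = fact (card A)" using finA by (simp add: card_permutations)

lemma finC: "finite (C \<tau>)" using finA commuting_subset finite_subset by metis

lemma sigma_in: "\<sigma> x \<in> A \<longleftrightarrow> x \<in> A" using perm by (rule permutes_in_image)

lemma sigma_inj: "\<sigma> x = \<sigma> y \<longleftrightarrow> x = y" using permutes_inj[OF perm] by (simp add: inj_eq)

lemma tau_in: "\<tau> \<in> Sy \<Longrightarrow> \<tau> x \<in> A \<longleftrightarrow> x \<in> A" by (simp add: permutes_in_image)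

lemma tau_inj: "\<tau> \<in> Sy \<Longrightarrow> \<tau> x = \<tau> y \<longleftrightarrow> x = y"
  using permutes_inj[of \<tau> A] by (simp add: inj_eq)

lemma transpose_comp_permutes:
  "\<tau> \<in> Sy \<Longrightarrow> a \<in> A \<Longrightarrow> b \<in> A \<Longrightarrow> Transposition.transpose a b \<circ> \<tau> \<in> Sy"
  by (simp add: permutes_compose permutes_swap_id)

text \<open>
  Swapping two values of \<open>\<tau>\<close> makes \<open>j\<close> commute. The original \<open>\<tau>\<close> is recovered from the result and the
  overwritten value \<open>a = \<tau> (\<sigma> j)\<close>, which is unrestricted except for \<open>a \<noteq> \<tau> j\<close>.
\<close>

lemma sum_switch:
  assumes j: "j \<in> A" "\<sigma> j \<noteq> j"
  shows "(\<Sum>\<tau>\<in>N j. h (\<tau> (\<sigma> j)) (sw j \<tau>)) = (\<Sum>\<tau>\<in>I j. \<Sum>a\<in>A - {\<tau> j}. (h a \<tau> :: real))"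
proof -
  have "(\<Sum>\<tau>\<in>I j. \<Sum>a\<in>A - {\<tau> j}. h a \<tau>) = (\<Sum>(\<tau>, a)\<in>Sigma (I j) (\<lambda>\<tau>. A - {\<tau> j}). h a \<tau>)"
    using finA finSy by (subst sum.Sigma) auto
  also have "\<dots> = (\<Sum>\<tau>\<in>N j. h (\<tau> (\<sigma> j)) (sw j \<tau>))"
  proof (rule sum.reindex_bij_witness[where j = "\<lambda>(\<tau>, a). Transposition.transpose a (\<tau> (\<sigma> j)) \<circ> \<tau>"
        and i = "\<lambda>\<tau>. (sw j \<tau>, \<tau> (\<sigma> j))"])
    fix p assume p: "p \<in> Sigma (I j) (\<lambda>\<tau>. A - {\<tau> j})"
    obtain \<tau> a where p_eq: "p = (\<tau>, a)" by (cases p)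
    have \<tau>: "\<tau> \<in> Sy" and c: "\<sigma> (\<tau> j) = \<tau> (\<sigma> j)" and a: "a \<in> A" "a \<noteq> \<tau> j"
      using p p_eq by (auto simp: commuting_def)
    let ?\<rho> = "Transposition.transpose a (\<tau> (\<sigma> j)) \<circ> \<tau>"
    have ne: "\<tau> (\<sigma> j) \<noteq> \<tau> j" using j tau_inj[OF \<tau>] by simp
    have r1: "?\<rho> (\<sigma> j) = a" by simp
    have r2: "?\<rho> j = \<tau> j" using a ne by (simp add: Transposition.transpose_def)
    have r3: "?\<rho> \<in> Sy" using \<tau> a j by (intro transpose_comp_permutes) (auto simp: tau_in sigma_in)
    have r4: "sw j ?\<rho> = \<tau>"
      unfolding r1 r2 c by (simp add: o_assoc[symmetric] fun_eq_iff)
    show "(case p of (\<tau>, a) \<Rightarrow> Transposition.transpose a (\<tau> (\<sigma> j)) \<circ> \<tau>) \<in> N j"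
      using r3 r2 c ne p_eq by simp
    show "(sw j (case p of (\<tau>, a) \<Rightarrow> Transposition.transpose a (\<tau> (\<sigma> j)) \<circ> \<tau>),
           (case p of (\<tau>, a) \<Rightarrow> Transposition.transpose a (\<tau> (\<sigma> j)) \<circ> \<tau>) (\<sigma> j)) = p"
      using r4 r1 p_eq by simp
    show "h ((case p of (\<tau>, a) \<Rightarrow> Transposition.transpose a (\<tau> (\<sigma> j)) \<circ> \<tau>) (\<sigma> j))
        (sw j (case p of (\<tau>, a) \<Rightarrow> Transposition.transpose a (\<tau> (\<sigma> j)) \<circ> \<tau>)) = (case p of (\<tau>, a) \<Rightarrow> h a \<tau>)"
      using r4 r1 p_eq by simp
  next
    fix \<tau> assume \<tau>: "\<tau> \<in> N j"
    then have \<tau>S: "\<tau> \<in> Sy" and ne: "\<sigma> (\<tau> j) \<noteq> \<tau> j" by auto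
    have ne2: "\<tau> (\<sigma> j) \<noteq> \<tau> j" using j tau_inj[OF \<tau>S] by simp
    have s1: "sw j \<tau> j = \<tau> j" using ne ne2 by (simp add: Transposition.transpose_def)
    have s2: "sw j \<tau> (\<sigma> j) = \<sigma> (\<tau> j)" by simp
    have s3: "sw j \<tau> \<in> Sy" using \<tau>S j by (intro transpose_comp_permutes) (auto simp: tau_in sigma_in)
    show "(sw j \<tau>, \<tau> (\<sigma> j)) \<in> Sigma (I j) (\<lambda>\<tau>. A - {\<tau> j})"
      using s1 s2 s3 j ne2 tau_in[OF \<tau>S] by (auto simp: commuting_def sigma_in)
    show "(case (sw j \<tau>, \<tau> (\<sigma> j)) of (\<tau>, a) \<Rightarrow> Transposition.transpose a (\<tau> (\<sigma> j)) \<circ> \<tau>) = \<tau>"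
      unfolding prod.case s2 by (simp add: o_assoc[symmetric] fun_eq_iff)
  qed
  finally show ?thesis by simp
qed

lemma sum_switch':
  assumes j: "j \<in> A" "\<sigma> j \<noteq> j"
  shows "(\<Sum>\<tau>\<in>N j. h (sw j \<tau>)) = (real (card A) - 1) * (\<Sum>\<tau>\<in>I j. h \<tau>)"
proof -
  have "(\<Sum>\<tau>\<in>N j. h (sw j \<tau>)) = (\<Sum>\<tau>\<in>I j. \<Sum>a\<in>A - {\<tau> j}. h \<tau>)"
    using sum_switch[OF j, of "\<lambda>a. h"] .
  also have "\<dots> = (\<Sum>\<tau>\<in>I j. (real (card A) - 1) * h \<tau>)"
  proof (rule sum.cong[OF refl])
    fix \<tau> assume "\<tau> \<in> I j"
    then have "\<tau> j \<in> A" using j tau_in by blast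
    then have "card (A - {\<tau> j}) = card A - 1" using finA by simp
    then show "(\<Sum>a\<in>A - {\<tau> j}. h \<tau>) = (real (card A) - 1) * h \<tau>"
      using nge2 by (simp add: of_nat_diff)
  qed
  finally show ?thesis by (simp add: sum_distrib_left)
qed

text \<open>Besides \<open>\<sigma> j\<close>, the only argument at which the switch at
  \<open>j\<close> can change the value of \<tau>.\<close>

definition moved :: "'a \<Rightarrow> ('a \<Rightarrow> 'a) \<Rightarrow> 'a" where
  "moved j \<tau> = inv \<tau> (\<sigma> (\<tau> j))"

lemma moved: "\<tau> \<in> Sy \<Longrightarrow> \<tau> (moved j \<tau>) = \<sigma> (\<tau> j)"
  unfolding moved_def by (rule permutes_inverses(1)) simp

lemma moved_in: "\<tau> \<in> Sy \<Longrightarrow> j \<in> A \<Longrightarrow> moved j \<tau> \<in> A"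
  using moved[of \<tau> j] tau_in[of \<tau>] sigma_in by metis

lemma inv_sigma_in: "x \<in> A \<Longrightarrow> inv \<sigma> x \<in> A"
  by (meson permutes_in_image permutes_inv perm)

text \<open>Whether \<open>i\<close> commutes depends on the values of \<tau> at \<open>i\<close>
  and \<open>\<sigma> i\<close>, and the switch affects only those at \<open>\<sigma> j\<close> and
  \<open>moved j \<tau>\<close>. This leaves these two arguments and their preimages under \<sigma>
  as exceptions.\<close>

lemma commuting_sw_iff:
  assumes \<tau>: "\<tau> \<in> Sy" and i: "i \<notin> {j, \<sigma> j, moved j \<tau>, inv \<sigma> (moved j \<tau>)}"
  shows "i \<in> C (sw j \<tau>) \<longleftrightarrow> i \<in> C \<tau>"
proof -
  have "\<tau> i \<noteq> \<tau> (\<sigma> j)" "\<tau> i \<noteq> \<sigma> (\<tau> j)"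
    using i tau_inj[OF \<tau>] moved[OF \<tau>, of j, symmetric] by auto
  then have 1: "sw j \<tau> i = \<tau> i" by simp
  have "\<sigma> i \<noteq> moved j \<tau>" using i permutes_inverses(2)[OF perm, of i] by auto
  then have "\<tau> (\<sigma> i) \<noteq> \<tau> (\<sigma> j)" "\<tau> (\<sigma> i) \<noteq> \<sigma> (\<tau> j)"
    using i tau_inj[OF \<tau>] moved[OF \<tau>, of j, symmetric] sigma_inj by auto
  then have 2: "sw j \<tau> (\<sigma> i) = \<tau> (\<sigma> i)" by simp
  show ?thesis using 1 2 by (simp add: commuting_def)
qed

lemma X_eq_sum: "real (X \<tau>) = (\<Sum>i\<in>A. of_bool (i \<in> C \<tau>))"
proof -
  have "C \<tau> = {i\<in>A. i \<in> C \<tau>}" using commuting_subset by fastforce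
  then show ?thesis using finA by (simp add: of_bool_def sum.If_cases Int_def)
qed

text \<open>The point \<open>j\<close> accounts for the expected increase by 1, unless it commuted
  before. Each of the other affected points changes its state only if it commutes before or after
  the switch, so the sum \<open>e\<close> of both indicators bounds its effect.\<close>

lemma X_sw_diff:
  assumes \<tau>: "\<tau> \<in> N j" and j: "j \<in> A" "\<sigma> j \<noteq> j"
  defines "e \<equiv> (\<lambda>i. of_bool (i \<in> C \<tau>) + of_bool (i \<in> C (sw j \<tau>)))"
  shows "\<bar>real (X (sw j \<tau>)) - (real (X \<tau>) + 1)\<bar>
    \<le> of_bool (j \<in> C \<tau>) + e (\<sigma> j) + e (moved j \<tau>) + e (inv \<sigma> (moved j \<tau>))"
proof -
  have \<tau>S: "\<tau> \<in> Sy" and ne: "\<sigma> (\<tau> j) \<noteq> \<tau> j" using \<tau> by auto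
  have ne2: "\<tau> (\<sigma> j) \<noteq> \<tau> j" using j tau_inj[OF \<tau>S] by simp
  have s1: "sw j \<tau> j = \<tau> j" using ne ne2 by (simp add: Transposition.transpose_def)
  have jC: "j \<in> C (sw j \<tau>)" using s1 j by (auto simp: commuting_def)
  define d :: "'a \<Rightarrow> real" where "d = (\<lambda>i. of_bool (i \<in> C (sw j \<tau>)) - of_bool (i \<in> C \<tau>))"
  let ?R = "{\<sigma> j, moved j \<tau>, inv \<sigma> (moved j \<tau>)} - {j}"
  have sub: "insert j ?R \<subseteq> A"
    using j sigma_in moved_in[OF \<tau>S j(1)] inv_sigma_in by auto
  have "real (X (sw j \<tau>)) - real (X \<tau>) = (\<Sum>i\<in>A. d i)"
    by (simp add: X_eq_sum d_def sum_subtractf)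
  also have "\<dots> = (\<Sum>i\<in>insert j ?R. d i)"
    using finA sub commuting_sw_iff[OF \<tau>S, of _ j]
    by (intro sum.mono_neutral_right) (auto simp: d_def)
  also have "\<dots> = d j + (\<Sum>i\<in>?R. d i)" by (subst sum.insert) auto
  also have "d j = 1 - of_bool (j \<in> C \<tau>)" using jC by (simp add: d_def)
  finally have eq: "real (X (sw j \<tau>)) - (real (X \<tau>) + 1) = (\<Sum>i\<in>?R. d i) - of_bool (j \<in> C \<tau>)" by linarith
  have "\<bar>real (X (sw j \<tau>)) - (real (X \<tau>) + 1)\<bar> \<le> \<bar>\<Sum>i\<in>?R. d i\<bar> + \<bar>of_bool (j \<in> C \<tau>)\<bar>"
    unfolding eq by (rule abs_triangle_ineq4)
  also have "\<bar>\<Sum>i\<in>?R. d i\<bar> \<le> (\<Sum>i\<in>?R. \<bar>d i\<bar>)" by (rule sum_abs)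
  also have "\<dots> \<le> (\<Sum>i\<in>?R. e i)" by (intro sum_mono) (auto simp: d_def e_def)
  also have "\<dots> \<le> (\<Sum>i\<in>{\<sigma> j, moved j \<tau>, inv \<sigma> (moved j \<tau>)}. e i)"
    by (intro sum_mono2) (auto simp: e_def)
  also have "\<dots> \<le> e (\<sigma> j) + e (moved j \<tau>) + e (inv \<sigma> (moved j \<tau>))"
  proof -
    have "0 \<le> e i" for i by (simp add: e_def)
    then show ?thesis by (auto simp: sum.insert_if)
  qed
  finally show ?thesis by simp
qed

text \<open>This crude bound by the number of affected points suffices for the second
  moment.\<close>

lemma X_sw_le:
  assumes \<tau>: "\<tau> \<in> Sy"
  shows "X (sw j \<tau>) \<le> X \<tau> + 4"
proof -
  let ?Q = "{j, \<sigma> j, moved j \<tau>, inv \<sigma> (moved j \<tau>)}"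
  have "C (sw j \<tau>) \<subseteq> C \<tau> \<union> ?Q" using commuting_sw_iff[OF \<tau>, of _ j] by blast
  then have "X (sw j \<tau>) \<le> card (C \<tau> \<union> ?Q)" using finC by (intro card_mono) auto
  also have "\<dots> \<le> X \<tau> + card ?Q" by (rule card_Un_le)
  also have "card ?Q \<le> 4" by (auto simp: card_insert_if)
  finally show ?thesis by simp
qed

section \<open>First and second moment of the number of commuting points\<close>

lemma card_value_in:
  assumes "j \<in> A" and "U \<subseteq> A"
  shows "card {\<tau>\<in>Sy. \<tau> j \<in> U} \<le> card U * fact (card A - 1)"
proof -
  have fU: "finite U" using assms finA finite_subset by blast
  have eq: "{\<tau>\<in>Sy. \<tau> j \<in> U} = (\<Union>u\<in>U. {\<tau>. \<tau> permutes A \<and> (\<forall>x\<in>{j}. \<tau> x = u)})" by auto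
  have "card {\<tau>\<in>Sy. \<tau> j \<in> U} \<le> (\<Sum>u\<in>U. card {\<tau>. \<tau> permutes A \<and> (\<forall>x\<in>{j}. \<tau> x = u)})"
    unfolding eq by (rule card_UN_le[OF fU])
  also have "\<dots> \<le> (\<Sum>u\<in>U. fact (card A - card {j}))"
    using assms by (intro sum_mono card_permutes_prescribed finA) auto
  finally show ?thesis by simp
qed

lemma card_value_eq:
  assumes "j \<in> A" "k \<in> A" "j \<noteq> k"
  shows "card {\<tau>\<in>Sy. \<tau> k = \<pi> (\<tau> j)} * (card A - 1) \<le> fact (card A)"
proof -
  have "{\<tau>\<in>Sy. \<tau> k = \<pi> (\<tau> j)}
     \<subseteq> (\<Union>u\<in>A. {\<tau>. \<tau> permutes A \<and> (\<forall>x\<in>{j, k}. \<tau> x = (if x = j then u else \<pi> u))})"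
    using assms tau_in by auto
  then have "card {\<tau>\<in>Sy. \<tau> k = \<pi> (\<tau> j)}
      \<le> card (\<Union>u\<in>A. {\<tau>. \<tau> permutes A \<and> (\<forall>x\<in>{j, k}. \<tau> x = (if x = j then u else \<pi> u))})"
    using finA finite_permutations[OF finA]
    by (intro card_mono) (auto intro: finite_subset[OF _ finite_permutations[OF finA]])
  also have "\<dots> \<le> (\<Sum>u\<in>A. card {\<tau>. \<tau> permutes A \<and> (\<forall>x\<in>{j, k}. \<tau> x = (if x = j then u else \<pi> u))})"
    by (rule card_UN_le[OF finA])
  also have "\<dots> \<le> (\<Sum>u\<in>A. fact (card A - card {j, k}))"
    using assms by (intro sum_mono card_permutes_prescribed finA) auto
  also have "\<dots> = card A * fact (card A - 2)" using assms by (simp add: numeral_2_eq_2)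
  finally have "card {\<tau>\<in>Sy. \<tau> k = \<pi> (\<tau> j)} * (card A - 1) \<le> card A * fact (card A - 2) * (card A - 1)"
    by (rule mult_right_mono) simp
  also have "\<dots> = fact (card A)"
  proof -
    obtain m where "card A = Suc (Suc m)" using nge2 by (metis add_2_eq_Suc le_Suc_ex)
    then show ?thesis by (simp add: algebra_simps)
  qed
  finally show ?thesis .
qed

abbreviation "n \<equiv> real (card A)"
abbreviation "F \<equiv> fact (card A) :: real"
abbreviation "f \<equiv> real (card Fix)"

lemma finFix: "finite Fix" using finA by simp

lemma Fix_le: "f \<le> n" using finA by (simp add: card_mono)

lemma fact_pred: "n * fact (card A - 1) = F"
  using nge2 by (metis fact_reduce le_0_eq linorder_not_less not_numeral_le_zero)

lemma n_bound: "n / (n - 1) \<le> 2" "0 < n - 1"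
  using nge2 by (auto simp: divide_simps)

lemma sum_Sy_mono:
  "T \<subseteq> Sy \<Longrightarrow> (\<And>\<tau>. \<tau> \<in> Sy \<Longrightarrow> 0 \<le> h \<tau>) \<Longrightarrow> (\<Sum>\<tau>\<in>T. h \<tau>) \<le> (\<Sum>\<tau>\<in>Sy. h \<tau> :: real)"
  by (rule sum_mono2[OF finSy]) auto

text \<open>Writing \<open>X\<close> as a sum of indicators reduces averages of \<open>X * h\<close>
  to sums over a single \<open>I j\<close>, to which the switch at \<open>j\<close> applies.\<close>

lemma sum_A_I: "(\<Sum>\<tau>\<in>Sy. real (X \<tau>) * h \<tau>) = (\<Sum>j\<in>A. \<Sum>\<tau>\<in>I j. h \<tau>)"
proof -
  have "(\<Sum>\<tau>\<in>Sy. real (X \<tau>) * h \<tau>) = (\<Sum>\<tau>\<in>Sy. \<Sum>j\<in>A. of_bool (j \<in> C \<tau>) * h \<tau>)"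
    by (simp add: X_eq_sum sum_distrib_right)
  also have "\<dots> = (\<Sum>j\<in>A. \<Sum>\<tau>\<in>Sy. of_bool (j \<in> C \<tau>) * h \<tau>)" by (rule sum.swap)
  also have "\<dots> = (\<Sum>j\<in>A. \<Sum>\<tau>\<in>I j. h \<tau>)"
  proof (rule sum.cong[OF refl])
    fix j assume "j \<in> A"
    have "(\<Sum>\<tau>\<in>I j. h \<tau>) = (\<Sum>\<tau>\<in>Sy. if j \<in> C \<tau> then h \<tau> else 0)"
      by (rule sum.inter_filter[OF finSy])
    also have "\<dots> = (\<Sum>\<tau>\<in>Sy. of_bool (j \<in> C \<tau>) * h \<tau>)" by (intro sum.cong refl) simp
    finally show "(\<Sum>\<tau>\<in>Sy. of_bool (j \<in> C \<tau>) * h \<tau>) = (\<Sum>\<tau>\<in>I j. h \<tau>)" ..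
  qed
  finally show ?thesis .
qed

lemma sum_split_Fix: "(\<Sum>j\<in>A. h j) = (\<Sum>j\<in>Fix. h j) + (\<Sum>j\<in>A - Fix. h j :: real)"
  using sum.subset_diff[of Fix A h] finA by auto

text \<open>No switch is available at a fixed point \<open>j\<close> of \<sigma>, since there
  \<open>j = \<sigma> j\<close>. But such a \<open>j\<close> commutes only if
  \<open>\<tau> j\<close> is fixed too, which leaves \<open>f\<close> choices for
  \<open>\<tau> j\<close>.\<close>

lemma sum_Fix_le:
  assumes "\<And>\<tau>. \<tau> \<in> Sy \<Longrightarrow> 0 \<le> h \<tau> \<and> h \<tau> \<le> 1"
  shows "(\<Sum>j\<in>Fix. \<Sum>\<tau>\<in>I j. h \<tau>) \<le> f\<^sup>2 * fact (card A - 1)"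
proof -
  have "(\<Sum>j\<in>Fix. \<Sum>\<tau>\<in>I j. h \<tau>) \<le> (\<Sum>j\<in>Fix. f * fact (card A - 1))"
  proof (rule sum_mono)
    fix j assume j: "j \<in> Fix"
    have "(\<Sum>\<tau>\<in>I j. h \<tau>) \<le> (\<Sum>\<tau>\<in>I j. 1)" using assms by (intro sum_mono) auto
    also have "\<dots> = real (card (I j))" by simp
    also have "card (I j) \<le> card {\<tau>\<in>Sy. \<tau> j \<in> Fix}"
      using finSy j tau_in by (intro card_mono) (auto simp: commuting_def)
    also have "\<dots> \<le> card Fix * fact (card A - 1)" using j by (intro card_value_in) auto
    finally show "(\<Sum>\<tau>\<in>I j. h \<tau>) \<le> f * fact (card A - 1)" by simp
  qed
  then show ?thesis by (simp add: power2_eq_square)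
qed

lemma sum_I_eq: "j \<in> A - Fix \<Longrightarrow> (\<Sum>\<tau>\<in>I j. h \<tau>) = (\<Sum>\<tau>\<in>N j. h (sw j \<tau>)) / (n - 1)"
  using sum_switch'[of j h] n_bound(2) by (simp add: field_simps)

text \<open>Fixed points contribute at most \<open>f\<close> on average, by
  \<open>f \<le> n\<close>. Any other \<open>j\<close> commutes with probability at most
  \<open>1 / (n - 1)\<close> by switching, which adds up to at most 2.\<close>

lemma sum_X_le: "(\<Sum>\<tau>\<in>Sy. real (X \<tau>)) \<le> F * (f + 2)"
proof -
  have "(\<Sum>\<tau>\<in>Sy. real (X \<tau>)) = (\<Sum>j\<in>Fix. \<Sum>\<tau>\<in>I j. 1) + (\<Sum>j\<in>A - Fix. \<Sum>\<tau>\<in>I j. 1)"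
    using sum_A_I[of "\<lambda>_. 1"] sum_split_Fix by simp
  also have "(\<Sum>j\<in>Fix. \<Sum>\<tau>\<in>I j. 1 :: real) \<le> f\<^sup>2 * fact (card A - 1)" by (rule sum_Fix_le) simp
  also have "f\<^sup>2 * fact (card A - 1) \<le> f * (n * fact (card A - 1))"
    unfolding power2_eq_square mult.assoc by (intro mult_left_mono mult_right_mono Fix_le) auto
  also have "n * fact (card A - 1) = F" by (rule fact_pred)
  also have "(\<Sum>j\<in>A - Fix. \<Sum>\<tau>\<in>I j. 1 :: real) \<le> (\<Sum>j\<in>A - Fix. F / (n - 1))"
  proof (rule sum_mono)
    fix j assume "j \<in> A - Fix"
    then have "(\<Sum>\<tau>\<in>I j. 1 :: real) = (\<Sum>\<tau>\<in>N j. 1) / (n - 1)" by (rule sum_I_eq)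
    also have "(\<Sum>\<tau>\<in>N j. 1 :: real) \<le> (\<Sum>\<tau>\<in>Sy. 1)" by (rule sum_Sy_mono) auto
    also have "\<dots> = F" using cardSy by simp
    finally show "(\<Sum>\<tau>\<in>I j. 1 :: real) \<le> F / (n - 1)" using n_bound by (simp add: divide_right_mono)
  qed
  also have "\<dots> \<le> n * (F / (n - 1))"
  proof -
    have "real (card (A - Fix)) \<le> n" using finA by (simp add: card_mono)
    then show ?thesis using n_bound unfolding sum_constant by (intro mult_right_mono) auto
  qed
  also have "\<dots> = F * (n / (n - 1))" by simp
  also have "\<dots> \<le> F * 2" by (intro mult_left_mono n_bound) simp
  finally show ?thesis by (simp add: algebra_simps)
qed

text \<open>One factor \<open>X\<close> is expanded into indicators. At a non-fixed
  \<open>j\<close>, switching trades the condition that \<open>j\<close> commutes for a factor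
  \<open>1 / (n - 1)\<close>, at the price of raising the other \<open>X\<close> by at most 4; at a
  fixed \<open>j\<close> the condition is dropped.\<close>

lemma sum_X2_le: "(\<Sum>\<tau>\<in>Sy. (real (X \<tau>))\<^sup>2) \<le> F * ((f + 2)\<^sup>2 + 8)"
proof -
  let ?S = "\<Sum>\<tau>\<in>Sy. real (X \<tau>)"
  have "(\<Sum>\<tau>\<in>Sy. (real (X \<tau>))\<^sup>2)
      = (\<Sum>j\<in>Fix. \<Sum>\<tau>\<in>I j. real (X \<tau>)) + (\<Sum>j\<in>A - Fix. \<Sum>\<tau>\<in>I j. real (X \<tau>))"
    unfolding power2_eq_square sum_A_I by (rule sum_split_Fix)
  also have "(\<Sum>j\<in>Fix. \<Sum>\<tau>\<in>I j. real (X \<tau>)) \<le> (\<Sum>j\<in>Fix. ?S)"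
    by (intro sum_mono sum_Sy_mono) auto
  also have "(\<Sum>j\<in>A - Fix. \<Sum>\<tau>\<in>I j. real (X \<tau>)) \<le> (\<Sum>j\<in>A - Fix. (?S + 4 * F) / (n - 1))"
  proof (rule sum_mono)
    fix j assume "j \<in> A - Fix"
    then have "(\<Sum>\<tau>\<in>I j. real (X \<tau>)) = (\<Sum>\<tau>\<in>N j. real (X (sw j \<tau>))) / (n - 1)" by (rule sum_I_eq)
    also have "(\<Sum>\<tau>\<in>N j. real (X (sw j \<tau>))) \<le> (\<Sum>\<tau>\<in>N j. real (X \<tau>) + 4)"
    proof (rule sum_mono)
      fix \<tau> assume "\<tau> \<in> N j"
      then have "real (X (sw j \<tau>)) \<le> real (X \<tau> + 4)" by (intro of_nat_mono X_sw_le) auto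
      then show "real (X (sw j \<tau>)) \<le> real (X \<tau>) + 4" by simp
    qed
    also have "\<dots> \<le> (\<Sum>\<tau>\<in>Sy. real (X \<tau>) + 4)" by (rule sum_Sy_mono) (blast, simp)
    also have "\<dots> = ?S + 4 * F" using cardSy by (simp add: sum.distrib)
    finally show "(\<Sum>\<tau>\<in>I j. real (X \<tau>)) \<le> (?S + 4 * F) / (n - 1)"
      using n_bound by (simp add: divide_right_mono)
  qed
  also have "\<dots> \<le> n * ((?S + 4 * F) / (n - 1))"
  proof -
    have "real (card (A - Fix)) \<le> n" using finA by (simp add: card_mono)
    moreover have "0 \<le> (?S + 4 * F) / (n - 1)"
      using n_bound by (intro divide_nonneg_nonneg add_nonneg_nonneg sum_nonneg) auto
    ultimately show ?thesis unfolding sum_constant by (rule mult_right_mono)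
  qed
  also have "\<dots> = (?S + 4 * F) * (n / (n - 1))" by simp
  also have "\<dots> \<le> (?S + 4 * F) * 2"
    by (intro mult_left_mono n_bound add_nonneg_nonneg sum_nonneg) auto
  also have "(\<Sum>j\<in>Fix. ?S) + (?S + 4 * F) * 2 = (f + 2) * ?S + 8 * F" by (simp add: algebra_simps)
  also have "(f + 2) * ?S \<le> (f + 2) * (F * (f + 2))" by (intro mult_left_mono sum_X_le) simp
  finally show ?thesis by (simp add: algebra_simps power2_eq_square)
qed

section \<open>Error terms of the switch\<close>

lemma sum_inj_commuting_le:
  assumes "inj_on p A" and "p ` A \<subseteq> A" and "B \<subseteq> A"
  shows "(\<Sum>j\<in>B. of_bool (p j \<in> C \<tau>)) \<le> real (X \<tau>)"
proof -
  have "(\<Sum>j\<in>B. of_bool (p j \<in> C \<tau>)) \<le> (\<Sum>j\<in>A. of_bool (p j \<in> C \<tau>) :: real)"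
    using finA assms by (intro sum_mono2) auto
  also have "\<dots> = (\<Sum>i\<in>p ` A. of_bool (i \<in> C \<tau>))"
    using assms(1) by (simp add: sum.reindex)
  also have "p ` A = A" using finA assms by (simp add: endo_inj_surj)
  finally show ?thesis using X_eq_sum by simp
qed

text \<open>For the error terms of \<open>X_sw_diff\<close> before the switch: given \<tau>, the
  affected point runs injectively through \<open>A\<close> as \<open>j\<close> varies, so it
  commutes for at most \<open>X \<tau>\<close> of the \<open>j\<close>.\<close>

lemma sum_inj_le:
  assumes "\<And>\<tau>. \<tau> \<in> Sy \<Longrightarrow> inj_on (p \<tau>) A" and "\<And>\<tau>. \<tau> \<in> Sy \<Longrightarrow> p \<tau> ` A \<subseteq> A"
  shows "(\<Sum>j\<in>A - Fix. \<Sum>\<tau>\<in>N j. of_bool (p \<tau> j \<in> C \<tau>)) \<le> (\<Sum>\<tau>\<in>Sy. real (X \<tau>))"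
proof -
  have "(\<Sum>j\<in>A - Fix. \<Sum>\<tau>\<in>N j. of_bool (p \<tau> j \<in> C \<tau>))
      \<le> (\<Sum>j\<in>A - Fix. \<Sum>\<tau>\<in>Sy. of_bool (p \<tau> j \<in> C \<tau>) :: real)"
    by (intro sum_mono sum_Sy_mono) auto
  also have "\<dots> = (\<Sum>\<tau>\<in>Sy. \<Sum>j\<in>A - Fix. of_bool (p \<tau> j \<in> C \<tau>))" by (rule sum.swap)
  also have "\<dots> \<le> (\<Sum>\<tau>\<in>Sy. real (X \<tau>))"
    using assms by (intro sum_mono sum_inj_commuting_le) auto
  finally show ?thesis .
qed

lemma inj_moved: "\<tau> \<in> Sy \<Longrightarrow> inj_on (\<lambda>j. moved j \<tau>) A"
  by (rule inj_onI) (metis moved sigma_inj tau_inj)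

lemma inj_inv_sigma: "inj_on (inv \<sigma>) B"
  by (rule inj_on_subset[OF permutes_inj[OF permutes_inv[OF perm]]]) simp

text \<open>For error terms after the switch: in terms of the switched permutation and the
  overwritten value \<open>a\<close>, the point \<open>moved j \<tau>\<close> is the preimage of
  \<open>a\<close>. So \<open>sum_switch\<close> yields a sum over \<tau> for which \<open>j\<close>
  commutes and over \<open>a\<close>, where at most \<open>X \<tau>\<close> values \<open>a\<close>
  count; summing over \<open>j\<close> gives the second factor \<open>X \<tau>\<close>.\<close>

lemma sum_switched_le:
  assumes "inj_on p A" and "p ` A \<subseteq> A"
  shows "(\<Sum>j\<in>A - Fix. \<Sum>\<tau>\<in>N j. of_bool (p (moved j \<tau>) \<in> C (sw j \<tau>))) \<le> (\<Sum>\<tau>\<in>Sy. (real (X \<tau>))\<^sup>2)"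
proof -
  have "(\<Sum>j\<in>A - Fix. \<Sum>\<tau>\<in>N j. of_bool (p (moved j \<tau>) \<in> C (sw j \<tau>)) :: real)
     = (\<Sum>j\<in>A - Fix. \<Sum>\<tau>\<in>N j. of_bool (p (inv (sw j \<tau>) (\<tau> (\<sigma> j))) \<in> C (sw j \<tau>)))"
  proof (intro sum.cong refl)
    fix j \<tau> assume j: "j \<in> A - Fix" and \<tau>: "\<tau> \<in> N j"
    then have \<tau>S: "\<tau> \<in> Sy" by simp
    have 1: "sw j \<tau> \<in> Sy" using \<tau>S j by (intro transpose_comp_permutes) (auto simp: tau_in sigma_in)
    have "sw j \<tau> (moved j \<tau>) = \<tau> (\<sigma> j)" using moved[OF \<tau>S, of j] by simp
    then have "inv (sw j \<tau>) (\<tau> (\<sigma> j)) = moved j \<tau>"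
      using 1 by (metis mem_Collect_eq permutes_inverses(2))
    then show "of_bool (p (moved j \<tau>) \<in> C (sw j \<tau>))
        = (of_bool (p (inv (sw j \<tau>) (\<tau> (\<sigma> j))) \<in> C (sw j \<tau>)) :: real)" by simp
  qed
  also have "\<dots> = (\<Sum>j\<in>A - Fix. \<Sum>\<tau>\<in>I j. \<Sum>a\<in>A - {\<tau> j}. of_bool (p (inv \<tau> a) \<in> C \<tau>))"
    by (rule sum.cong[OF refl], rule sum_switch[of _ "\<lambda>a \<tau>. of_bool (p (inv \<tau> a) \<in> C \<tau>)"]) auto
  also have "\<dots> \<le> (\<Sum>j\<in>A - Fix. \<Sum>\<tau>\<in>I j. real (X \<tau>))"
  proof (intro sum_mono)
    fix j \<tau> assume "\<tau> \<in> I j"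
    then have \<tau>: "\<tau> permutes A" by simp
    have i: "inv \<tau> permutes A" using \<tau> by (rule permutes_inv)
    have "inj_on (p \<circ> inv \<tau>) A"
      using assms permutes_image[OF i] by (intro comp_inj_on permutes_inj_on[OF i]) simp
    moreover have "(p \<circ> inv \<tau>) ` A \<subseteq> A"
      using assms(2) by (simp only: image_comp[symmetric] permutes_image[OF i])
    ultimately show "(\<Sum>a\<in>A - {\<tau> j}. of_bool (p (inv \<tau> a) \<in> C \<tau>)) \<le> real (X \<tau>)"
      using sum_inj_commuting_le[of "p \<circ> inv \<tau>" "A - {\<tau> j}" \<tau>] by simp
  qed
  also have "\<dots> \<le> (\<Sum>j\<in>A. \<Sum>\<tau>\<in>I j. real (X \<tau>))"
    using finA by (intro sum_mono2) (auto intro: sum_nonneg)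
  also have "\<dots> = (\<Sum>\<tau>\<in>Sy. (real (X \<tau>))\<^sup>2)"
    unfolding power2_eq_square by (rule sum_A_I[symmetric])
  finally show ?thesis .
qed

abbreviation "Fix2 \<equiv> {j\<in>A. \<sigma> (\<sigma> j) = j}"

text \<open>The switch puts \<open>\<sigma> (\<tau> j)\<close> at \<open>\<sigma> j\<close>, so
  \<open>\<sigma> j\<close> commutes afterwards only if the new value at
  \<open>\<sigma> (\<sigma> j)\<close> is \<open>\<sigma> (\<sigma> (\<tau> j))\<close>. This ties
  two values of \<tau> together, which is unlikely unless \<open>\<sigma> (\<sigma> j) = j\<close>;
  hence \<open>Fix2\<close>.\<close>

lemma sum_switched_sigma_le:
  "(\<Sum>j\<in>A - Fix. \<Sum>\<tau>\<in>N j. of_bool (\<sigma> j \<in> C (sw j \<tau>))) \<le> F * (real (card Fix2) + 4)"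
proof -
  have "(\<Sum>j\<in>A - Fix. \<Sum>\<tau>\<in>N j. of_bool (\<sigma> j \<in> C (sw j \<tau>)))
      \<le> (\<Sum>j\<in>A - Fix. of_bool (j \<in> Fix2) * F + 2 * (F / (n - 1)))"
  proof (rule sum_mono)
    fix j assume j: "j \<in> A - Fix"
    show "(\<Sum>\<tau>\<in>N j. of_bool (\<sigma> j \<in> C (sw j \<tau>))) \<le> of_bool (j \<in> Fix2) * F + 2 * (F / (n - 1))"
    proof (cases "j \<in> Fix2")
      case True
      have "(\<Sum>\<tau>\<in>N j. of_bool (\<sigma> j \<in> C (sw j \<tau>))) \<le> (\<Sum>\<tau>\<in>N j. 1 :: real)" by (intro sum_mono) simp
      also have "\<dots> \<le> (\<Sum>\<tau>\<in>Sy. 1)" by (rule sum_Sy_mono) auto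
      also have "\<dots> = F" using cardSy by simp
      moreover have "0 \<le> F / (n - 1)" using n_bound by simp
      ultimately show ?thesis using True by simp
    next
      case False
      let ?k = "\<sigma> (\<sigma> j)"
      let ?T = "\<lambda>\<pi>. {\<tau>\<in>Sy. \<tau> ?k = \<pi> (\<tau> j)}"
      have k: "?k \<in> A" "j \<noteq> ?k" using j False sigma_in by auto
      have T: "real (card (?T \<pi>)) \<le> F / (n - 1)" for \<pi>
      proof -
        have "real (card (?T \<pi>) * (card A - 1)) \<le> real (fact (card A))"
          using card_value_eq[of j ?k \<pi>] j k by (simp only: of_nat_le_iff) blast
        then show ?thesis using nge2 n_bound(2) by (simp add: of_nat_diff field_simps)
      qed
      \<comment> \<open>The second set covers the case that the switch changes the value at
        \<open>?k\<close>, that is, \<open>?k = moved j \<tau>\<close>.\<close>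
      have "{\<tau>\<in>N j. \<sigma> j \<in> C (sw j \<tau>)} \<subseteq> ?T (\<lambda>u. \<sigma> (\<sigma> u)) \<union> ?T \<sigma>"
      proof
        fix \<tau> assume t: "\<tau> \<in> {\<tau>\<in>N j. \<sigma> j \<in> C (sw j \<tau>)}"
        then have \<tau>: "\<tau> \<in> Sy" and c: "\<sigma> (sw j \<tau> (\<sigma> j)) = sw j \<tau> ?k" by (auto simp: commuting_def)
        have "?k \<noteq> \<sigma> j" using j sigma_inj by simp
        then have ne: "\<tau> ?k \<noteq> \<tau> (\<sigma> j)" using tau_inj[OF \<tau>] by simp
        show "\<tau> \<in> ?T (\<lambda>u. \<sigma> (\<sigma> u)) \<union> ?T \<sigma>"
        proof (cases "\<tau> ?k = \<sigma> (\<tau> j)")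
          case False
          then have "sw j \<tau> ?k = \<tau> ?k" using ne by simp
          then show ?thesis using c \<tau> by simp
        qed (use \<tau> in simp)
      qed
      then have "card {\<tau>\<in>N j. \<sigma> j \<in> C (sw j \<tau>)} \<le> card (?T (\<lambda>u. \<sigma> (\<sigma> u)) \<union> ?T \<sigma>)"
        using finSy by (intro card_mono) auto
      also have "\<dots> \<le> card (?T (\<lambda>u. \<sigma> (\<sigma> u))) + card (?T \<sigma>)" by (rule card_Un_le)
      finally have "real (card {\<tau>\<in>N j. \<sigma> j \<in> C (sw j \<tau>)}) \<le> real (card (?T (\<lambda>u. \<sigma> (\<sigma> u)))) + real (card (?T \<sigma>))"
        by linarith
      also have "\<dots> \<le> 2 * (F / (n - 1))"
        using T[of \<sigma>] T[of "\<lambda>u. \<sigma> (\<sigma> u)"] by linarith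
      finally have "real (card {\<tau>\<in>N j. \<sigma> j \<in> C (sw j \<tau>)}) \<le> 2 * (F / (n - 1))" .
      moreover have "(\<Sum>\<tau>\<in>N j. of_bool (\<sigma> j \<in> C (sw j \<tau>))) = real (card {\<tau>\<in>N j. \<sigma> j \<in> C (sw j \<tau>)})"
        using finSy by (simp add: of_bool_def sum.If_cases Int_def)
      moreover have "of_bool (j \<in> Fix2) = (0 :: real)" using False by (simp only: of_bool_eq)
      ultimately show ?thesis by (simp only: mult_zero_left add_0)
    qed
  qed
  also have "\<dots> \<le> (\<Sum>j\<in>A. of_bool (j \<in> Fix2) * F + 2 * (F / (n - 1)))"
    using finA n_bound by (intro sum_mono2) auto
  also have "\<dots> = real (card Fix2) * F + 2 * F * (n / (n - 1))"
    using finA by (simp add: sum.distrib sum_distrib_right[symmetric] of_bool_def sum.If_cases Int_def)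
  also have "\<dots> \<le> real (card Fix2) * F + 2 * F * 2"
    by (intro add_left_mono mult_left_mono n_bound) simp
  finally show ?thesis by (simp add: algebra_simps)
qed

lemma sum_sw_diff_le:
  "(\<Sum>j\<in>A - Fix. \<Sum>\<tau>\<in>N j. \<bar>real (X (sw j \<tau>)) - (real (X \<tau>) + 1)\<bar>)
    \<le> F * (4 * (f + 2) + 2 * ((f + 2)\<^sup>2 + 8) + (real (card Fix2) + 4))"
proof -
  have "(\<Sum>j\<in>A - Fix. \<Sum>\<tau>\<in>N j. \<bar>real (X (sw j \<tau>)) - (real (X \<tau>) + 1)\<bar>)
     \<le> (\<Sum>j\<in>A - Fix. \<Sum>\<tau>\<in>N j. of_bool (j \<in> C \<tau>)
         + (of_bool (\<sigma> j \<in> C \<tau>) + of_bool (\<sigma> j \<in> C (sw j \<tau>)))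
         + (of_bool (moved j \<tau> \<in> C \<tau>) + of_bool (moved j \<tau> \<in> C (sw j \<tau>)))
         + (of_bool (inv \<sigma> (moved j \<tau>) \<in> C \<tau>) + of_bool (inv \<sigma> (moved j \<tau>) \<in> C (sw j \<tau>))))"
    by (intro sum_mono X_sw_diff) auto
  also have "\<dots> = (\<Sum>j\<in>A - Fix. \<Sum>\<tau>\<in>N j. of_bool (j \<in> C \<tau>))
         + ((\<Sum>j\<in>A - Fix. \<Sum>\<tau>\<in>N j. of_bool (\<sigma> j \<in> C \<tau>))
            + (\<Sum>j\<in>A - Fix. \<Sum>\<tau>\<in>N j. of_bool (\<sigma> j \<in> C (sw j \<tau>))))
         + ((\<Sum>j\<in>A - Fix. \<Sum>\<tau>\<in>N j. of_bool (moved j \<tau> \<in> C \<tau>))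
            + (\<Sum>j\<in>A - Fix. \<Sum>\<tau>\<in>N j. of_bool (moved j \<tau> \<in> C (sw j \<tau>))))
         + ((\<Sum>j\<in>A - Fix. \<Sum>\<tau>\<in>N j. of_bool (inv \<sigma> (moved j \<tau>) \<in> C \<tau>))
            + (\<Sum>j\<in>A - Fix. \<Sum>\<tau>\<in>N j. of_bool (inv \<sigma> (moved j \<tau>) \<in> C (sw j \<tau>))))"
    by (simp only: sum.distrib)
  also have "\<dots> \<le> (\<Sum>\<tau>\<in>Sy. real (X \<tau>)) + ((\<Sum>\<tau>\<in>Sy. real (X \<tau>)) + F * (real (card Fix2) + 4))
      + ((\<Sum>\<tau>\<in>Sy. real (X \<tau>)) + (\<Sum>\<tau>\<in>Sy. (real (X \<tau>))\<^sup>2))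
      + ((\<Sum>\<tau>\<in>Sy. real (X \<tau>)) + (\<Sum>\<tau>\<in>Sy. (real (X \<tau>))\<^sup>2))"
  proof (intro add_mono)
    show "(\<Sum>j\<in>A - Fix. \<Sum>\<tau>\<in>N j. of_bool (j \<in> C \<tau>)) \<le> (\<Sum>\<tau>\<in>Sy. real (X \<tau>))"
      by (rule sum_inj_le) auto
    show "(\<Sum>j\<in>A - Fix. \<Sum>\<tau>\<in>N j. of_bool (\<sigma> j \<in> C \<tau>)) \<le> (\<Sum>\<tau>\<in>Sy. real (X \<tau>))"
      by (rule sum_inj_le) (use sigma_in sigma_inj in \<open>auto intro: inj_onI\<close>)
    show "(\<Sum>j\<in>A - Fix. \<Sum>\<tau>\<in>N j. of_bool (\<sigma> j \<in> C (sw j \<tau>))) \<le> F * (real (card Fix2) + 4)"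
      by (rule sum_switched_sigma_le)
    show "(\<Sum>j\<in>A - Fix. \<Sum>\<tau>\<in>N j. of_bool (moved j \<tau> \<in> C \<tau>)) \<le> (\<Sum>\<tau>\<in>Sy. real (X \<tau>))"
      by (rule sum_inj_le) (use inj_moved moved_in in auto)
    show "(\<Sum>j\<in>A - Fix. \<Sum>\<tau>\<in>N j. of_bool (moved j \<tau> \<in> C (sw j \<tau>))) \<le> (\<Sum>\<tau>\<in>Sy. (real (X \<tau>))\<^sup>2)"
      by (rule sum_switched_le[of "\<lambda>x. x"]) auto
    show "(\<Sum>j\<in>A - Fix. \<Sum>\<tau>\<in>N j. of_bool (inv \<sigma> (moved j \<tau>) \<in> C \<tau>)) \<le> (\<Sum>\<tau>\<in>Sy. real (X \<tau>))"
    proof (rule sum_inj_le)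
      fix \<tau> assume "\<tau> \<in> Sy"
      then show "inj_on (\<lambda>j. inv \<sigma> (moved j \<tau>)) A"
        using comp_inj_on[OF inj_moved inj_inv_sigma] by (simp add: comp_def)
      show "(\<lambda>j. inv \<sigma> (moved j \<tau>)) ` A \<subseteq> A"
        using moved_in[OF \<open>\<tau> \<in> Sy\<close>] inv_sigma_in by auto
    qed
    show "(\<Sum>j\<in>A - Fix. \<Sum>\<tau>\<in>N j. of_bool (inv \<sigma> (moved j \<tau>) \<in> C (sw j \<tau>))) \<le> (\<Sum>\<tau>\<in>Sy. (real (X \<tau>))\<^sup>2)"
      by (rule sum_switched_le) (use inj_inv_sigma inv_sigma_in in auto)
  qed
  also have "\<dots> = 4 * (\<Sum>\<tau>\<in>Sy. real (X \<tau>)) + 2 * (\<Sum>\<tau>\<in>Sy. (real (X \<tau>))\<^sup>2) + F * (real (card Fix2) + 4)"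
    by simp
  also have "\<dots> \<le> 4 * (F * (f + 2)) + 2 * (F * ((f + 2)\<^sup>2 + 8)) + F * (real (card Fix2) + 4)"
    using sum_X_le sum_X2_le by simp
  finally show ?thesis by (simp add: algebra_simps)
qed

text \<open>A chain of approximations: \<open>n - 1\<close> times the sum of
  \<open>X * stein X\<close> is, up to the fixed points (\<open>?D\<close>), the sum
  \<open>?E\<close> over switched permutations; replacing the switched \<open>X\<close> by
  \<open>X + 1\<close> gives \<open>?G\<close>; and \<open>?G\<close> is nearly \<open>n - 1\<close>
  copies of \<open>?H\<close>, because all but at most \<open>2 * f\<close> of the \<open>j\<close>
  are counted. Relative to \<open>F\<close>, each error is bounded in terms of \<open>f\<close> and
  \<open>card Fix2\<close>.\<close>

lemma sum_stein_le:
  "(n - 1) * \<bar>\<Sum>\<tau>\<in>Sy. stein (X \<tau> + 1) - real (X \<tau>) * stein (X \<tau>)\<bar>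
    \<le> F * (17 * f\<^sup>2 + real (card Fix2) + 37)"
proof -
  let ?D = "\<Sum>j\<in>Fix. \<Sum>\<tau>\<in>I j. stein (X \<tau>)"
  let ?E = "\<Sum>j\<in>A - Fix. \<Sum>\<tau>\<in>N j. stein (X (sw j \<tau>))"
  let ?G = "\<Sum>j\<in>A - Fix. \<Sum>\<tau>\<in>N j. stein (X \<tau> + 1)"
  let ?H = "\<Sum>\<tau>\<in>Sy. stein (X \<tau> + 1)"
  let ?w = "\<lambda>\<tau>. real (card {j\<in>A - Fix. \<sigma> (\<tau> j) \<noteq> \<tau> j})"
  have pos: "n - 1 > 0" by (rule n_bound)
  have D: "0 \<le> ?D" "(n - 1) * ?D \<le> F * f\<^sup>2"
  proof -
    show "0 \<le> ?D" using stein_bounds by (intro sum_nonneg) auto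
    have "?D \<le> f\<^sup>2 * fact (card A - 1)" using stein_bounds by (intro sum_Fix_le) auto
    then have "(n - 1) * ?D \<le> n * (f\<^sup>2 * fact (card A - 1))"
      using pos \<open>0 \<le> ?D\<close> by (intro mult_mono) auto
    also have "\<dots> = (n * fact (card A - 1)) * f\<^sup>2" by (simp add: mult_ac)
    finally show "(n - 1) * ?D \<le> F * f\<^sup>2" by (simp only: fact_pred)
  qed
  have "(\<Sum>\<tau>\<in>Sy. real (X \<tau>) * stein (X \<tau>)) = ?D + (\<Sum>j\<in>A - Fix. \<Sum>\<tau>\<in>I j. stein (X \<tau>))"
    unfolding sum_A_I by (rule sum_split_Fix)
  also have "(\<Sum>j\<in>A - Fix. \<Sum>\<tau>\<in>I j. stein (X \<tau>)) = ?E / (n - 1)"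
    by (subst sum_divide_distrib) (rule sum.cong[OF refl], rule sum_I_eq)
  finally have eq: "(n - 1) * (\<Sum>\<tau>\<in>Sy. stein (X \<tau> + 1) - real (X \<tau>) * stein (X \<tau>))
      = (n - 1) * ?H - (n - 1) * ?D - ?E"
    using pos by (simp add: sum_subtractf field_simps)
  have "\<bar>?E - ?G\<bar> \<le> (\<Sum>j\<in>A - Fix. \<Sum>\<tau>\<in>N j. \<bar>stein (X (sw j \<tau>)) - stein (X \<tau> + 1)\<bar>)"
    unfolding sum_subtractf[symmetric]
    by (rule order_trans[OF sum_abs], rule sum_mono, rule sum_abs)
  also have "\<dots> \<le> (\<Sum>j\<in>A - Fix. \<Sum>\<tau>\<in>N j. \<bar>real (X (sw j \<tau>)) - (real (X \<tau>) + 1)\<bar>)"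
    by (intro sum_mono order_trans[OF stein_lipschitz]) simp
  also have "\<dots> \<le> F * (4 * (f + 2) + 2 * ((f + 2)\<^sup>2 + 8) + (real (card Fix2) + 4))"
    by (rule sum_sw_diff_le)
  finally have EG: "\<bar>?E - ?G\<bar> \<le> F * (4 * (f + 2) + 2 * ((f + 2)\<^sup>2 + 8) + (real (card Fix2) + 4))" .
  have "?G = (\<Sum>j\<in>A - Fix. \<Sum>\<tau>\<in>Sy. if \<sigma> (\<tau> j) \<noteq> \<tau> j then stein (X \<tau> + 1) else 0)"
    by (intro sum.cong refl sum.inter_filter finSy)
  also have "\<dots> = (\<Sum>\<tau>\<in>Sy. \<Sum>j\<in>A - Fix. if \<sigma> (\<tau> j) \<noteq> \<tau> j then stein (X \<tau> + 1) else 0)"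
    by (rule sum.swap)
  also have "\<dots> = (\<Sum>\<tau>\<in>Sy. ?w \<tau> * stein (X \<tau> + 1))"
  proof (rule sum.cong[OF refl])
    fix \<tau>
    have "(\<Sum>j\<in>A - Fix. if \<sigma> (\<tau> j) \<noteq> \<tau> j then stein (X \<tau> + 1) else 0)
      = (\<Sum>j | j \<in> A - Fix \<and> \<sigma> (\<tau> j) \<noteq> \<tau> j. stein (X \<tau> + 1))"
      using finA by (intro sum.inter_filter[symmetric]) simp
    then show "(\<Sum>j\<in>A - Fix. if \<sigma> (\<tau> j) \<noteq> \<tau> j then stein (X \<tau> + 1) else 0) = ?w \<tau> * stein (X \<tau> + 1)"
      by (simp only: sum_constant)
  qed
  finally have G: "?G = (\<Sum>\<tau>\<in>Sy. ?w \<tau> * stein (X \<tau> + 1))" .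
  have "\<bar>(n - 1) * ?H - ?G\<bar> \<le> (\<Sum>\<tau>\<in>Sy. \<bar>(n - 1 - ?w \<tau>) * stein (X \<tau> + 1)\<bar>)"
    unfolding G sum_distrib_left sum_subtractf[symmetric] left_diff_distrib[symmetric] by (rule sum_abs)
  also have "\<dots> \<le> (\<Sum>\<tau>\<in>Sy. 2 * f + 1)"
  proof (rule sum_mono)
    fix \<tau> assume \<tau>: "\<tau> \<in> Sy"
    let ?W = "{j\<in>A - Fix. \<sigma> (\<tau> j) \<noteq> \<tau> j}"
    have "card {j\<in>A. \<tau> j \<in> Fix} \<le> card Fix"
      using finFix tau_inj[OF \<tau>] by (intro card_inj_on_le[of \<tau>]) (auto intro: inj_onI)
    moreover have "card A \<le> card (?W \<union> (Fix \<union> {j\<in>A. \<tau> j \<in> Fix}))"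
      using finA tau_in[OF \<tau>] by (intro card_mono) auto
    then have "card A \<le> card ?W + (card Fix + card {j\<in>A. \<tau> j \<in> Fix})"
      by (meson card_Un_le le_trans add_left_mono)
    ultimately have "n \<le> ?w \<tau> + 2 * f" by linarith
    moreover have "?w \<tau> \<le> n" using finA by (simp add: card_mono)
    ultimately have "\<bar>n - 1 - ?w \<tau>\<bar> \<le> 2 * f + 1" by linarith
    then have "\<bar>n - 1 - ?w \<tau>\<bar> * \<bar>stein (X \<tau> + 1)\<bar> \<le> (2 * f + 1) * 1"
      using stein_bounds[of "X \<tau> + 1"] by (intro mult_mono) auto
    then show "\<bar>(n - 1 - ?w \<tau>) * stein (X \<tau> + 1)\<bar> \<le> 2 * f + 1" by (simp only: abs_mult mult_1_right)
  qed
  also have "\<dots> = F * (2 * f + 1)" using cardSy by simp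
  finally have HG: "\<bar>(n - 1) * ?H - ?G\<bar> \<le> F * (2 * f + 1)" .
  have "(n - 1) * \<bar>\<Sum>\<tau>\<in>Sy. stein (X \<tau> + 1) - real (X \<tau>) * stein (X \<tau>)\<bar>
     = \<bar>(n - 1) * (\<Sum>\<tau>\<in>Sy. stein (X \<tau> + 1) - real (X \<tau>) * stein (X \<tau>))\<bar>"
    using pos by (simp only: abs_mult abs_of_pos)
  also have "\<dots> \<le> F * f\<^sup>2 + F * (4 * (f + 2) + 2 * ((f + 2)\<^sup>2 + 8) + (real (card Fix2) + 4)) + F * (2 * f + 1)"
    unfolding eq using D pos EG HG mult_nonneg_nonneg[of "n - 1" ?D] by linarith
  also have "\<dots> = F * (3 * f\<^sup>2 + 14 * f + real (card Fix2) + 37)"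
    by (simp add: algebra_simps power2_eq_square)
  \<comment> \<open>Absorbing \<open>f\<close> into its square leaves only the second moment of
    \<open>f\<close> to be averaged; \<open>17 = 3 + 14\<close>.\<close>
  also have "\<dots> \<le> F * (3 * f\<^sup>2 + 14 * f\<^sup>2 + real (card Fix2) + 37)"
  proof -
    have "f \<le> f\<^sup>2" by (cases "card Fix = 0") (auto simp: power2_eq_square mult_le_cancel_left1)
    then show ?thesis by (intro mult_left_mono) auto
  qed
  finally show ?thesis by simp
qed

end

text \<open>Serves two averages, those over pairs of fixed points and over pairs exchanged by
  \<sigma>. The diagonal and the off-diagonal pairs contribute at most \<open>fact (card A)\<close>
  each.\<close>

lemma sum_card_two_values_le:
  assumes A: "finite A"
  shows "(\<Sum>j\<in>A. \<Sum>k\<in>A. card {\<sigma>. \<sigma> permutes A \<and> \<sigma> j = a j k \<and> \<sigma> k = b j k}) \<le> 2 * fact (card A)"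
proof -
  let ?P = "\<lambda>j k. {\<sigma>. \<sigma> permutes A \<and> \<sigma> j = a j k \<and> \<sigma> k = b j k}"
  let ?n = "card A"
  have fin: "finite {\<sigma>. \<sigma> permutes A \<and> R \<sigma>}" for R
    by (rule finite_subset[OF _ finite_permutations[OF A]]) auto
  have "(\<Sum>j\<in>A. \<Sum>k\<in>A. card (?P j k)) \<le> (\<Sum>j\<in>A. fact (?n - 1) + (\<Sum>k\<in>A - {j}. fact (?n - 2)))"
  proof (rule sum_mono)
    fix j assume j: "j \<in> A"
    have "(\<Sum>k\<in>A. card (?P j k)) = card (?P j j) + (\<Sum>k\<in>A - {j}. card (?P j k))"
      by (rule sum.remove[OF A j])
    also have "card (?P j j) \<le> card {\<sigma>. \<sigma> permutes A \<and> (\<forall>x\<in>{j}. \<sigma> x = a j j)}"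
      by (intro card_mono fin) auto
    also have "\<dots> \<le> fact (?n - card {j})" using j by (intro card_permutes_prescribed A) auto
    also have "(\<Sum>k\<in>A - {j}. card (?P j k)) \<le> (\<Sum>k\<in>A - {j}. fact (?n - 2))"
    proof (rule sum_mono)
      fix k assume k: "k \<in> A - {j}"
      have "card (?P j k) \<le> card {\<sigma>. \<sigma> permutes A \<and> (\<forall>x\<in>{j, k}. \<sigma> x = (if x = j then a j k else b j k))}"
        using k by (intro card_mono fin) auto
      also have "\<dots> \<le> fact (?n - card {j, k})" using j k by (intro card_permutes_prescribed A) auto
      also have "card {j, k} = 2" using k by auto
      finally show "card (?P j k) \<le> fact (?n - 2)" .
    qed
    finally show "(\<Sum>k\<in>A. card (?P j k)) \<le> fact (?n - 1) + (\<Sum>k\<in>A - {j}. fact (?n - 2))" by simp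
  qed
  also have "\<dots> = (\<Sum>j\<in>A. fact (?n - 1) + (?n - 1) * fact (?n - 2))"
    using A by (intro sum.cong refl) simp
  also have "\<dots> \<le> 2 * fact ?n"
  proof (cases ?n)
    case (Suc m)
    then show ?thesis by (cases m) (simp_all add: algebra_simps)
  qed simp
  finally show ?thesis .
qed

lemma sum_sq_card_fixed_le:
  assumes A: "finite A"
  shows "(\<Sum>\<sigma> | \<sigma> permutes A. (real (card {j\<in>A. \<sigma> j = j}))\<^sup>2) \<le> 2 * fact (card A)"
proof -
  let ?S = "{\<sigma>. \<sigma> permutes A}"
  have fin: "finite ?S" using A by (rule finite_permutations)
  have "(\<Sum>\<sigma>\<in>?S. (card {j\<in>A. \<sigma> j = j})\<^sup>2) = (\<Sum>\<sigma>\<in>?S. \<Sum>j\<in>A. \<Sum>k\<in>A. of_bool (\<sigma> j = j \<and> \<sigma> k = k))"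
  proof (rule sum.cong[OF refl])
    fix \<sigma> :: "'a \<Rightarrow> 'a"
    have "card {j\<in>A. \<sigma> j = j} = (\<Sum>j\<in>A. of_bool (\<sigma> j = j))"
      using A by (simp add: of_bool_def sum.If_cases Int_def)
    then show "(card {j\<in>A. \<sigma> j = j})\<^sup>2 = (\<Sum>j\<in>A. \<Sum>k\<in>A. of_bool (\<sigma> j = j \<and> \<sigma> k = k))"
      by (simp add: power2_eq_square sum_product of_bool_conj)
  qed
  also have "\<dots> = (\<Sum>j\<in>A. \<Sum>k\<in>A. \<Sum>\<sigma>\<in>?S. of_bool (\<sigma> j = j \<and> \<sigma> k = k))"
    by (subst sum.swap) (intro sum.cong refl sum.swap)
  also have "\<dots> = (\<Sum>j\<in>A. \<Sum>k\<in>A. card {\<sigma>. \<sigma> permutes A \<and> \<sigma> j = j \<and> \<sigma> k = k})"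
    using fin by (simp add: of_bool_def sum.If_cases Int_def)
  also have "\<dots> \<le> 2 * fact (card A)" by (rule sum_card_two_values_le[OF A])
  finally have "real (\<Sum>\<sigma>\<in>?S. (card {j\<in>A. \<sigma> j = j})\<^sup>2) \<le> real (2 * fact (card A))"
    by (simp only: of_nat_le_iff)
  then show ?thesis by simp
qed

lemma sum_card_fixed2_le:
  assumes A: "finite A"
  shows "(\<Sum>\<sigma> | \<sigma> permutes A. real (card {j\<in>A. \<sigma> (\<sigma> j) = j})) \<le> 2 * fact (card A)"
proof -
  let ?S = "{\<sigma>. \<sigma> permutes A}"
  have fin: "finite ?S" using A by (rule finite_permutations)
  have "(\<Sum>\<sigma>\<in>?S. card {j\<in>A. \<sigma> (\<sigma> j) = j}) = (\<Sum>\<sigma>\<in>?S. \<Sum>j\<in>A. \<Sum>k\<in>A. of_bool (\<sigma> j = k \<and> \<sigma> k = j))"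
  proof (rule sum.cong[OF refl])
    fix \<sigma> assume s: "\<sigma> \<in> ?S"
    have "card {j\<in>A. \<sigma> (\<sigma> j) = j} = (\<Sum>j\<in>A. of_bool (\<sigma> (\<sigma> j) = j))"
      using A by (simp add: of_bool_def sum.If_cases Int_def)
    also have "\<dots> = (\<Sum>j\<in>A. \<Sum>k\<in>A. of_bool (\<sigma> j = k \<and> \<sigma> k = j))"
    proof (rule sum.cong[OF refl])
      fix j assume "j \<in> A"
      then have "\<sigma> j \<in> A" using s permutes_in_image by fastforce
      have "(\<Sum>k\<in>A. of_bool (\<sigma> j = k \<and> \<sigma> k = j)) = (\<Sum>k\<in>A. if \<sigma> j = k then of_bool (\<sigma> (\<sigma> j) = j) else 0 :: nat)"
        by (intro sum.cong refl) auto
      then show "of_bool (\<sigma> (\<sigma> j) = j) = (\<Sum>k\<in>A. of_bool (\<sigma> j = k \<and> \<sigma> k = j) :: nat)"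
        using A \<open>\<sigma> j \<in> A\<close> by simp
    qed
    finally show "card {j\<in>A. \<sigma> (\<sigma> j) = j} = (\<Sum>j\<in>A. \<Sum>k\<in>A. of_bool (\<sigma> j = k \<and> \<sigma> k = j))" .
  qed
  also have "\<dots> = (\<Sum>j\<in>A. \<Sum>k\<in>A. \<Sum>\<sigma>\<in>?S. of_bool (\<sigma> j = k \<and> \<sigma> k = j))"
    by (subst sum.swap) (intro sum.cong refl sum.swap)
  also have "\<dots> = (\<Sum>j\<in>A. \<Sum>k\<in>A. card {\<sigma>. \<sigma> permutes A \<and> \<sigma> j = k \<and> \<sigma> k = j})"
    using fin by (simp add: of_bool_def sum.If_cases Int_def)
  also have "\<dots> \<le> 2 * fact (card A)" by (rule sum_card_two_values_le[OF A])
  finally have "real (\<Sum>\<sigma>\<in>?S. card {j\<in>A. \<sigma> (\<sigma> j) = j}) \<le> real (2 * fact (card A))"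
    by (simp only: of_nat_le_iff)
  then show ?thesis by simp
qed

text \<open>Averages \<open>sum_stein_le\<close> over \<sigma>: the squared number of fixed points
  and the number of points fixed by the square of \<sigma> both have mean at most 2, and
  \<open>73 = 17 * 2 + 2 + 37\<close>.\<close>

lemma card_pairs_not_commuting_approx:
  assumes A: "finite A" and n: "2 \<le> card A"
  shows "(real (card A) - 1)
     * \<bar>real (card {(\<sigma>, \<tau>). \<sigma> permutes A \<and> \<tau> permutes A \<and> commuting A \<sigma> \<tau> = {}}) - (fact (card A))\<^sup>2 / exp 1\<bar>
     \<le> 73 * (fact (card A))\<^sup>2"
proof -
  let ?S = "{\<sigma>. \<sigma> permutes A}"
  let ?X = "\<lambda>\<sigma> \<tau>. card (commuting A \<sigma> \<tau>)"
  have fin: "finite ?S" using A by (rule finite_permutations)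
  have cS: "real (card ?S) = fact (card A)" using A by (simp add: card_permutations)
  have "{(\<sigma>, \<tau>). \<sigma> permutes A \<and> \<tau> permutes A \<and> commuting A \<sigma> \<tau> = {}}
     = {p \<in> ?S \<times> ?S. case p of (\<sigma>, \<tau>) \<Rightarrow> ?X \<sigma> \<tau> = 0}"
    using finite_subset[OF commuting_subset A] by auto
  then have "real (card {(\<sigma>, \<tau>). \<sigma> permutes A \<and> \<tau> permutes A \<and> commuting A \<sigma> \<tau> = {}})
     = (\<Sum>p | p \<in> ?S \<times> ?S \<and> (case p of (\<sigma>, \<tau>) \<Rightarrow> ?X \<sigma> \<tau> = 0). 1)"
    by simp
  also have "\<dots> = (\<Sum>p\<in>?S \<times> ?S. if (case p of (\<sigma>, \<tau>) \<Rightarrow> ?X \<sigma> \<tau> = 0) then 1 else 0)"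
    using fin by (intro sum.inter_filter) simp
  also have "\<dots> = (\<Sum>p\<in>?S \<times> ?S. case p of (\<sigma>, \<tau>) \<Rightarrow> if ?X \<sigma> \<tau> = 0 then 1 else 0)"
    by (intro sum.cong refl) (auto split: prod.splits)
  also have "\<dots> = (\<Sum>\<sigma>\<in>?S. \<Sum>\<tau>\<in>?S. if ?X \<sigma> \<tau> = 0 then 1 else 0)"
    by (rule sum.cartesian_product[symmetric])
  finally have 1: "real (card {(\<sigma>, \<tau>). \<sigma> permutes A \<and> \<tau> permutes A \<and> commuting A \<sigma> \<tau> = {}})
     = (\<Sum>\<sigma>\<in>?S. \<Sum>\<tau>\<in>?S. if ?X \<sigma> \<tau> = 0 then 1 else 0)" .
  have 2: "(fact (card A))\<^sup>2 / exp 1 = (\<Sum>\<sigma>\<in>?S. \<Sum>\<tau>\<in>?S. 1 / exp (1::real))"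
    by (simp add: cS power2_eq_square)
  have 3: "real (card {(\<sigma>, \<tau>). \<sigma> permutes A \<and> \<tau> permutes A \<and> commuting A \<sigma> \<tau> = {}}) - (fact (card A))\<^sup>2 / exp 1
    = (\<Sum>\<sigma>\<in>?S. \<Sum>\<tau>\<in>?S. stein (?X \<sigma> \<tau> + 1) - real (?X \<sigma> \<tau>) * stein (?X \<sigma> \<tau>))"
    unfolding 1 2 stein_eq sum_subtractf[symmetric] ..
  have "(real (card A) - 1) * \<bar>\<Sum>\<sigma>\<in>?S. \<Sum>\<tau>\<in>?S. stein (?X \<sigma> \<tau> + 1) - real (?X \<sigma> \<tau>) * stein (?X \<sigma> \<tau>)\<bar>
    \<le> (real (card A) - 1) * (\<Sum>\<sigma>\<in>?S. \<bar>\<Sum>\<tau>\<in>?S. stein (?X \<sigma> \<tau> + 1) - real (?X \<sigma> \<tau>) * stein (?X \<sigma> \<tau>)\<bar>)"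
    using n by (intro mult_left_mono sum_abs) auto
  also have "\<dots> \<le> (\<Sum>\<sigma>\<in>?S. fact (card A) *
      (17 * (real (card {j\<in>A. \<sigma> j = j}))\<^sup>2 + real (card {j\<in>A. \<sigma> (\<sigma> j) = j}) + 37))"
    unfolding sum_distrib_left[of "real (card A) - 1"]
    by (intro sum_mono switching.sum_stein_le switching.intro A n) simp
  also have "\<dots> = fact (card A) * (17 * (\<Sum>\<sigma>\<in>?S. (real (card {j\<in>A. \<sigma> j = j}))\<^sup>2)
      + (\<Sum>\<sigma>\<in>?S. real (card {j\<in>A. \<sigma> (\<sigma> j) = j})) + 37 * fact (card A))"
    by (simp add: sum_distrib_left[symmetric] sum.distrib cS)
  also have "\<dots> \<le> fact (card A) * (17 * (2 * fact (card A)) + 2 * fact (card A) + 37 * fact (card A))"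
    by (intro mult_left_mono add_mono order_refl sum_sq_card_fixed_le sum_card_fixed2_le A) auto
  also have "\<dots> = 73 * (fact (card A))\<^sup>2" by (simp add: power2_eq_square)
  finally show ?thesis unfolding 3 .
qed

section \<open>Cone points and marked points\<close>

locale square_tiled =
  fixes n :: nat and \<sigma> \<tau> :: "nat \<Rightarrow> nat"
  assumes sigma: "\<sigma> permutes {1..n}" and tau: "\<tau> permutes {1..n}"
begin

abbreviation "\<Omega> \<equiv> {1..n}"
abbreviation "G \<equiv> side_gluing n \<sigma> \<tau>"
abbreviation "pt \<equiv> surface_pt n \<sigma> \<tau>"
abbreviation "cones \<equiv> cone_points n \<sigma> \<tau>"
abbreviation "marks \<equiv> marked_points n \<sigma> \<tau>"
abbreviation "regular \<equiv> commuting \<Omega> \<sigma> \<tau>"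

lemma sigma_in: "\<sigma> i \<in> \<Omega> \<longleftrightarrow> i \<in> \<Omega>" by (rule permutes_in_image[OF sigma])
lemma tau_in: "\<tau> i \<in> \<Omega> \<longleftrightarrow> i \<in> \<Omega>" by (rule permutes_in_image[OF tau])
lemma sigma_inj: "\<sigma> i = \<sigma> j \<longleftrightarrow> i = j" using permutes_inj[OF sigma] by (simp add: inj_eq)
lemma tau_inj: "\<tau> i = \<tau> j \<longleftrightarrow> i = j" using permutes_inj[OF tau] by (simp add: inj_eq)

lemma side_gluing_iff:
  "(p, q) \<in> G \<longleftrightarrow>
     (\<exists>i y. p = (i, 1, y) \<and> q = (\<sigma> i, 0, y) \<and> i \<in> \<Omega> \<and> y \<in> {0..1}) \<or>
     (\<exists>i x. p = (i, x, 1) \<and> q = (\<tau> i, x, 0) \<and> i \<in> \<Omega> \<and> x \<in> {0..1})"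
  by (auto simp: side_gluing_def)

lemma squares_iff: "(i, x, y) \<in> squares n \<longleftrightarrow> i \<in> \<Omega> \<and> x \<in> {0..1} \<and> y \<in> {0..1}"
  by (simp add: squares_def)

lemma side_gluing_squares:
  assumes "(p, q) \<in> G" shows "p \<in> squares n" "q \<in> squares n"
proof -
  have "p \<in> squares n \<and> q \<in> squares n"
    using assms unfolding side_gluing_iff
  proof (elim disjE exE conjE)
    fix i y assume "p = (i, 1, y)" "q = (\<sigma> i, 0, y)" "i \<in> \<Omega>" "y \<in> {0..1}"
    then show ?thesis using sigma_in[of i] by (simp add: squares_iff)
  next
    fix i x assume "p = (i, x, 1)" "q = (\<tau> i, x, 0)" "i \<in> \<Omega>" "x \<in> {0..1}"
    then show ?thesis using tau_in[of i] by (simp add: squares_iff)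
  qed
  then show "p \<in> squares n" "q \<in> squares n" by simp_all
qed

lemma equiv_gluing: "equiv (squares n) (gluing_equiv n \<sigma> \<tau>)"
proof (rule equivI)
  show "gluing_equiv n \<sigma> \<tau> \<subseteq> squares n \<times> squares n" by (auto simp: gluing_equiv_def)
  show "refl_on (squares n) (gluing_equiv n \<sigma> \<tau>)" by (simp add: refl_on_def gluing_equiv_def)
  have "sym ((G \<union> G\<inverse>)\<^sup>*)" by (rule sym_rtrancl) (rule sym_Un_converse)
  then show "sym (gluing_equiv n \<sigma> \<tau>)" by (auto simp: gluing_equiv_def sym_def)
  show "trans (gluing_equiv n \<sigma> \<tau>)"
    by (auto simp: gluing_equiv_def trans_def intro: rtrancl_trans)
qed

lemma pt_eq_iff:
  "p \<in> squares n \<Longrightarrow> q \<in> squares n \<Longrightarrow> pt p = pt q \<longleftrightarrow> (p, q) \<in> gluing_equiv n \<sigma> \<tau>"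
  unfolding surface_pt_def by (rule eq_equiv_class_iff[OF equiv_gluing])

lemma mem_pt_iff: "p \<in> squares n \<Longrightarrow> q \<in> pt p \<longleftrightarrow> q \<in> squares n \<and> pt q = pt p"
proof -
  assume p: "p \<in> squares n"
  have "q \<in> pt p \<longleftrightarrow> (p, q) \<in> gluing_equiv n \<sigma> \<tau>" by (simp add: surface_pt_def)
  moreover have "(p, q) \<in> gluing_equiv n \<sigma> \<tau> \<Longrightarrow> q \<in> squares n" by (simp add: gluing_equiv_def)
  ultimately show ?thesis using pt_eq_iff[OF p, of q] by metis
qed

lemma pt_glue: "(p, q) \<in> G \<Longrightarrow> pt p = pt q"
proof -
  assume g: "(p, q) \<in> G"
  then have "(p, q) \<in> (G \<union> G\<inverse>)\<^sup>*" by (intro r_into_rtrancl) simp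
  with side_gluing_squares[OF g] show "pt p = pt q" by (subst pt_eq_iff) (simp_all add: gluing_equiv_def)
qed

lemma pt_right: "i \<in> \<Omega> \<Longrightarrow> y \<in> {0..1} \<Longrightarrow> pt (i, 1, y) = pt (\<sigma> i, 0, y)"
  by (rule pt_glue) (auto simp: side_gluing_iff)

lemma pt_top: "i \<in> \<Omega> \<Longrightarrow> x \<in> {0..1} \<Longrightarrow> pt (i, x, 1) = pt (\<tau> i, x, 0)"
  by (rule pt_glue) (auto simp: side_gluing_iff)

text \<open>As points of the surface are sets, their total angles can be bounded from above by
  exhibiting finite sets closed under gluing.\<close>

lemma pt_subset:
  assumes "p \<in> K" and closed: "\<And>a b. (a, b) \<in> G \<Longrightarrow> a \<in> K \<longleftrightarrow> b \<in> K"
  shows "pt p \<subseteq> K"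
proof
  fix q assume "q \<in> pt p"
  then have "(p, q) \<in> (G \<union> G\<inverse>)\<^sup>*" by (simp add: surface_pt_def gluing_equiv_def)
  then show "q \<in> K" by induction (use assms in auto)
qed

text \<open>Gluings shift coordinates by integers, so the surface projects to the torus of the plane
  modulo the integer lattice.\<close>

lemma pt_eq_int_diff:
  assumes "(i, x, y) \<in> squares n" "(j, x', y') \<in> squares n" "pt (i, x, y) = pt (j, x', y')"
  shows "x' - x \<in> \<int> \<and> y' - y \<in> \<int>"
proof -
  let ?K = "{(j :: nat, x', y'). x' - x \<in> \<int> \<and> y' - y \<in> \<int>}"
  have "pt (i, x, y) \<subseteq> ?K"
  proof (rule pt_subset)
    fix a b assume "(a, b) \<in> G"
    moreover have "1 - u \<in> \<int> \<longleftrightarrow> 0 - u \<in> \<int>" for u :: real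
      using Ints_add[of "0 - u" 1] Ints_diff[of "1 - u" 1] by auto
    ultimately show "a \<in> ?K \<longleftrightarrow> b \<in> ?K" by (auto simp: side_gluing_iff)
  qed simp
  moreover have "(j, x', y') \<in> pt (i, x, y)" using assms mem_pt_iff by simp
  ultimately show ?thesis by auto
qed

lemma pt_in_surface: "p \<in> squares n \<Longrightarrow> pt p \<in> surface n \<sigma> \<tau>"
  unfolding surface_def surface_pt_def by (rule quotientI)

lemma in_surfaceE:
  assumes "P \<in> surface n \<sigma> \<tau>" obtains p where "p \<in> squares n" "P = pt p"
  using assms that unfolding surface_def surface_pt_def quotient_def by blast

lemma square_angle_nonneg: "0 \<le> square_angle p"
  by (auto simp: square_angle_def split: prod.splits)

lemma total_angle_mono: "finite K \<Longrightarrow> P \<subseteq> K \<Longrightarrow> total_angle P \<le> total_angle K"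
  unfolding total_angle_def by (intro sum_mono2 square_angle_nonneg)

lemma not_cone_if_subset:
  assumes "p \<in> K" and "\<And>a b. (a, b) \<in> G \<Longrightarrow> a \<in> K \<longleftrightarrow> b \<in> K" and "finite K" and "total_angle K \<le> 2 * pi"
  shows "pt p \<notin> cones"
  using total_angle_mono[OF assms(3) pt_subset[OF assms(1,2)]] assms(4) by (simp add: cone_points_def)

abbreviation "corner \<equiv> (\<lambda>(x :: real, y :: real). x \<in> {0, 1} \<and> y \<in> {0, 1})"

lemma not_cone_if_not_corner:
  assumes p: "(i, x, y) \<in> squares n" and nc: "\<not> corner (x, y)"
  shows "pt (i, x, y) \<notin> cones"
proof -
  have i: "i \<in> \<Omega>" using p by (simp add: squares_iff)
  consider "x \<notin> {0, 1}" "y \<notin> {0, 1}" | "x \<in> {0, 1}" "y \<notin> {0, 1}" | "x \<notin> {0, 1}" "y \<in> {0, 1}"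
    using nc by auto
  then show ?thesis
  proof cases
    case 1
    show ?thesis
    proof (rule not_cone_if_subset)
      show "(i, x, y) \<in> {(i, x, y)}" by simp
      show "a \<in> {(i, x, y)} \<longleftrightarrow> b \<in> {(i, x, y)}" if "(a, b) \<in> G" for a b
        using that 1 by (auto simp: side_gluing_iff)
    qed (use 1 in \<open>auto simp: total_angle_def square_angle_def\<close>)
  next
    case 2
    \<comment> \<open>\<open>j\<close> is the square that has the point on its right side.\<close>
    obtain j where j: "x = 1 \<and> i = j \<or> x = 0 \<and> i = \<sigma> j"
      using 2 permutes_inverses(1)[OF sigma] by (metis insertE singletonD)
    show ?thesis
    proof (rule not_cone_if_subset)
      show "(i, x, y) \<in> {(j, 1, y), (\<sigma> j, 0, y)}" using j by auto
      show "a \<in> {(j, 1, y), (\<sigma> j, 0, y)} \<longleftrightarrow> b \<in> {(j, 1, y), (\<sigma> j, 0, y)}" if "(a, b) \<in> G" for a b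
        using that 2 by (auto simp: side_gluing_iff sigma_inj)
    qed (use 2 in \<open>auto simp: total_angle_def square_angle_def\<close>)
  next
    case 3
    obtain j where j: "y = 1 \<and> i = j \<or> y = 0 \<and> i = \<tau> j"
      using 3 permutes_inverses(1)[OF tau] by (metis insertE singletonD)
    show ?thesis
    proof (rule not_cone_if_subset)
      show "(i, x, y) \<in> {(j, x, 1), (\<tau> j, x, 0)}" using j by auto
      show "a \<in> {(j, x, 1), (\<tau> j, x, 0)} \<longleftrightarrow> b \<in> {(j, x, 1), (\<tau> j, x, 0)}" if "(a, b) \<in> G" for a b
        using that 3 by (auto simp: side_gluing_iff tau_inj)
    qed (use 3 in \<open>auto simp: total_angle_def square_angle_def\<close>)
  qed
qed

lemma top_right_corner:
  assumes "j \<in> \<Omega>"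
  shows "pt (\<sigma> j, 0, 1) = pt (j, 1, 1)" "pt (\<tau> j, 1, 0) = pt (j, 1, 1)"
    "pt (\<tau> (\<sigma> j), 0, 0) = pt (j, 1, 1)" "pt (\<sigma> (\<tau> j), 0, 0) = pt (j, 1, 1)"
proof -
  have s: "\<sigma> j \<in> \<Omega>" and t: "\<tau> j \<in> \<Omega>" using assms by (simp_all only: sigma_in tau_in)
  show 1: "pt (\<sigma> j, 0, 1) = pt (j, 1, 1)" by (rule pt_right[symmetric]) (use assms in auto)
  show 2: "pt (\<tau> j, 1, 0) = pt (j, 1, 1)" by (rule pt_top[symmetric]) (use assms in auto)
  show "pt (\<tau> (\<sigma> j), 0, 0) = pt (j, 1, 1)"
    unfolding 1[symmetric] by (rule pt_top[symmetric]) (use s in auto)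
  show "pt (\<sigma> (\<tau> j), 0, 0) = pt (j, 1, 1)"
    unfolding 2[symmetric] by (rule pt_right[symmetric]) (use t in auto)
qed

lemma cone_corner_iff:
  assumes j: "j \<in> \<Omega>"
  shows "pt (j, 1, 1) \<in> cones \<longleftrightarrow> j \<notin> regular"
proof
  show "j \<notin> regular" if "pt (j, 1, 1) \<in> cones"
  proof
    assume "j \<in> regular"
    then have c: "\<sigma> (\<tau> j) = \<tau> (\<sigma> j)" by (simp add: commuting_def)
    \<comment> \<open>These four corners close up around the vertex because of
      \<open>c\<close>.\<close>
    let ?K = "{(j, 1, 1), (\<sigma> j, 0, 1), (\<tau> j, 1, 0), (\<tau> (\<sigma> j), 0, 0 :: real)} :: (nat \<times> real \<times> real) set"
    have "pt (j, 1, 1) \<notin> cones"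
    proof (rule not_cone_if_subset)
      show "(j, 1, 1) \<in> ?K" by simp
      show "a \<in> ?K \<longleftrightarrow> b \<in> ?K" if g: "(a, b) \<in> G" for a b
      proof -
        consider k u where "a = (k, 1, u)" "b = (\<sigma> k, 0, u)" | k u where "a = (k, u, 1)" "b = (\<tau> k, u, 0)"
          using g unfolding side_gluing_iff by blast
        then show ?thesis
        proof cases
          case 1
          then show ?thesis by (auto simp: c[symmetric] sigma_inj)
        next
          case 2
          then show ?thesis by (auto simp: tau_inj)
        qed
      qed
    qed (auto simp: total_angle_def square_angle_def)
    with that show False by blast
  qed
next
  assume "j \<notin> regular"
  then have c: "\<sigma> (\<tau> j) \<noteq> \<tau> (\<sigma> j)" using j by (simp add: commuting_def)
  \<comment> \<open>Five corners, distinct by \<open>c\<close>, of angle \<open>pi / 2\<close> each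
    exceed \<open>2 * pi\<close>. Finiteness of the class has to be shown as well, since
    \<open>sum\<close> over an infinite set would be 0.\<close>
  let ?K = "{(j, 1, 1), (\<sigma> j, 0, 1), (\<tau> j, 1, 0), (\<tau> (\<sigma> j), 0, 0), (\<sigma> (\<tau> j), 0, 0)} :: (nat \<times> real \<times> real) set"
  have J: "(j, 1, 1) \<in> squares n" using j by (simp add: squares_iff)
  have "\<sigma> j \<in> \<Omega>" "\<tau> j \<in> \<Omega>" "\<tau> (\<sigma> j) \<in> \<Omega>" "\<sigma> (\<tau> j) \<in> \<Omega>"
    using j by (simp_all only: sigma_in tau_in)
  then have "?K \<subseteq> squares n" using j by (simp add: squares_def)
  then have "?K \<subseteq> pt (j, 1, 1)"
    by (simp add: mem_pt_iff[OF J] top_right_corner[OF j])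
  moreover have "finite (pt (j, 1, 1))"
  proof (rule finite_subset)
    let ?L = "{p \<in> squares n. corner (snd p)}"
    show "pt (j, 1, 1) \<subseteq> ?L"
    proof (rule pt_subset)
      fix a b assume g: "(a, b) \<in> G"
      then have "corner (snd a) \<longleftrightarrow> corner (snd b)" by (auto simp: side_gluing_iff)
      then show "a \<in> ?L \<longleftrightarrow> b \<in> ?L" using side_gluing_squares[OF g] by simp
    qed (use J in simp)
    show "finite ?L"
      by (rule finite_subset[of _ "\<Omega> \<times> {0, 1} \<times> {0, 1}"]) (auto simp: squares_def)
  qed
  ultimately have "total_angle ?K \<le> total_angle (pt (j, 1, 1))" by (intro total_angle_mono)
  moreover have "total_angle ?K = 5 * (pi / 2)"
    using c by (auto simp: total_angle_def square_angle_def)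
  ultimately have "total_angle (pt (j, 1, 1)) > 2 * pi" using pi_gt_zero by linarith
  then show "pt (j, 1, 1) \<in> cones" using pt_in_surface[OF J] by (simp add: cone_points_def)
qed

text \<open>A corner in any position is the top right corner of the same, an adjacent or a
  diagonally adjacent square, and passing to that square permutes the labels. Thus counts of regular
  squares apply to all four positions.\<close>

lemma corner_representatives:
  assumes "x \<in> {0, 1}" "y \<in> {0, 1}"
  obtains \<rho> where "\<rho> permutes \<Omega>" "\<And>j. j \<in> \<Omega> \<Longrightarrow> pt (\<rho> j, x, y) = pt (j, 1, 1)"
proof -
  consider "x = 1 \<and> y = 1" | "x = 0 \<and> y = 1" | "x = 1 \<and> y = 0" | "x = 0 \<and> y = 0"
    using assms by blast
  then show ?thesis
  proof cases
    case 1 then show ?thesis using that[of id] permutes_id by simp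
  next
    case 2 then show ?thesis using that[of \<sigma>] sigma top_right_corner by simp
  next
    case 3 then show ?thesis using that[of \<tau>] tau top_right_corner by simp
  next
    case 4 then show ?thesis
      using that[of "\<tau> \<circ> \<sigma>"] permutes_compose[OF sigma tau] top_right_corner by simp
  qed
qed

lemma card_not_cone_le:
  assumes "x \<in> {0, 1}" "y \<in> {0, 1}"
  shows "card {i\<in>\<Omega>. pt (i, x, y) \<notin> cones} \<le> card regular"
proof -
  obtain \<rho> where \<rho>: "\<rho> permutes \<Omega>" "\<And>j. j \<in> \<Omega> \<Longrightarrow> pt (\<rho> j, x, y) = pt (j, 1, 1)"
    using corner_representatives[OF assms] by metis
  have fin: "finite regular" using finite_subset[OF commuting_subset] by blast
  have "{i\<in>\<Omega>. pt (i, x, y) \<notin> cones} \<subseteq> \<rho> ` regular"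
  proof clarify
    fix i assume i: "i \<in> \<Omega>" "pt (i, x, y) \<notin> cones"
    then obtain j where j: "j \<in> \<Omega>" "i = \<rho> j" using permutes_image[OF \<rho>(1)] by blast
    then have "j \<in> regular" using \<rho>(2)[of j] cone_corner_iff i(2) by metis
    then show "i \<in> \<rho> ` regular" using j by blast
  qed
  then show ?thesis using fin by (meson surj_card_le)
qed

section \<open>Components without cone points\<close>

lemma continuous_pt: "continuous_map (top_of_set (squares n)) (surface_topology n \<sigma> \<tau>) pt"
proof -
  have "openin (surface_topology n \<sigma> \<tau>) (surface n \<sigma> \<tau>)"
  proof -
    have "{p \<in> squares n. pt p \<in> surface n \<sigma> \<tau>} = squares n" using pt_in_surface by blast
    then show ?thesis by (simp add: openin_surface_topology)
  qed
  then have "surface n \<sigma> \<tau> \<subseteq> topspace (surface_topology n \<sigma> \<tau>)" by (rule openin_subset)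
  then show ?thesis
    using pt_in_surface by (auto simp: continuous_map_def openin_surface_topology)
qed

lemma topspace_surface: "topspace (surface_topology n \<sigma> \<tau>) \<subseteq> surface n \<sigma> \<tau>"
  using openin_topspace[of "surface_topology n \<sigma> \<tau>"] unfolding openin_surface_topology by blast

lemma component_square:
  assumes C: "C \<in> connected_components_of (surface_topology n \<sigma> \<tau>)"
    and p: "(i, x, y) \<in> squares n" "pt (i, x, y) \<in> C" and q: "(i, x', y') \<in> squares n"
  shows "pt (i, x', y') \<in> C"
proof -
  let ?Q = "{i} \<times> {0..1::real} \<times> {0..1::real}"
  have i: "i \<in> \<Omega>" using p by (simp add: squares_iff)
  have "connectedin (top_of_set (squares n)) ?Q"
  proof -
    have "connected ?Q" by (intro connected_Times) auto
    moreover have "?Q \<subseteq> squares n" using i by (auto simp: squares_def)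
    ultimately show ?thesis by (simp add: connectedin_subtopology)
  qed
  then have "connectedin (surface_topology n \<sigma> \<tau>) (pt ` ?Q)"
    by (rule connectedin_continuous_map_image[OF continuous_pt])
  moreover have "\<not> disjnt C (pt ` ?Q)"
  proof -
    have "pt (i, x, y) \<in> pt ` ?Q" using p(1) by (intro imageI) (simp add: squares_iff)
    with p(2) show ?thesis unfolding disjnt_def by blast
  qed
  ultimately have "pt ` ?Q \<subseteq> C" using C connected_components_of_maximal by blast
  moreover have "pt (i, x', y') \<in> pt ` ?Q" using q by (intro imageI) (simp add: squares_iff)
  ultimately show ?thesis by blast
qed

text \<open>A flag on labels rather than on points. It is unchanged by crossing a side, false for a
  square with a cone point and true for one with a marked point, so it shows that a line starting at
  a cone point meets no marked point.\<close>

definition on_torus :: "nat \<Rightarrow> bool" where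
  "on_torus i \<longleftrightarrow> (\<exists>C \<in> connected_components_of (surface_topology n \<sigma> \<tau>). pt (i, 0, 0) \<in> C \<and> C \<inter> cones = {})"

lemma on_torus_iff:
  assumes "(i, x, y) \<in> squares n"
  shows "on_torus i \<longleftrightarrow> (\<exists>C \<in> connected_components_of (surface_topology n \<sigma> \<tau>). pt (i, x, y) \<in> C \<and> C \<inter> cones = {})"
proof -
  have sq: "(i, 0, 0) \<in> squares n" using assms by (simp add: squares_iff)
  have "pt (i, 0, 0) \<in> C \<longleftrightarrow> pt (i, x, y) \<in> C"
    if "C \<in> connected_components_of (surface_topology n \<sigma> \<tau>)" for C
    using component_square[OF that assms _ sq] component_square[OF that sq _ assms] by (rule iffI[rotated])
  then show ?thesis unfolding on_torus_def by (intro bex_cong refl) simp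
qed

lemma on_torus_sigma: "i \<in> \<Omega> \<Longrightarrow> on_torus (\<sigma> i) \<longleftrightarrow> on_torus i"
  using on_torus_iff[of i 1 0] on_torus_iff[of "\<sigma> i" 0 0] pt_right[of i 0] sigma_in[of i] by (simp add: squares_iff)

lemma on_torus_tau: "i \<in> \<Omega> \<Longrightarrow> on_torus (\<tau> i) \<longleftrightarrow> on_torus i"
  using on_torus_iff[of i 0 1] on_torus_iff[of "\<tau> i" 0 0] pt_top[of i 0] tau_in[of i] by (simp add: squares_iff)

lemma not_on_torus_if_cone: "(i, x, y) \<in> squares n \<Longrightarrow> pt (i, x, y) \<in> cones \<Longrightarrow> \<not> on_torus i"
  unfolding on_torus_iff[of i x y] by fast

lemma on_torus_if_marked: "(i, x, y) \<in> squares n \<Longrightarrow> pt (i, x, y) \<in> marks \<Longrightarrow> on_torus i"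
proof -
  assume p: "(i, x, y) \<in> squares n" and "pt (i, x, y) \<in> marks"
  then obtain C where C: "C \<in> connected_components_of (surface_topology n \<sigma> \<tau>)" "C \<inter> cones = {}"
    and eq: "pt (i, x, y) = (SOME P. P \<in> C)" by (auto simp: marked_points_def)
  have "(SOME P. P \<in> C) \<in> C" using nonempty_connected_components_of[OF C(1)] by (simp add: some_in_eq)
  with eq C show "on_torus i" using on_torus_iff[OF p] by metis
qed

lemma marks_in_surface: "marks \<subseteq> surface n \<sigma> \<tau>"
proof
  fix P assume "P \<in> marks"
  then obtain C where C: "C \<in> connected_components_of (surface_topology n \<sigma> \<tau>)"
    and eq: "P = (SOME P. P \<in> C)" by (auto simp: marked_points_def)
  have "P \<in> C" unfolding eq using nonempty_connected_components_of[OF C(1)] by (simp add: some_in_eq)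
  then show "P \<in> surface n \<sigma> \<tau>" using connected_components_of_subset[OF C] topspace_surface by blast
qed

end

section \<open>Saddle connections\<close>

text \<open>
  The labels of the squares met by a line with primitive direction \<open>(p, q)\<close> starting in a corner: in
  units of \<open>1 / (p * q)\<close> of its length, the line crosses a vertical side at the multiples of \<open>q\<close> and a
  horizontal one at the multiples of \<open>p\<close>, and never both before the end.
\<close>

primrec cell :: "nat \<Rightarrow> nat \<Rightarrow> (nat \<Rightarrow> nat) \<Rightarrow> (nat \<Rightarrow> nat) \<Rightarrow> nat \<Rightarrow> nat \<Rightarrow> nat" where
  "cell p q S T 0 i = i"
| "cell p q S T (Suc k) i =
     (if q dvd Suc k then S (cell p q S T k i)
      else if p dvd Suc k then T (cell p q S T k i) else cell p q S T k i)"

lemma cell_permutes: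
  assumes "S permutes A" and "T permutes A"
  shows "cell p q S T k permutes A"
proof (induction k)
  case 0
  have "cell p q S T 0 = id" by auto
  then show ?case using permutes_id by metis
next
  case (Suc k)
  have "cell p q S T (Suc k) = (if q dvd Suc k then S \<circ> cell p q S T k
      else if p dvd Suc k then T \<circ> cell p q S T k else cell p q S T k)"
    by auto
  then show ?case using Suc permutes_compose[OF Suc] assms by simp
qed

text \<open>On piece number \<open>k\<close> of a line in direction \<open>(p, q)\<close>, the first
  coordinate runs from \<open>k / q\<close> to \<open>(k + 1) / q\<close>; so it stays within the
  column of squares number \<open>k div q\<close>.\<close>

lemma div_le_bounds:
  fixes k q :: nat
  assumes "0 < q"
  shows "real (k div q) \<le> real k / real q" and "(real k + 1) / real q \<le> real (k div q) + 1"
proof -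
  have "k div q * q \<le> k" by simp
  then have "real (k div q) * real q \<le> real k" by (metis of_nat_le_iff of_nat_mult)
  then show "real (k div q) \<le> real k / real q" using assms by (simp add: pos_le_divide_eq)
  have "k < q * (k div q) + q" using dividend_less_times_div[OF assms, of k] by (simp add: add.commute)
  then have "k + 1 \<le> (k div q + 1) * q" by (simp add: algebra_simps)
  then have "real (k + 1) \<le> real ((k div q + 1) * q)" by (simp only: of_nat_le_iff)
  then show "(real k + 1) / real q \<le> real (k div q) + 1"
    using assms by (simp add: pos_divide_le_eq algebra_simps)
qed

text \<open>Bezout; this keeps lattice points out of the interior of a primitive segment.\<close>

lemma integer_if_multiples_integer:
  fixes s :: real and p q :: int
  assumes "coprime p q" and "s * p \<in> \<int>" and "s * q \<in> \<int>"
  shows "s \<in> \<int>"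
proof -
  obtain u v where uv: "u * p + v * q = 1"
    using assms(1) by (metis bezout_int coprime_imp_gcd_eq_1)
  have "s = real_of_int u * (s * p) + real_of_int v * (s * q)"
  proof -
    have "real_of_int u * (s * p) + real_of_int v * (s * q) = s * real_of_int (u * p + v * q)"
      by (simp add: algebra_simps)
    then show ?thesis using uv by simp
  qed
  also have "\<dots> \<in> \<int>" by (rule Ints_add; rule Ints_mult) (use assms in auto)
  finally show ?thesis .
qed

lemma no_integer_between_0_1: "0 < s \<Longrightarrow> s < 1 \<Longrightarrow> (s :: real) \<notin> \<int>"
  by (auto elim!: Ints_cases)

text \<open>
  The flags select the quadrant of the direction: a coordinate is mirrored if its flag is set.
\<close>

definition flip :: "bool \<Rightarrow> real \<Rightarrow> real" where "flip b u = (if b then 1 - u else u)"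
definition dir :: "bool \<Rightarrow> real" where "dir b = (if b then - 1 else 1)"

lemma flip_in_01 [simp]: "flip b u \<in> {0..1} \<longleftrightarrow> u \<in> {0..1}"
  by (auto simp: flip_def)

lemma flip_int [simp]: "flip b u \<in> \<int> \<longleftrightarrow> u \<in> \<int>"
  using Ints_diff[of 1 "1 - u"] by (auto simp: flip_def)

lemma flip_corner: "flip b 0 \<in> {0, 1}" "flip b 1 \<in> {0, 1}"
  by (auto simp: flip_def)

lemma flip_line: "flip b (- c) + s * (dir b * r) = flip b (s * r - c)"
  by (auto simp: flip_def dir_def)

context square_tiled
begin

text \<open>The line is cut into \<open>m\<close> pieces of equal length, one for each square of the
  chain. Marked points are excluded through \<open>on_torus\<close>: it fails in the first square,
  which contains a cone point, and keeps its value along the chain.\<close>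

lemma chain_in_Hol:
  fixes a :: "nat \<Rightarrow> real \<times> real"
  assumes m: "0 < m" and v: "v \<noteq> 0"
    and sq: "\<And>k s. k < m \<Longrightarrow> s \<in> {real k / m..(real k + 1) / m} \<Longrightarrow> (i k, a k + s *\<^sub>R v) \<in> squares n"
    and join: "\<And>k. Suc k < m \<Longrightarrow>
      pt (i k, a k + ((real k + 1) / m) *\<^sub>R v) = pt (i (Suc k), a (Suc k) + ((real k + 1) / m) *\<^sub>R v)"
    and on_torus: "\<And>k. Suc k < m \<Longrightarrow> on_torus (i (Suc k)) \<longleftrightarrow> on_torus (i k)"
    and start: "pt (i 0, a 0) \<in> cones" and final: "pt (i (m - 1), a (m - 1) + v) \<in> cones"
    and interior: "\<And>k s. k < m \<Longrightarrow> s \<in> {real k / m..(real k + 1) / m} \<Longrightarrow> 0 < s \<Longrightarrow> s < 1 \<Longrightarrow>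
      pt (i k, a k + s *\<^sub>R v) \<notin> cones"
  shows "v \<in> Hol n \<sigma> \<tau>"
proof -
  \<comment> \<open>The piece containing \<open>s\<close>. At a common end of two pieces this is the
    later one, and \<open>join\<close> makes the choice harmless; the minimum takes effect at
    \<open>s = 1\<close>.\<close>
  define K where "K s = min (m - 1) (nat \<lfloor>s * real m\<rfloor>)" for s
  define \<gamma> where "\<gamma> s = pt (i (K s), a (K s) + s *\<^sub>R v)" for s
  have \<gamma>: "\<gamma> s = pt (i k, a k + s *\<^sub>R v)" if k: "k < m" and s: "s \<in> {real k / m..(real k + 1) / m}" for k s
  proof (cases "s = (real k + 1) / m")
    case False
    then have "real k \<le> s * m" "s * m < real k + 1" using s m by (auto simp: field_simps)
    then have "\<lfloor>s * real m\<rfloor> = int k" by (simp add: floor_eq_iff)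
    then have "K s = k" using k by (simp add: K_def)
    then show ?thesis by (simp add: \<gamma>_def)
  next
    case True
    then have "s * real m = real (Suc k)" using m by simp
    then have K: "K s = min (m - 1) (Suc k)" by (simp add: K_def)
    show ?thesis
    proof (cases "Suc k < m")
      case True
      then have "K s = Suc k" using K by simp
      then show ?thesis using join[OF True] \<open>s = (real k + 1) / m\<close> by (simp add: \<gamma>_def)
    next
      case False
      then have "K s = k" using K k by simp
      then show ?thesis by (simp add: \<gamma>_def)
    qed
  qed
  have seg: "straight_segment n \<sigma> \<tau> v \<gamma>"
    unfolding straight_segment_def
  proof (intro conjI exI allI impI ballI)
    show "v \<noteq> 0" by (rule v)
    show "real 0 / real m = 0" by simp
    show "real m / real m = 1" using m by simp
    fix k assume k: "k < m"
    show "real k / real m < real (Suc k) / real m" using m by (simp add: divide_strict_right_mono)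
    fix s assume "s \<in> {real k / real m..real (Suc k) / real m}"
    then have s: "s \<in> {real k / m..(real k + 1) / m}" by (simp add: add.commute)
    show "(i k, a k + s *\<^sub>R v) \<in> squares n" using sq[OF k s] .
    show "\<gamma> s = pt (i k, a k + s *\<^sub>R v)" using \<gamma>[OF k s] .
  qed
  have \<gamma>0: "\<gamma> 0 \<in> cones" using \<gamma>[of 0 0] m start by simp
  have \<gamma>1: "\<gamma> 1 \<in> cones"
    using \<gamma>[of "m - 1" 1] m final by (simp add: of_nat_diff)
  have nf: "\<not> on_torus (i k)" if "k < m" for k
    using that
  proof (induction k)
    case 0
    have "(i 0, a 0) \<in> squares n" using sq[of 0 0] m by simp
    then show ?case using not_on_torus_if_cone[of "i 0" "fst (a 0)" "snd (a 0)"] start by simp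
  next
    case (Suc k)
    then show ?case using on_torus[of k] by simp
  qed
  have int: "\<gamma> s \<notin> cones \<union> marks" if s: "s \<in> {0<..<1}" for s
  proof -
    let ?k = "nat \<lfloor>s * real m\<rfloor>"
    have s0: "0 \<le> s * m" "s * m < m" using s m by auto
    have km: "real ?k \<le> s * m" "s * m < real ?k + 1" using s0 by linarith+
    then have k: "?k < m" using s0 by linarith
    have sk: "s \<in> {real ?k / m..(real ?k + 1) / m}" using km m by (simp add: field_simps)
    have "pt (i ?k, a ?k + s *\<^sub>R v) \<notin> marks"
      using on_torus_if_marked[of "i ?k" "fst (a ?k + s *\<^sub>R v)" "snd (a ?k + s *\<^sub>R v)"] sq[OF k sk] nf[OF k]
      by (simp only: prod.collapse) blast
    then show ?thesis using \<gamma>[OF k sk] interior[OF k sk] s by auto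
  qed
  show ?thesis
    unfolding Hol_def saddle_connection_def using seg \<gamma>0 \<gamma>1 int by blast
qed

definition step_h :: "bool \<Rightarrow> nat \<Rightarrow> nat" where "step_h b = (if b then inv \<sigma> else \<sigma>)"
definition step_v :: "bool \<Rightarrow> nat \<Rightarrow> nat" where "step_v b = (if b then inv \<tau> else \<tau>)"

lemma step_h_permutes: "step_h b permutes \<Omega>"
  using sigma permutes_inv[OF sigma] by (simp add: step_h_def)

lemma step_v_permutes: "step_v b permutes \<Omega>"
  using tau permutes_inv[OF tau] by (simp add: step_v_def)

lemma pt_step_h:
  assumes "i \<in> \<Omega>" "y \<in> {0..1}"
  shows "pt (i, flip b 1, y) = pt (step_h b i, flip b 0, y)"
proof (cases b)
  case True
  have "inv \<sigma> i \<in> \<Omega>" using assms(1) permutes_in_image[OF permutes_inv[OF sigma]] by blast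
  then show ?thesis
    using pt_right[of "inv \<sigma> i" y] True assms(2) by (simp add: flip_def step_h_def permutes_inverses(1)[OF sigma])
qed (use assms pt_right in \<open>simp add: flip_def step_h_def\<close>)

lemma pt_step_v:
  assumes "i \<in> \<Omega>" "x \<in> {0..1}"
  shows "pt (i, x, flip b 1) = pt (step_v b i, x, flip b 0)"
proof (cases b)
  case True
  have "inv \<tau> i \<in> \<Omega>" using assms(1) permutes_in_image[OF permutes_inv[OF tau]] by blast
  then show ?thesis
    using pt_top[of "inv \<tau> i" x] True assms(2) by (simp add: flip_def step_v_def permutes_inverses(1)[OF tau])
qed (use assms pt_top in \<open>simp add: flip_def step_v_def\<close>)

lemma on_torus_step_h: "i \<in> \<Omega> \<Longrightarrow> on_torus (step_h b i) \<longleftrightarrow> on_torus i"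
  using on_torus_sigma[of i] on_torus_sigma[of "inv \<sigma> i"] permutes_in_image[OF permutes_inv[OF sigma], of i]
  by (simp add: step_h_def permutes_inverses(1)[OF sigma])

lemma on_torus_step_v: "i \<in> \<Omega> \<Longrightarrow> on_torus (step_v b i) \<longleftrightarrow> on_torus i"
  using on_torus_tau[of i] on_torus_tau[of "inv \<tau> i"] permutes_in_image[OF permutes_inv[OF tau], of i]
  by (simp add: step_v_def permutes_inverses(1)[OF tau])

text \<open>At most \<open>card regular\<close> labels fail at the start, and at most as many at the
  end because \<open>w\<close> is a bijection; together these are fewer than
  \<open>n\<close>.\<close>

lemma exists_cone_to_cone:
  assumes few: "2 * card regular < n" and w: "w permutes \<Omega>"
    and c: "x \<in> {0, 1}" "y \<in> {0, 1}" "x' \<in> {0, 1}" "y' \<in> {0, 1}"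
  obtains i where "i \<in> \<Omega>" "pt (i, x, y) \<in> cones" "pt (w i, x', y') \<in> cones"
proof -
  let ?Z = "{i\<in>\<Omega>. pt (i, x, y) \<notin> cones}"
  let ?Y = "{i\<in>\<Omega>. pt (i, x', y') \<notin> cones}"
  let ?W = "{i\<in>\<Omega>. pt (w i, x', y') \<notin> cones}"
  have "card ?W \<le> card ?Y"
    using permutes_in_image[OF w] permutes_inj_on[OF w]
    by (intro card_inj_on_le[of w]) auto
  then have "card (?Z \<union> ?W) < n"
    using card_Un_le[of ?Z ?W] card_not_cone_le[OF c(1,2)] card_not_cone_le[OF c(3,4)] few by linarith
  then have "\<not> \<Omega> \<subseteq> ?Z \<union> ?W" using card_mono[of "?Z \<union> ?W" \<Omega>] by fastforce
  then show ?thesis using that by blast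
qed

lemma primitive_in_Hol:
  fixes p q :: nat
  assumes few: "2 * card regular < n" and p: "0 < p" and q: "0 < q" and cop: "coprime p q"
  shows "(dir bx * p, dir by * q) \<in> Hol n \<sigma> \<tau>"
proof -
  define w where "w = cell p q (step_h bx) (step_v by)"
  have w: "w k permutes \<Omega>" for k
    unfolding w_def by (rule cell_permutes[OF step_h_permutes step_v_permutes])
  \<comment> \<open>The last label is the one after \<open>p * q - 1\<close> steps: step
    \<open>p * q\<close> is the corner at the end, where both divisibility conditions of
    \<open>cell\<close> hold.\<close>
  obtain i where i: "i \<in> \<Omega>" and i0: "pt (i, flip bx 0, flip by 0) \<in> cones"
    and i1: "pt (w (p * q - 1) i, flip bx 1, flip by 1) \<in> cones"
    by (rule exists_cone_to_cone[OF few w flip_corner(1,1,2,2)])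
  have wi: "w k i \<in> \<Omega>" for k using permutes_in_image[OF w] i by blast
  let ?v = "(dir bx * p, dir by * q)"
  let ?m = "p * q"
  \<comment> \<open>Subtracting the numbers of columns and rows crossed so far moves the line back
    into the unit square.\<close>
  define a where "a k = (flip bx (- real (k div q)), flip by (- real (k div p)))" for k
  have pos: "a k + s *\<^sub>R ?v = (flip bx (s * p - real (k div q)), flip by (s * q - real (k div p)))" for k s
    by (simp add: a_def flip_line)
  have s_bounds: "real k / q \<le> s * p" "s * p \<le> (real k + 1) / q" "real k / p \<le> s * q" "s * q \<le> (real k + 1) / p"
    if "s \<in> {real k / real ?m..(real k + 1) / real ?m}" for k s
    using that p q by (auto simp: field_simps)
  show ?thesis
  proof (rule chain_in_Hol[where m = ?m and i = "\<lambda>k. w k i" and a = a])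
    show "0 < ?m" using p q by simp
    show "?v \<noteq> 0" using p by (simp add: dir_def zero_prod_def)
    show "(w k i, a k + s *\<^sub>R ?v) \<in> squares n"
      if "k < ?m" and s: "s \<in> {real k / real ?m..(real k + 1) / real ?m}" for k s
      unfolding pos squares_iff flip_in_01
      using s_bounds[OF s] div_le_bounds[OF p, of k] div_le_bounds[OF q, of k] wi by auto
    show "pt (w 0 i, a 0) \<in> cones" using i0 by (simp add: w_def a_def)
    show "pt (w (?m - 1) i, a (?m - 1) + ?v) \<in> cones"
    proof -
      have S: "Suc (?m - 1) = p * q" using p q by simp
      have "Suc ((?m - 1) div q) = p" using div_Suc[of "?m - 1" q] q unfolding S by simp
      moreover have "Suc ((?m - 1) div p) = q" using div_Suc[of "?m - 1" p] p unfolding S by simp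
      ultimately have "real p - real ((?m - 1) div q) = 1" "real q - real ((?m - 1) div p) = 1"
        by linarith+
      then have "a (?m - 1) + ?v = (flip bx 1, flip by 1)" using pos[of "?m - 1" 1] by simp
      then show ?thesis using i1 by simp
    qed
    show "pt (w k i, a k + s *\<^sub>R ?v) \<notin> cones"
      if k: "k < ?m" and s: "s \<in> {real k / real ?m..(real k + 1) / real ?m}" and s01: "0 < s" "s < 1" for k s
    proof -
      have "\<not> corner (a k + s *\<^sub>R ?v)"
      proof
        assume "corner (a k + s *\<^sub>R ?v)"
        then have c: "flip bx (s * p - real (k div q)) \<in> {0, 1}" "flip by (s * q - real (k div p)) \<in> {0, 1}"
          unfolding pos by simp_all
        have "{0, 1} \<subseteq> (\<int> :: real set)" by simp
        then have "s * p - real (k div q) \<in> \<int>" "s * q - real (k div p) \<in> \<int>"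
          using c flip_int by blast+
        from Ints_add[OF this(1) Ints_of_nat[of "k div q"]] Ints_add[OF this(2) Ints_of_nat[of "k div p"]]
        have "s \<in> \<int>"
          using integer_if_multiples_integer[of "int p" "int q" s] cop by simp
        then show False using no_integer_between_0_1 s01 by blast
      qed
      moreover have "(w k i, a k + s *\<^sub>R ?v) \<in> squares n"
        unfolding pos squares_iff flip_in_01
        using s_bounds[OF s] div_le_bounds[OF p, of k] div_le_bounds[OF q, of k] wi by auto
      ultimately show ?thesis unfolding pos by (intro not_cone_if_not_corner)
    qed
    fix k assume k: "Suc k < ?m"
    show "on_torus (w (Suc k) i) \<longleftrightarrow> on_torus (w k i)"
      using on_torus_step_h on_torus_step_v wi[of k] by (simp add: w_def)
    let ?s = "(real k + 1) / real ?m"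
    have sp: "?s * p = real (Suc k) / q" and sq: "?s * q = real (Suc k) / p" using p q by (auto simp: field_simps)
    have sS: "?s \<in> {real k / real ?m..(real k + 1) / real ?m}" by (simp add: divide_right_mono)
    \<comment> \<open>Otherwise the line would pass through a corner before its end. Hence each step
      crosses at most one side.\<close>
    have ndvd: "\<not> (p dvd Suc k \<and> q dvd Suc k)"
    proof
      assume "p dvd Suc k \<and> q dvd Suc k"
      then have "p * q dvd Suc k" using cop by (blast intro: divides_mult)
      then have "p * q \<le> Suc k" by (rule dvd_imp_le) simp
      with k show False by simp
    qed
    show "pt (w k i, a k + ?s *\<^sub>R ?v) = pt (w (Suc k) i, a (Suc k) + ?s *\<^sub>R ?v)"
    proof -
      have divq: "Suc k div q = (if q dvd Suc k then Suc (k div q) else k div q)"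
        and divp: "Suc k div p = (if p dvd Suc k then Suc (k div p) else k div p)"
        by (simp_all add: div_Suc dvd_eq_mod_eq_0)
      have realq: "q dvd Suc k \<Longrightarrow> real (Suc k) / q = real (Suc k div q)"
        and realp: "p dvd Suc k \<Longrightarrow> real (Suc k) / p = real (Suc k div p)"
        by (simp_all add: real_of_nat_div)
      have bx01: "?s * p - real (k div q) \<in> {0..1}" and by01: "?s * q - real (k div p) \<in> {0..1}"
        using s_bounds[OF sS] div_le_bounds[OF p, of k] div_le_bounds[OF q, of k] by auto
      consider "q dvd Suc k" "\<not> p dvd Suc k" | "\<not> q dvd Suc k" "p dvd Suc k" | "\<not> q dvd Suc k" "\<not> p dvd Suc k"
        using ndvd by blast
      then show ?thesis
      proof cases
        case 1
        then have x: "?s * p - real (k div q) = 1" "?s * p - real (Suc k div q) = 0"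
          unfolding sp using realq divq by simp_all
        have y: "Suc k div p = k div p" using 1 divp by simp
        have "w (Suc k) i = step_h bx (w k i)" using 1 by (simp add: w_def)
        then show ?thesis
          unfolding pos x y by (simp only:) (rule pt_step_h[OF wi], simp only: flip_in_01 by01)
      next
        case 2
        then have y: "?s * q - real (k div p) = 1" "?s * q - real (Suc k div p) = 0"
          unfolding sq using realp divp by simp_all
        have x: "Suc k div q = k div q" using 2 divq by simp
        have "w (Suc k) i = step_v by (w k i)" using 2 by (simp add: w_def)
        then show ?thesis
          unfolding pos x y by (simp only:) (rule pt_step_v[OF wi], simp only: flip_in_01 bx01)
      next
        case 3
        then show ?thesis unfolding pos by (simp add: divp divq w_def)
      qed
    qed
  qed
qed

text \<open>The pieces in \<open>primitive_in_Hol\<close> presuppose positive \<open>p\<close> and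
  \<open>q\<close>. Here the segment is a single side, the bottom side of square \<open>i\<close>,
  traversed in the direction given by \<open>b\<close>.\<close>

lemma horizontal_in_Hol:
  assumes few: "2 * card regular < n"
  shows "(dir b, 0) \<in> Hol n \<sigma> \<tau>"
proof -
  obtain i where i: "i \<in> \<Omega>" "pt (i, flip b 0, 0) \<in> cones" "pt (id i, flip b 1, 0) \<in> cones"
    by (rule exists_cone_to_cone[OF few permutes_id flip_corner(1) _ flip_corner(2), of 0 0 b b]) auto
  have pos: "(flip b 0, 0) + s *\<^sub>R (dir b, 0) = (flip b s, 0)" for s
    using flip_line[of b 0 s 1] by simp
  show ?thesis
  proof (rule chain_in_Hol[where m = 1 and i = "\<lambda>_. i" and a = "\<lambda>_. (flip b 0, 0)"])
    show "(dir b, 0) \<noteq> (0 :: real \<times> real)" by (simp add: dir_def zero_prod_def)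
    show "pt (i, (flip b 0, 0) + (dir b, 0)) \<in> cones" using pos[of 1] i by simp
    fix k :: nat and s :: real assume k: "k < 1" and s: "s \<in> {real k / real 1..(real k + 1) / real 1}"
    show sq: "(i, (flip b 0, 0) + s *\<^sub>R (dir b, 0)) \<in> squares n"
      unfolding pos squares_iff flip_in_01 using i k s by auto
    assume "0 < s" "s < 1"
    then show "pt (i, (flip b 0, 0) + s *\<^sub>R (dir b, 0)) \<notin> cones"
      using sq unfolding pos by (intro not_cone_if_not_corner) (auto simp: flip_def split: if_splits)
  qed (use i in auto)
qed

lemma vertical_in_Hol:
  assumes few: "2 * card regular < n"
  shows "(0, dir b) \<in> Hol n \<sigma> \<tau>"
proof -
  obtain i where i: "i \<in> \<Omega>" "pt (i, 0, flip b 0) \<in> cones" "pt (id i, 0, flip b 1) \<in> cones"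
    by (rule exists_cone_to_cone[OF few permutes_id _ flip_corner(1) _ flip_corner(2), of 0 0 b b]) auto
  have pos: "(0, flip b 0) + s *\<^sub>R (0, dir b) = (0, flip b s)" for s
    using flip_line[of b 0 s 1] by simp
  show ?thesis
  proof (rule chain_in_Hol[where m = 1 and i = "\<lambda>_. i" and a = "\<lambda>_. (0, flip b 0)"])
    show "(0, dir b) \<noteq> (0 :: real \<times> real)" by (simp add: dir_def zero_prod_def)
    show "pt (i, (0, flip b 0) + (0, dir b)) \<in> cones" using pos[of 1] i by simp
    fix k :: nat and s :: real assume k: "k < 1" and s: "s \<in> {real k / real 1..(real k + 1) / real 1}"
    show sq: "(i, (0, flip b 0) + s *\<^sub>R (0, dir b)) \<in> squares n"
      unfolding pos squares_iff flip_in_01 using i k s by auto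
    assume "0 < s" "s < 1"
    then show "pt (i, (0, flip b 0) + s *\<^sub>R (0, dir b)) \<notin> cones"
      using sq unfolding pos by (intro not_cone_if_not_corner) (auto simp: flip_def split: if_splits)
  qed (use i in auto)
qed

theorem visibility_torus_if_few_regular:
  assumes few: "2 * card regular < n"
  shows "visibility_torus n \<sigma> \<tau>"
  unfolding visibility_torus_def
proof
  fix v assume "v \<in> RP"
  then obtain a b where v: "v = (real_of_int a, real_of_int b)" and cop: "coprime a b" by (auto simp: RP_def)
  consider "a = 0" | "b = 0" | "a \<noteq> 0" "b \<noteq> 0" by blast
  then show "v \<in> Hol n \<sigma> \<tau>"
  proof cases
    case 1
    then have "v = (0, dir (b < 0))" using v cop by (auto simp: dir_def abs_if split: if_splits)
    then show ?thesis using vertical_in_Hol[OF few] by metis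
  next
    case 2
    then have "v = (dir (a < 0), 0)" using v cop by (auto simp: dir_def abs_if split: if_splits)
    then show ?thesis using horizontal_in_Hol[OF few] by metis
  next
    case 3
    have "v = (dir (a < 0) * real (nat \<bar>a\<bar>), dir (b < 0) * real (nat \<bar>b\<bar>))"
      using v by (simp add: dir_def)
    moreover have "coprime (nat \<bar>a\<bar>) (nat \<bar>b\<bar>)"
      using cop by (metis coprime_abs_left_iff coprime_abs_right_iff coprime_int_iff abs_ge_zero nat_0_le)
    ultimately show ?thesis
      using primitive_in_Hol[OF few, of "nat \<bar>a\<bar>" "nat \<bar>b\<bar>" "a < 0" "b < 0"] 3 by simp
  qed
qed

section \<open>Surfaces without regular squares\<close>

lemma corner_cone_if_no_regular:
  assumes none: "regular = {}" and p: "(i, x, y) \<in> squares n" "corner (x, y)"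
  shows "pt (i, x, y) \<in> cones"
proof -
  obtain \<rho> where \<rho>: "\<rho> permutes \<Omega>" "\<And>j. j \<in> \<Omega> \<Longrightarrow> pt (\<rho> j, x, y) = pt (j, 1, 1)"
    using corner_representatives[of x y] p(2) by auto
  have "i \<in> \<Omega>" using p(1) by (simp add: squares_iff)
  then obtain j where "j \<in> \<Omega>" "i = \<rho> j" using permutes_image[OF \<rho>(1)] by blast
  then show ?thesis using \<rho>(2)[of j] cone_corner_iff[of j] none by simp
qed

lemma no_marks_if_no_regular:
  assumes none: "regular = {}"
  shows "marks = {}"
proof -
  have False if "P \<in> marks" for P
  proof -
    have "P \<in> surface n \<sigma> \<tau>" using that marks_in_surface by blast
    then obtain p where p: "p \<in> squares n" "P = pt p" by (rule in_surfaceE)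
    obtain i x y where ixy: "p = (i, x, y)" by (cases p)
    then have "on_torus i" using on_torus_if_marked p that by simp
    moreover have sq: "(i, 1, 1) \<in> squares n" using p ixy by (simp add: squares_iff)
    then have "\<not> on_torus i" using not_on_torus_if_cone[OF sq] corner_cone_if_no_regular[OF none sq] by simp
    ultimately show False by blast
  qed
  then show ?thesis by blast
qed

lemma exists_subinterval:
  fixes t :: "nat \<Rightarrow> real"
  assumes "t 0 \<le> s" "s \<le> t m" "0 < m"
  shows "\<exists>k<m. s \<in> {t k..t (Suc k)}"
  using assms(2,3)
proof (induction m)
  case (Suc m)
  show ?case
  proof (cases "t m \<le> s")
    case False
    then have "0 < m" using assms(1) by (cases m) auto
    then obtain k where "k < m" "s \<in> {t k..t (Suc k)}" using Suc.IH False by auto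
    then show ?thesis using less_SucI by blast
  qed (use Suc in auto)
qed simp

text \<open>Every vertex is a cone point, so there are no marked points and a saddle connection runs
  from corner to corner, which makes \<open>v\<close> integral. If its coordinates had a common
  divisor \<open>d > 1\<close>, the point at parameter \<open>1 / d\<close> would be a cone point in
  the interior.\<close>

lemma Hol_subset_RP:
  assumes none: "regular = {}"
  shows "Hol n \<sigma> \<tau> \<subseteq> RP"
proof
  fix v assume "v \<in> Hol n \<sigma> \<tau>"
  then obtain \<gamma> where seg: "straight_segment n \<sigma> \<tau> v \<gamma>"
    and g0: "\<gamma> 0 \<in> cones" and g1: "\<gamma> 1 \<in> cones" and g: "\<And>s. 0 < s \<Longrightarrow> s < 1 \<Longrightarrow> \<gamma> s \<notin> cones"
    unfolding Hol_def saddle_connection_def no_marks_if_no_regular[OF none] by auto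
  obtain m t i a where v0: "v \<noteq> 0" and t0: "t 0 = 0" and tm: "t m = (1 :: real)"
    and t: "\<And>k. k < m \<Longrightarrow> t k < t (Suc k)"
    and piece: "\<And>k s. k < m \<Longrightarrow> s \<in> {t k..t (Suc k)} \<Longrightarrow>
      (i k, a k + s *\<^sub>R v) \<in> squares n \<and> \<gamma> s = pt (i k, a k + s *\<^sub>R v)"
    using seg unfolding straight_segment_def by metis
  have m: "0 < m" using t0 tm by (cases m) auto
  obtain v1 v2 where v: "v = (v1, v2)" by (cases v)
  define x y where "x k = fst (a k)" and "y k = snd (a k)" for k
  have pos: "a k + s *\<^sub>R v = (x k + s * v1, y k + s * v2)" for k s
    by (simp add: x_def y_def v prod_eq_iff)
  have sq: "(i k, x k + s * v1, y k + s * v2) \<in> squares n" and \<gamma>: "\<gamma> s = pt (i k, x k + s * v1, y k + s * v2)"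
    if "k < m" "s \<in> {t k..t (Suc k)}" for k s
    using piece[OF that] unfolding pos by auto
  have corner_int: "X \<in> \<int> \<and> Y \<in> \<int>" if "(j, X, Y) \<in> squares n" "pt (j, X, Y) \<in> cones" for j X Y
  proof -
    have "corner (X, Y)" using not_cone_if_not_corner[OF that(1)] that(2) by blast
    then show ?thesis by auto
  qed
  have int_corner: "pt (j, X, Y) \<in> cones" if "(j, X, Y) \<in> squares n" "X \<in> \<int>" "Y \<in> \<int>" for j X Y
  proof (rule corner_cone_if_no_regular[OF none that(1)])
    have "X \<in> {0..1}" "Y \<in> {0..1}" using that(1) by (simp_all add: squares_iff)
    moreover have "z \<in> {0, 1}" if "z \<in> {0..1}" "z \<in> \<int>" for z :: real
      using no_integer_between_0_1[of z] that by (cases "z = 0 \<or> z = 1") auto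
    ultimately show "corner (X, Y)" using that(2,3) by simp
  qed
  have t00: "0 \<in> {t 0..t (Suc 0)}" using t[of 0] m t0 by simp
  \<comment> \<open>The line leaves a corner, so the first offset is integral. From piece to piece
    this persists, because the two coordinates of the common end point differ by integers.\<close>
  have a_int: "x k \<in> \<int> \<and> y k \<in> \<int>" if "k < m" for k
    using that
  proof (induction k)
    case 0
    show ?case using corner_int sq[OF m t00] \<gamma>[OF m t00] g0 by simp
  next
    case (Suc k)
    let ?s = "t (Suc k)"
    have k: "k < m" and k': "Suc k < m" using Suc.prems by auto
    have s: "?s \<in> {t k..t (Suc k)}" "?s \<in> {t (Suc k)..t (Suc (Suc k))}" using t[OF k] t[OF k'] by auto
    have "x (Suc k) + ?s * v1 - (x k + ?s * v1) \<in> \<int> \<and> y (Suc k) + ?s * v2 - (y k + ?s * v2) \<in> \<int>"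
      by (rule pt_eq_int_diff[OF sq[OF k s(1)] sq[OF k' s(2)]]) (metis \<gamma> k k' s)
    then have "x (Suc k) - x k \<in> \<int>" "y (Suc k) - y k \<in> \<int>" by simp_all
    from this[THEN Ints_add] Suc.IH[OF k] show ?case by fastforce
  qed
  have v_int: "v1 \<in> \<int>" "v2 \<in> \<int>"
  proof -
    have k: "m - 1 < m" and s: "1 \<in> {t (m - 1)..t (Suc (m - 1))}"
      using m tm t[of "m - 1"] by auto
    have "x (m - 1) + 1 * v1 \<in> \<int> \<and> y (m - 1) + 1 * v2 \<in> \<int>"
      using corner_int[OF sq[OF k s]] \<gamma>[OF k s] g1 by simp
    then show "v1 \<in> \<int>" "v2 \<in> \<int>"
      using a_int[OF k] Ints_diff[of "x (m - 1) + 1 * v1" "x (m - 1)"] Ints_diff[of "y (m - 1) + 1 * v2" "y (m - 1)"]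
      by auto
  qed
  then obtain p q where pq: "v1 = real_of_int p" "v2 = real_of_int q" by (auto elim!: Ints_cases)
  have "coprime p q"
  proof (rule ccontr)
    assume nc: "\<not> coprime p q"
    let ?d = "gcd p q"
    have "p \<noteq> 0 \<or> q \<noteq> 0" using v0 v pq by (auto simp: zero_prod_def)
    then have "?d > 0" by simp
    moreover have "?d \<noteq> 1" using nc by (simp add: coprime_iff_gcd_eq_1)
    ultimately have d: "?d \<ge> 2" by linarith
    define s where "s = 1 / real_of_int ?d"
    have "2 \<le> real_of_int ?d" using d by linarith
    moreover have "0 < 1 / r" "1 / r < 1" if "2 \<le> r" for r :: real using that by simp_all
    ultimately have s01: "0 < s" "s < 1" unfolding s_def by blast+
    have "s * v1 \<in> \<int>" "s * v2 \<in> \<int>"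
      by (auto simp: s_def pq intro!: of_int_divide_in_Ints)
    obtain k where k: "k < m" "s \<in> {t k..t (Suc k)}"
      using exists_subinterval[of t s m] t0 tm m s01 by auto
    have "\<gamma> s \<in> cones"
      unfolding \<gamma>[OF k] using a_int[OF k(1)] \<open>s * v1 \<in> \<int>\<close> \<open>s * v2 \<in> \<int>\<close>
      by (intro int_corner sq[OF k]) (simp_all add: Ints_add)
    then show False using g s01 by blast
  qed
  then show "v \<in> RP" unfolding RP_def using v pq by blast
qed

theorem holonomy_torus_if_no_regular:
  assumes "0 < n" and "regular = {}"
  shows "holonomy_torus n \<sigma> \<tau>"
  using visibility_torus_if_few_regular Hol_subset_RP assms
  by (simp add: holonomy_torus_def visibility_torus_def)

section \<open>Prolongation of an edge\<close>

definition on_edge :: "bool \<Rightarrow> real \<Rightarrow> real \<times> real" where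
  "on_edge h z = (if h then (z, 1) else (1, z))"

definition along :: "bool \<Rightarrow> nat \<Rightarrow> nat" where
  "along h = (if h then \<sigma> else \<tau>)"

lemma along_permutes: "along h permutes \<Omega>"
  using sigma tau by (simp add: along_def)

text \<open>Top and right sides are followed because such a side ends in the top right corner of its
  own square and begins in that of the preceding one. So regularity of labels decides which vertices
  on the line are cone points.\<close>

lemma pt_along: "j \<in> \<Omega> \<Longrightarrow> pt (along h j, on_edge h 0) = pt (j, 1, 1)"
  using top_right_corner[of j] by (simp add: along_def on_edge_def)

lemma long_saddle_connection:
  assumes u: "u \<in> \<Omega>" "u \<notin> regular" and m: "0 < m" and last: "(along h ^^ m) u \<notin> regular"
    and between: "\<And>j. 0 < j \<Longrightarrow> j < m \<Longrightarrow> (along h ^^ j) u \<in> regular"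
  shows "(if h then (real m, 0) else (0, real m)) \<in> Hol n \<sigma> \<tau>"
proof -
  let ?v = "(if h then (real m, 0) else (0, real m))"
  \<comment> \<open>The edge leaving the top right corner of \<open>u\<close> belongs to the next
    square, hence \<open>Suc k\<close>.\<close>
  let ?i = "\<lambda>k. (along h ^^ Suc k) u"
  let ?a = "\<lambda>k. on_edge h (- real k)"
  have pos: "?a k + s *\<^sub>R ?v = on_edge h (s * m - real k)" for k s
    by (simp add: on_edge_def)
  have iu: "(along h ^^ k) u \<in> \<Omega>" for k
    using u permutes_in_image[OF along_permutes] by (induction k) auto
  have e0: "pt (?i k, on_edge h 0) = pt ((along h ^^ k) u, 1, 1)" for k
    using pt_along[OF iu] by simp
  have e1: "on_edge h 1 = (1, 1)" by (simp add: on_edge_def)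
  have on_torus_along: "on_torus (along h j) \<longleftrightarrow> on_torus j" if "j \<in> \<Omega>" for j
    using that on_torus_sigma on_torus_tau by (simp add: along_def)
  show ?thesis
  proof (rule chain_in_Hol[where m = m and i = ?i and a = ?a])
    show "0 < m" by (rule m)
    show "?v \<noteq> 0" using m by (simp add: zero_prod_def)
    show "pt (?i 0, ?a 0) \<in> cones" using e0[of 0] cone_corner_iff u by simp
    show "pt (?i (m - 1), ?a (m - 1) + ?v) \<in> cones"
    proof -
      have "?a (m - 1) + ?v = (1, 1)" using pos[of "m - 1" 1] m e1 by (simp add: of_nat_diff)
      moreover have "?i (m - 1) = (along h ^^ m) u" using m by simp
      ultimately show ?thesis using cone_corner_iff[OF iu] last by metis
    qed
    show "on_torus (?i (Suc k)) \<longleftrightarrow> on_torus (?i k)" for k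
      using on_torus_along[OF iu[of "Suc k"]] by simp
    show "pt (?i k, ?a k + ((real k + 1) / m) *\<^sub>R ?v) = pt (?i (Suc k), ?a (Suc k) + ((real k + 1) / m) *\<^sub>R ?v)" for k
    proof -
      have "(real k + 1) / m * m - real k = 1" "(real k + 1) / m * m - real (Suc k) = 0" using m by simp_all
      then show ?thesis unfolding pos using e0[of "Suc k"] e1 by metis
    qed
    fix k s assume k: "k < m" and s: "s \<in> {real k / real m..(real k + 1) / real m}"
    let ?z = "s * m - real k"
    have z: "?z \<in> {0..1}" using s m by (auto simp: field_simps)
    show sq: "(?i k, ?a k + s *\<^sub>R ?v) \<in> squares n"
      unfolding pos using z iu[of "Suc k"] by (simp add: on_edge_def squares_def)
    assume s01: "0 < s" "s < 1"
    show "pt (?i k, ?a k + s *\<^sub>R ?v) \<notin> cones"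
    proof (cases "?z \<in> {0, 1}")
      case False
      then have "\<not> corner (on_edge h ?z)" by (auto simp: on_edge_def)
      then show ?thesis
        using sq not_cone_if_not_corner[of "?i k" "fst (on_edge h ?z)" "snd (on_edge h ?z)"]
        unfolding pos by simp
    next
      case True
      then consider "?z = 0" | "?z = 1" by auto
      then show ?thesis
      proof cases
        case 1
        then have "0 < k" using s01 m by (cases k) auto
        then have "(along h ^^ k) u \<in> regular" using between k by blast
        then show ?thesis unfolding pos 1 e0 using cone_corner_iff[OF iu] by blast
      next
        case 2
        then have "s * m = real (Suc k)" by simp
        moreover have "s * m < m" using s01 m by simp
        ultimately have "Suc k < m" by linarith
        then have "?i k \<in> regular" using between by blast
        then show ?thesis unfolding pos 2 e1 using cone_corner_iff[OF iu] by blast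
      qed
    qed
  qed
qed

text \<open>
  If \<open>u\<close> has a cone point and its successor has not, the line leaving this cone point along the edges of
  the squares passes at least one regular vertex, so its holonomy vector is not primitive.
\<close>

lemma along_regular:
  assumes hol: "holonomy_torus n \<sigma> \<tau>"
  shows "along h ` regular \<subseteq> regular"
proof (rule ccontr)
  assume neg: "\<not> along h ` regular \<subseteq> regular"
  let ?\<rho> = "along h"
  have inj: "inj ?\<rho>" using along_permutes by (rule permutes_inj)
  have \<rho>_in: "?\<rho> j \<in> \<Omega> \<longleftrightarrow> j \<in> \<Omega>" for j by (rule permutes_in_image[OF along_permutes])
  have reg: "regular \<subseteq> \<Omega>" by (rule commuting_subset)
  \<comment> \<open>Without such a \<open>u\<close>, the non-regular squares would be mapped into,
    hence onto themselves, and so would the regular ones.\<close>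
  have "\<exists>u\<in>\<Omega> - regular. ?\<rho> u \<in> regular"
  proof (rule ccontr)
    assume "\<not> ?thesis"
    then have sub: "?\<rho> ` (\<Omega> - regular) \<subseteq> \<Omega> - regular" using \<rho>_in by blast
    then have "?\<rho> ` (\<Omega> - regular) = \<Omega> - regular"
      using inj by (intro endo_inj_surj) (auto intro: inj_on_subset)
    then have "?\<rho> ` regular \<inter> (\<Omega> - regular) = {}"
      using inj by (metis image_Int inj_on_subset Diff_disjoint image_empty)
    moreover have "?\<rho> ` regular \<subseteq> \<Omega>" using reg \<rho>_in by blast
    ultimately show False using neg by blast
  qed
  then obtain u where u: "u \<in> \<Omega>" "u \<notin> regular" "?\<rho> u \<in> regular" by blast
  \<comment> \<open>The orbit of \<open>u\<close> is finite and returns to \<open>u\<close>, which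
    is not regular; so the line does reach a cone point again.\<close>
  have "\<exists>N>0. (?\<rho> ^^ N) u = u"
  proof (rule funpow_inj_finite[OF inj])
    have "(?\<rho> ^^ N) u \<in> \<Omega>" for N using u \<rho>_in by (induction N) auto
    then have "{y. \<exists>N. y = (?\<rho> ^^ N) u} \<subseteq> \<Omega>" by blast
    then show "finite {y. \<exists>N. y = (?\<rho> ^^ N) u}" by (rule finite_subset) simp
  qed blast
  then obtain N where N: "0 < N" "(?\<rho> ^^ N) u \<notin> regular" using u by metis
  define m where "m = (LEAST N. 0 < N \<and> (?\<rho> ^^ N) u \<notin> regular)"
  have m: "0 < m \<and> (?\<rho> ^^ m) u \<notin> regular"
    unfolding m_def by (rule LeastI[of _ N]) (use N in blast)
  have between: "(?\<rho> ^^ j) u \<in> regular" if "0 < j" "j < m" for j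
    using not_less_Least[of j "\<lambda>N. 0 < N \<and> (?\<rho> ^^ N) u \<notin> regular"] that unfolding m_def by blast
  have "m \<noteq> 1" using m u by auto
  have "(if h then (real m, 0) else (0, real m)) \<in> Hol n \<sigma> \<tau>"
    using long_saddle_connection[OF u(1,2)] m between by blast
  then have "(if h then (real m, 0) else (0, real m)) \<in> RP" using hol by (simp add: holonomy_torus_def)
  then obtain p q where pq: "(if h then (real m, 0) else (0, real m)) = (real_of_int p, real_of_int q)" "coprime p q"
    by (auto simp: RP_def)
  have "coprime (int m) 0"
  proof (cases h)
    case True
    then have "real m = real_of_int p" "q = 0" using pq(1) by auto
    then have "int m = p" "q = 0" by linarith+
    then show ?thesis using pq(2) by simp
  next
    case False
    then have "real m = real_of_int q" "p = 0" using pq(1) by auto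
    then have "int m = q" "p = 0" by linarith+
    then show ?thesis using pq(2) by (simp add: coprime_commute)
  qed
  then show False using m \<open>m \<noteq> 1\<close> by simp
qed

theorem regular_invariant_if_holonomy_torus:
  assumes "holonomy_torus n \<sigma> \<tau>"
  shows "\<sigma> ` regular \<subseteq> regular" "\<tau> ` regular \<subseteq> regular"
  using along_regular[OF assms, of True] along_regular[OF assms, of False] by (simp_all add: along_def)

end

section \<open>Probabilities\<close>

lemma sym_group_nonempty: "sym_group n \<noteq> {}"
proof -
  have "id \<in> sym_group n" by (simp only: sym_group_def mem_Collect_eq permutes_id)
  then show ?thesis by blast
qed

lemma prob_random_pair:
  "measure_pmf.prob (random_pair n) {(\<sigma>, \<tau>). Q \<sigma> \<tau>}
    = real (card {(\<sigma>, \<tau>). \<sigma> permutes {1..n} \<and> \<tau> permutes {1..n} \<and> Q \<sigma> \<tau>}) / (fact n)\<^sup>2"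
proof -
  let ?S = "sym_group n"
  have fin: "finite ?S" and card: "card ?S = fact n"
    by (simp_all add: sym_group_def finite_permutations card_permutations)
  have ne: "?S \<noteq> {}" by (rule sym_group_nonempty)
  have "measure_pmf.prob (random_pair n) {(\<sigma>, \<tau>). Q \<sigma> \<tau>}
      = real (card ((?S \<times> ?S) \<inter> {(\<sigma>, \<tau>). Q \<sigma> \<tau>})) / real (card (?S \<times> ?S))"
    unfolding random_pair_def using fin ne by (intro measure_pmf_of_set) auto
  also have "(?S \<times> ?S) \<inter> {(\<sigma>, \<tau>). Q \<sigma> \<tau>} = {(\<sigma>, \<tau>). \<sigma> permutes {1..n} \<and> \<tau> permutes {1..n} \<and> Q \<sigma> \<tau>}"
    by (auto simp: sym_group_def)
  also have "real (card (?S \<times> ?S)) = (fact n)\<^sup>2"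
    by (simp add: card_cartesian_product card power2_eq_square)
  finally show ?thesis .
qed

lemma finite_permutation_pairs:
  "finite A \<Longrightarrow> finite {(\<sigma>, \<tau>). \<sigma> permutes A \<and> \<tau> permutes A \<and> Q \<sigma> \<tau>}"
  by (rule finite_subset[of _ "{\<sigma>. \<sigma> permutes A} \<times> {\<tau>. \<tau> permutes A}"])
    (auto simp: finite_permutations)

lemma prob_many_regular_le:
  "measure_pmf.prob (random_pair n) {(\<sigma>, \<tau>). n \<le> 2 * card (commuting {1..n} \<sigma> \<tau>)}
     \<le> 2 * exp (2 ^ 18) / 2 powr (real n / 2)"
  using card_pairs_many_commuting_le[of "{1..n}"]
  unfolding prob_random_pair by (simp add: divide_simps mult_ac)

lemma prob_invariant_le:
  assumes "2 \<le> n"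
  shows "measure_pmf.prob (random_pair n)
      {(\<sigma>, \<tau>). \<exists>B. B \<noteq> {} \<and> B \<subset> {1..n} \<and> \<sigma> ` B \<subseteq> B \<and> \<tau> ` B \<subseteq> B} \<le> 4 / real n"
  using card_pairs_invariant_le[of "{1..n}"] assms
  unfolding prob_random_pair by (simp add: divide_simps mult_ac)

lemma prob_no_regular_approx:
  assumes "2 \<le> n"
  shows "\<bar>measure_pmf.prob (random_pair n) {(\<sigma>, \<tau>). commuting {1..n} \<sigma> \<tau> = {}} - 1 / exp 1\<bar> \<le> 146 / real n"
proof -
  let ?c = "real (card {(\<sigma>, \<tau>). \<sigma> permutes {1..n} \<and> \<tau> permutes {1..n} \<and> commuting {1..n} \<sigma> \<tau> = {}})"
  have pos: "(0::real) < (fact n)\<^sup>2" by simp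
  have "?c / (fact n)\<^sup>2 - 1 / exp 1 = (?c - (fact n)\<^sup>2 / exp 1) / (fact n)\<^sup>2"
    by (simp add: diff_divide_distrib)
  then have "\<bar>?c / (fact n)\<^sup>2 - 1 / exp 1\<bar> = \<bar>?c - (fact n)\<^sup>2 / exp 1\<bar> / (fact n)\<^sup>2"
    using pos by (simp only: abs_divide abs_of_pos)
  moreover have "(real n - 1) * \<bar>?c - (fact n)\<^sup>2 / exp 1\<bar> \<le> 73 * (fact n)\<^sup>2"
    using card_pairs_not_commuting_approx[of "{1..n}"] assms by simp
  ultimately have "(real n - 1) * \<bar>?c / (fact n)\<^sup>2 - 1 / exp 1\<bar> \<le> 73"
    using pos by (simp add: pos_divide_le_eq)
  \<comment> \<open>Passing from \<open>n - 1\<close> to \<open>n / 2\<close> costs a factor 2,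
    hence \<open>146 = 2 * 73\<close>.\<close>
  moreover have "real n / 2 * \<bar>?c / (fact n)\<^sup>2 - 1 / exp 1\<bar> \<le> (real n - 1) * \<bar>?c / (fact n)\<^sup>2 - 1 / exp 1\<bar>"
    using assms by (intro mult_right_mono) auto
  ultimately have "real n / 2 * \<bar>?c / (fact n)\<^sup>2 - 1 / exp 1\<bar> \<le> 73" by linarith
  then show ?thesis unfolding prob_random_pair using assms by (simp add: pos_le_divide_eq mult.commute)
qed

text \<open>From below, surfaces without regular squares are holonomy tori. From above, any further
  holonomy torus has a nonempty invariant set of regular squares, which is a proper subset or
  everything; both are rare. The constant is \<open>150 = 146 + 4\<close>.\<close>

lemma prob_holonomy_torus_approx:
  assumes n: "2 \<le> n"
  shows "\<bar>measure_pmf.prob (random_pair n) {(\<sigma>, \<tau>). holonomy_torus n \<sigma> \<tau>} - 1 / exp 1\<bar>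
    \<le> 150 / real n + 2 * exp (2 ^ 18) / 2 powr (real n / 2)"
proof -
  let ?P = "\<lambda>Q. {(\<sigma>, \<tau>). \<sigma> permutes {1..n} \<and> \<tau> permutes {1..n} \<and> Q \<sigma> \<tau>}"
  let ?pr = "\<lambda>Q. measure_pmf.prob (random_pair n) {(\<sigma>, \<tau>). Q \<sigma> \<tau>}"
  let ?H = "holonomy_torus n"
  let ?Z = "\<lambda>\<sigma> \<tau>. commuting {1..n} \<sigma> \<tau> = {}"
  let ?M = "\<lambda>\<sigma> \<tau>. n \<le> 2 * card (commuting {1..n} \<sigma> \<tau>)"
  let ?V = "\<lambda>\<sigma> \<tau>. \<exists>B. B \<noteq> {} \<and> B \<subset> {1..n} \<and> \<sigma> ` B \<subseteq> B \<and> \<tau> ` B \<subseteq> B"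
  have fin: "finite (?P Q)" for Q by (intro finite_permutation_pairs) simp
  have "?P ?Z \<subseteq> ?P ?H"
    using square_tiled.holonomy_torus_if_no_regular[OF square_tiled.intro] n by auto
  then have lower: "?pr ?Z \<le> ?pr ?H"
    unfolding prob_random_pair using fin by (intro divide_right_mono of_nat_mono card_mono) auto
  have "?P ?H \<subseteq> ?P ?Z \<union> (?P ?M \<union> ?P ?V)"
  proof (rule subsetI, elim CollectE case_prodE conjE)
    fix x \<sigma> \<tau> assume x: "x = (\<sigma>, \<tau>)" and perm: "\<sigma> permutes {1..n}" "\<tau> permutes {1..n}" and H: "?H \<sigma> \<tau>"
    let ?R = "commuting {1..n} \<sigma> \<tau>"
    have inv: "\<sigma> ` ?R \<subseteq> ?R" "\<tau> ` ?R \<subseteq> ?R"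
      using square_tiled.regular_invariant_if_holonomy_torus[OF square_tiled.intro[OF perm] H] by auto
    have "?Z \<sigma> \<tau> \<or> ?M \<sigma> \<tau> \<or> ?V \<sigma> \<tau>"
    \<comment> \<open>If all squares are regular, the invariant set is not proper, but this falls
      under \<open>?M\<close>.\<close>
    proof (cases "?R = {1..n}")
      case True
      then show ?thesis by simp
    next
      case False
      with commuting_subset have "?R \<subset> {1..n}" by (rule psubsetI)
      then have "?R \<noteq> {} \<Longrightarrow> ?V \<sigma> \<tau>" using inv by (intro exI[of _ ?R] conjI)
      then show ?thesis by argo
    qed
    then show "x \<in> ?P ?Z \<union> (?P ?M \<union> ?P ?V)" 
      unfolding x Un_iff mem_Collect_eq prod.case by (simp only: perm simp_thms)
  qed
  then have "card (?P ?H) \<le> card (?P ?Z \<union> (?P ?M \<union> ?P ?V))" using fin by (intro card_mono) auto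
  also have "\<dots> \<le> card (?P ?Z) + (card (?P ?M) + card (?P ?V))"
    by (meson card_Un_le le_trans add_left_mono)
  finally have "real (card (?P ?H)) \<le> real (card (?P ?Z)) + (real (card (?P ?M)) + real (card (?P ?V)))"
    by linarith
  then have "real (card (?P ?H)) / (fact n)\<^sup>2
      \<le> (real (card (?P ?Z)) + (real (card (?P ?M)) + real (card (?P ?V)))) / (fact n)\<^sup>2"
    by (rule divide_right_mono) simp
  then have "?pr ?H \<le> ?pr ?Z + (?pr ?M + ?pr ?V)"
    unfolding prob_random_pair add_divide_distrib .
  then show ?thesis
    using lower prob_many_regular_le[of n] prob_invariant_le[OF n] prob_no_regular_approx[OF n] by linarith
qed

lemma prob_not_visibility_torus_le:
  "\<bar>1 - measure_pmf.prob (random_pair n) {(\<sigma>, \<tau>). visibility_torus n \<sigma> \<tau>}\<bar>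
     \<le> 2 * exp (2 ^ 18) / 2 powr (real n / 2)"
proof -
  let ?S = "sym_group n \<times> sym_group n"
  let ?V = "{(\<sigma>, \<tau>). visibility_torus n \<sigma> \<tau>}"
  let ?M = "{(\<sigma>, \<tau>). n \<le> 2 * card (commuting {1..n} \<sigma> \<tau>)}"
  let ?p = "measure_pmf.prob (random_pair n)"
  have supp: "set_pmf (random_pair n) = ?S"
    unfolding random_pair_def using sym_group_nonempty
    by (intro set_pmf_of_set) (auto simp: sym_group_def finite_permutations)
  have "1 - ?p ?V = ?p (- ?V)"
    using measure_pmf.prob_compl[of ?V "random_pair n"] by (simp add: Compl_eq_Diff_UNIV)
  also have "\<dots> \<le> ?p ?M"
  proof (rule measure_pmf.finite_measure_mono_AE)
    show "AE x in measure_pmf (random_pair n). x \<in> - ?V \<longrightarrow> x \<in> ?M"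
      using square_tiled.visibility_torus_if_few_regular[OF square_tiled.intro]
      by (auto simp: AE_measure_pmf_iff supp sym_group_def not_le[symmetric])
  qed simp
  finally have "1 - ?p ?V \<le> 2 * exp (2 ^ 18) / 2 powr (real n / 2)"
    using prob_many_regular_le[of n] by linarith
  then show ?thesis by (simp add: measure_pmf.prob_le_1)
qed

text \<open>Absorbs the exponentially small term of the holonomy estimate into the error of order
  \<open>1 / n\<close>.\<close>

lemma le_two_powr_half: "real n \<le> 4 * 2 powr (real n / 2)"
proof -
  have "1 + real n / 2 * ln 2 \<le> exp (real n / 2 * ln 2)" by (rule exp_ge_add_one_self)
  moreover have "real n / 2 * (1 / 2) \<le> real n / 2 * ln 2"
    using ln2_ge_two_thirds by (intro mult_left_mono) auto
  moreover have "2 powr (real n / 2) = exp (real n / 2 * ln 2)" by (simp add: powr_def)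
  ultimately show ?thesis by linarith
qed

theorem mainTheorem2:
  shows "(\<lambda>n. measure_pmf.prob (random_pair n) {(\<sigma>, \<tau>). holonomy_torus n \<sigma> \<tau>} - 1 / exp 1)
           \<in> O(\<lambda>n. 1 / real n) \<and>
         (\<lambda>n. 1 - measure_pmf.prob (random_pair n) {(\<sigma>, \<tau>). visibility_torus n \<sigma> \<tau>})
           \<in> O(\<lambda>n. real n / 2 powr (real n / 2))"
proof
  have "\<forall>\<^sub>F n in sequentially.
      norm (measure_pmf.prob (random_pair n) {(\<sigma>, \<tau>). holonomy_torus n \<sigma> \<tau>} - 1 / exp 1)
      \<le> (150 + 8 * exp (2 ^ 18)) * norm (1 / real n)"
    using eventually_ge_at_top[of 2]
  proof eventually_elim
    case (elim n)
    have "1 / 2 powr (real n / 2) \<le> 4 / real n"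
      using le_two_powr_half[of n] elim by (simp add: field_simps)
    then have "2 * exp (2 ^ 18) * (1 / 2 powr (real n / 2)) \<le> 2 * exp (2 ^ 18) * (4 / real n)"
      by (intro mult_left_mono) auto
    then have "150 / real n + 2 * exp (2 ^ 18) / 2 powr (real n / 2) \<le> (150 + 8 * exp (2 ^ 18)) * (1 / real n)"
      by (simp add: algebra_simps)
    with prob_holonomy_torus_approx[OF elim] show ?case by simp
  qed
  then show "(\<lambda>n. measure_pmf.prob (random_pair n) {(\<sigma>, \<tau>). holonomy_torus n \<sigma> \<tau>} - 1 / exp 1)
      \<in> O(\<lambda>n. 1 / real n)"
    by (rule bigoI)
  have "\<forall>\<^sub>F n in sequentially.
      norm (1 - measure_pmf.prob (random_pair n) {(\<sigma>, \<tau>). visibility_torus n \<sigma> \<tau>})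
      \<le> 2 * exp (2 ^ 18) * norm (real n / 2 powr (real n / 2))"
    using eventually_ge_at_top[of 1]
  proof eventually_elim
    case (elim n)
    have "1 / 2 powr (real n / 2) \<le> real n / 2 powr (real n / 2)"
      using elim by (intro divide_right_mono) auto
    then have "2 * exp (2 ^ 18) * (1 / 2 powr (real n / 2)) \<le> 2 * exp (2 ^ 18) * (real n / 2 powr (real n / 2))"
      by (intro mult_left_mono) auto
    with prob_not_visibility_torus_le[of n] show ?case by simp
  qed
  then show "(\<lambda>n. 1 - measure_pmf.prob (random_pair n) {(\<sigma>, \<tau>). visibility_torus n \<sigma> \<tau>})
      \<in> O(\<lambda>n. real n / 2 powr (real n / 2))"
    by (rule bigoI)
qed

end
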